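(* For real $x>0$ let $$S(x)=\sum_{\rho}\frac{x^{\rho/2}\,\Gamma\!\left(1-\frac{\rho}{2}\right)}{\zeta'(\rho)}-\frac{x}{(2\pi)^2}\int_{0}^{\infty}e^{-xt/(2\pi)^2}\left(\sum_{n\ge1}\frac{\mu(n)}{n}\cos\!\left(\frac{\sqrt{t}}{n}\right)\right)dt,$$ where $\rho$ runs over the nontrivial zeros of the Riemann zeta function $\zeta$ and $\mu$ is the Möbius function. Then the Riemann hypothesis holds if and only if, for every $\epsilon>0$, $S(x)=O(x^{\frac14+\epsilon})$ as $x\to\infty$.
   Context: $\mu(n)$ denotes the Möbius function and $\Gamma$ the Gamma function. The nontrivial zeros $\rho$ of $\zeta$ are assumed to be simple, so that $\zeta'(\rho)\neq 0$ and each term of the sum over $\rho$ is defined; the sum over $\rho$ is understood as the limit of partial sums over zeros taken in order of increasing $|\Im\rho|$ (along a suitable sequence of heights). The Riemann hypothesis is the assertion that all nontrivial zeros of $\zeta$ have real part $\frac12$. *)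

theory Defs
  imports
    "HOL-Complex_Analysis.Complex_Analysis"
    "HOL-Computational_Algebra.Computational_Algebra"
    "HOL-Library.Landau_Symbols"
begin

text \<open>The Riemann zeta function is the analytic continuation of its Dirichlet series to the
  plane without the pole \<open>1\<close>. The condition \<open>f 1 = 0\<close> only fixes a junk value
  at the pole, so that the description is unique.\<close>

definition zeta :: "complex \<Rightarrow> complex" where
  "zeta = (THE f. f holomorphic_on - {1}
                \<and> (\<forall>s. Re s > 1 \<longrightarrow> (\<lambda>n. 1 / of_nat (Suc n) powr s) sums f s)
                \<and> f 1 = 0)"

text \<open>The point \<open>1\<close> has to be excluded because of the junk value of \<open>zeta\<close> there.\<close>

definition nontrivial_zeros :: "complex set" where
  "nontrivial_zeros =
     {\<rho>. \<rho> \<noteq> 1 \<and> zeta \<rho> = 0 \<and> \<not> (\<exists>k::nat. k \<ge> 1 \<and> \<rho> = - of_nat (2 * k))}"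

definition riemann_hypothesis :: bool where
  "riemann_hypothesis \<longleftrightarrow> (\<forall>\<rho>\<in>nontrivial_zeros. Re \<rho> = 1 / 2)"

definition moebius :: "nat \<Rightarrow> real" where
  "moebius n = (if squarefree n then (-1) ^ card (prime_factors n) else 0)"

definition zero_sum_upto :: "real \<Rightarrow> real \<Rightarrow> complex" where
  "zero_sum_upto T x =
     (\<Sum>\<rho> | \<rho> \<in> nontrivial_zeros \<and> \<bar>Im \<rho>\<bar> \<le> T.
        of_real x powr (\<rho> / 2) * Gamma (1 - \<rho> / 2) / deriv zeta \<rho>)"

definition cos_series :: "real \<Rightarrow> real" where
  "cos_series t = (\<Sum>n. moebius (Suc n) / real (Suc n) * cos (sqrt t / real (Suc n)))"

text \<open>The function \<open>S\<close>, where the sum over the zeros is the limit of its partial sums along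
  the sequence of heights \<open>T\<close>.\<close>

definition S_along :: "(nat \<Rightarrow> real) \<Rightarrow> real \<Rightarrow> complex" where
  "S_along T x =
     lim (\<lambda>k. zero_sum_upto (T k) x)
     - of_real (x / (2 * pi)\<^sup>2 * (LBINT t:{0..}. exp (- x * t / (2 * pi)\<^sup>2) * cos_series t))"

definition admissible_heights :: "(nat \<Rightarrow> real) \<Rightarrow> bool" where
  "admissible_heights T \<longleftrightarrow>
     strict_mono T \<and> filterlim T at_top sequentially
     \<and> (\<forall>x>0. convergent (\<lambda>k. zero_sum_upto (T k) x))"

end

theory Submission
  imports Defs "HOL-Real_Asymp.Real_Asymp"
begin

text \<open>Integrating \<open>F(s) x\<^sup>s\<^sup>/\<^sup>2\<close> with \<open>F(s) = \<Gamma>(1 - s/2) / \<zeta>(s)\<close> around rectangles whose horizontal sides avoid the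
  zeros shows that the sum over \<open>\<rho>\<close> is the difference of the integrals over the lines \<open>Re s = 5/4\<close>
  and \<open>Re s = -1/2\<close>; the latter and the term with the cosine series are bounded as \<open>x \<rightarrow> \<infinity>\<close>. Under the
  Riemann hypothesis the right-hand line may be moved to \<open>Re s = 1/2 + 2\<epsilon>\<close>, because Borel--Caratheodory
  makes \<open>1/\<zeta>\<close> polynomially bounded there. Conversely, the growth bound lets the Mellin transform of the
  line integral continue \<open>F(2w)\<close> holomorphically to \<open>Re w > 1/4 + \<epsilon>\<close>, so \<open>\<zeta>\<close> has no zeros with
  \<open>Re s > 1/2\<close>, and the functional equation does the rest. Zeros in a disc are counted by a Jensen type
  argument, which leaves heights \<open>T\<close> with \<open>|\<zeta>(\<sigma> + i T)| \<ge> exp (-T/4)\<close>; this is beaten by the decay of \<open>\<Gamma>\<close>.\<close>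

subsection \<open>Tools from complex analysis\<close>

text \<open>One exponential budget fixes the constants. \<open>Gamma (1 - s/2)\<close> decays like
  exp(-(pi/4)|Im s|) up to powers; the rate 3/4 < pi/4 absorbs the powers, and a loss of exp(T/4)
  from \<open>1/zeta\<close> still leaves the rate 1/2 recorded in \<open>line_bounded\<close>. The
  lines are confined to -1 < Re s < 2, because the trapezoidal formula for \<open>zeta\<close> stops
  at -1 and the Gamma factor has its first pole at 2. Zeros are only known to satisfy 0 <= Re \<rho>
  <= 1, edges included, so the right-hand lines stay strictly beyond 1, at 5/4 and 7/4; there are
  two because the transform on one line is continued by moving it across the pole s = 2w to the
  other. Left of Re s = 1/2 nothing bounds \<open>1/zeta\<close> directly; there the functional
  equation trades s for 1 - s, and the Gamma factors regroup into a single decaying one. Good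
  heights exist because only O(log n) zeros lie near height n: some height keeps a distance of order
  1/log n from all of them, and the product of the distances is at least exp(-O(log n log log n)),
  far above exp(-n/4).\<close>

lemma holomorphic_on_lebesgue_integral:
  fixes f :: "complex \<Rightarrow> 'a \<Rightarrow> complex"
  assumes "open U"
    and hol: "\<And>t. t \<in> space M \<Longrightarrow> (\<lambda>w. f w t) holomorphic_on U"
    and meas: "\<And>w. w \<in> U \<Longrightarrow> f w \<in> borel_measurable M"
    and dom: "\<And>w0. w0 \<in> U \<Longrightarrow> \<exists>r>0. \<exists>g. ball w0 r \<subseteq> U \<and> integrable M g \<and>
                 (\<forall>w\<in>ball w0 r. \<forall>t\<in>space M. norm (f w t) \<le> g t)"
  shows "(\<lambda>w. integral\<^sup>L M (f w)) holomorphic_on U"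
proof -
  have "(\<lambda>w. integral\<^sup>L M (f w)) field_differentiable (at w0)" if w0: "w0 \<in> U" for w0
  proof -
    obtain r g where r: "r > 0" "ball w0 r \<subseteq> U" and g: "integrable M g"
      and le: "\<And>w t. w \<in> ball w0 r \<Longrightarrow> t \<in> space M \<Longrightarrow> norm (f w t) \<le> g t"
      using dom[OF w0] by blast
    define D where "D t = deriv (\<lambda>w. f w t) w0" for t
    have int: "integrable M (f w)" if "w \<in> ball w0 r" for w
    proof (rule Bochner_Integration.integrable_bound[OF g])
      show "f w \<in> borel_measurable M" using that r by (auto intro!: meas)
      show "AE t in M. norm (f w t) \<le> norm (g t)"
        using le[OF that] by (intro AE_I2) fastforce
    qed
    \<comment> \<open>Cauchy's inequality turns the majorant of f into one for its difference
      quotients: discs of radius r/3 about points of the half ball stay in the full ball, since 1/2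
      + 1/3 < 1. This is what dominated convergence needs.\<close>
    have bnd: "norm (f w t - f w0 t) \<le> g t * (3 / r) * norm (w - w0)"
      if w: "w \<in> ball w0 (r/2)" and t: "t \<in> space M" for w t
    proof (rule field_differentiable_bound[of "ball w0 (r/2)" "\<lambda>w. f w t" "deriv (\<lambda>w. f w t)"])
      fix z assume z: "z \<in> ball w0 (r/2)"
      have sub: "cball z (r/3) \<subseteq> ball w0 r"
      proof
        fix y assume "y \<in> cball z (r/3)"
        then have "dist w0 z < r / 2" "dist z y \<le> r / 3" using z by simp_all
        then have "dist w0 y < r" using dist_triangle[of w0 y z] r(1) by linarith
        then show "y \<in> ball w0 r" by simp
      qed
      have hol': "(\<lambda>w. f w t) holomorphic_on ball w0 r"
        using hol[OF t] r holomorphic_on_subset by blast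
      have "z \<in> ball w0 r" using z r by auto
      then show "((\<lambda>w. f w t) has_field_derivative deriv (\<lambda>w. f w t) z) (at z within ball w0 (r/2))"
        using holomorphic_derivI[OF hol' open_ball] by blast
      have "norm ((deriv ^^ 1) (\<lambda>w. f w t) z) \<le> fact 1 * g t / (r/3) ^ 1"
      proof (rule Cauchy_inequality)
        show "(\<lambda>w. f w t) holomorphic_on ball z (r/3)"
          by (rule holomorphic_on_subset[OF hol']) (use sub ball_subset_cball in blast)
        show "continuous_on (cball z (r/3)) (\<lambda>w. f w t)"
          by (rule holomorphic_on_imp_continuous_on, rule holomorphic_on_subset[OF hol']) (use sub in blast)
        show "0 < r / 3" using r by simp
        show "norm (f x t) \<le> g t" if "norm (z - x) = r/3" for x
          by (rule le) (use that sub t in \<open>auto simp: dist_norm\<close>)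
      qed
      then show "norm (deriv (\<lambda>w. f w t) z) \<le> g t * (3 / r)" by (simp add: field_simps)
    qed (use w r in auto)
    have quot: "((\<lambda>w. (f w t - f w0 t) / (w - w0)) \<longlongrightarrow> D t) (at w0)" if "t \<in> space M" for t
      using holomorphic_derivI[OF hol[OF that] \<open>open U\<close> w0]
      by (simp add: D_def has_field_derivative_iff)
    have "((\<lambda>w. (integral\<^sup>L M (f w) - integral\<^sup>L M (f w0)) / (w - w0)) \<longlongrightarrow> integral\<^sup>L M D) (at w0)"
      unfolding tendsto_at_iff_sequentially
    proof (intro allI impI)
      fix X :: "nat \<Rightarrow> complex" assume X: "\<forall>i. X i \<in> UNIV - {w0}" and lim: "X \<longlonglongrightarrow> w0"
      have "eventually (\<lambda>i. X i \<in> ball w0 (r/2)) sequentially"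
        using lim r by (intro topological_tendstoD) auto
      then obtain N where N: "\<And>i. i \<ge> N \<Longrightarrow> X i \<in> ball w0 (r/2)"
        by (auto simp: eventually_sequentially)
      \<comment> \<open>Dropping the first N terms puts the whole sequence into the half ball where
        \<open>bnd\<close> applies.\<close>
      define Y where "Y i = X (i + N)" for i
      have Y: "Y i \<in> ball w0 (r/2)" "Y i \<noteq> w0" "Y i \<in> ball w0 r" for i
        using N[of "i+N"] X r by (auto simp: Y_def)
      have Ylim: "Y \<longlonglongrightarrow> w0" unfolding Y_def using lim by (rule LIMSEQ_ignore_initial_segment)
      have q: "(\<lambda>i. (f (Y i) t - f w0 t) / (Y i - w0)) \<longlonglongrightarrow> D t" if "t \<in> space M" for t
        using quot[OF that] Y(2) Ylim unfolding tendsto_at_iff_sequentially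
        by (auto simp: o_def)
      have mY: "f (Y i) \<in> borel_measurable M" "f w0 \<in> borel_measurable M" for i
        using Y(3) r w0 by (auto intro!: meas)
      have "(\<lambda>i. integral\<^sup>L M (\<lambda>t. (f (Y i) t - f w0 t) / (Y i - w0))) \<longlonglongrightarrow> integral\<^sup>L M D"
      proof (rule integral_dominated_convergence[where w = "\<lambda>t. g t * (3 / r)"])
        show mi: "(\<lambda>t. (f (Y i) t - f w0 t) / (Y i - w0)) \<in> borel_measurable M" for i
          using mY by measurable
        show "D \<in> borel_measurable M"
          by (rule borel_measurable_LIMSEQ_metric[OF mi q])
        show "AE t in M. (\<lambda>i. (f (Y i) t - f w0 t) / (Y i - w0)) \<longlonglongrightarrow> D t"
          using q by (intro AE_I2)
        show "AE t in M. norm ((f (Y i) t - f w0 t) / (Y i - w0)) \<le> g t * (3 / r)" for i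
          using bnd[OF Y(1)[of i]] Y(2)[of i]
          by (intro AE_I2) (auto simp: norm_divide divide_le_eq)
        show "integrable M (\<lambda>t. g t * (3 / r))" using g by simp
      qed
      moreover have "integral\<^sup>L M (\<lambda>t. (f (Y i) t - f w0 t) / (Y i - w0)) =
          (integral\<^sup>L M (f (Y i)) - integral\<^sup>L M (f w0)) / (Y i - w0)" for i
        using int[OF Y(3)[of i]] int[of w0] r by simp
      ultimately have "(\<lambda>i. (integral\<^sup>L M (f (Y i)) - integral\<^sup>L M (f w0)) / (Y i - w0)) \<longlonglongrightarrow> integral\<^sup>L M D"
        by (simp only:)
      then show "((\<lambda>w. (integral\<^sup>L M (f w) - integral\<^sup>L M (f w0)) / (w - w0)) \<circ> X) \<longlonglongrightarrow> integral\<^sup>L M D"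
        unfolding Y_def o_def by (rule LIMSEQ_offset)
    qed
    then show ?thesis by (auto simp: field_differentiable_def has_field_derivative_iff)
  qed
  then show ?thesis
    using \<open>open U\<close> by (auto simp: holomorphic_on_def intro: field_differentiable_at_within)
qed

text \<open>Borel--Caratheodory: the logarithm of \<open>g / g 0\<close> maps the disc into a half plane, and
  the Schwarz lemma applies after mapping that half plane to the unit disc.\<close>

lemma nonvanishing_lower_bound:
  fixes g :: "complex \<Rightarrow> complex"
  assumes hol: "g holomorphic_on ball 0 r" and r: "0 < r"
    and nz: "\<And>z. z \<in> ball 0 r \<Longrightarrow> g z \<noteq> 0"
    and le: "\<And>z. z \<in> ball 0 r \<Longrightarrow> norm (g z) < K * norm (g 0)"
    and z: "norm z \<le> r1" "r1 < r"
  shows "norm (g z) \<ge> norm (g 0) * K powr (- (2 * r1 / (r - r1)))"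
proof -
  have g0: "g 0 \<noteq> 0" using nz[of 0] r by simp
  have K1: "K > 1" using le[of 0] r g0 by simp
  obtain h0 where h0: "h0 holomorphic_on ball 0 r" "\<And>z. z \<in> ball 0 r \<Longrightarrow> exp (h0 z) = g z"
    using contractible_imp_holomorphic_log[OF hol _ nz] convex_imp_contractible[OF convex_ball]
    by metis
  define h where "h z = h0 z - h0 0" for z
  have hh: "h holomorphic_on ball 0 r" unfolding h_def using h0 by (auto intro!: holomorphic_intros)
  have h00: "h 0 = 0" by (simp add: h_def)
  have eh: "exp (h z) = g z / g 0" if "z \<in> ball 0 r" for z
    using that r by (simp add: h_def exp_diff h0)
  define A where "A = ln K"
  have A: "A > 0" using K1 by (simp add: A_def)
  have reh: "exp (Re (h z)) = norm (g z) / norm (g 0)" if "z \<in> ball 0 r" for z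
    using eh[OF that] by (metis norm_divide norm_exp_eq_Re)
  have hA: "Re (h z) < A" if "z \<in> ball 0 r" for z
  proof -
    have "exp (Re (h z)) < exp A"
      using le[OF that] g0 K1 by (simp add: reh[OF that] A_def divide_less_eq)
    then show ?thesis by simp
  qed
  \<comment> \<open>u -> u / (2A - u) sends the half plane Re u < A into the unit disc and fixes 0;
    the factor r rescales the argument to the unit disc.\<close>
  define \<phi> where "\<phi> w = h (of_real r * w) / (2 * of_real A - h (of_real r * w))" for w
  have inb: "of_real r * w \<in> ball 0 r" if "norm w < 1" for w :: complex
    using that r by (simp add: norm_mult)
  have nz2: "2 * of_real A - h (of_real r * w) \<noteq> 0" if "norm w < 1" for w
  proof
    assume "2 * of_real A - h (of_real r * w) = 0"
    then have "Re (h (of_real r * w)) = 2 * A" by (simp add: complex_eq_iff)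
    with hA[OF inb[OF that]] A show False by simp
  qed
  have hr: "(\<lambda>w. h (of_real r * w)) holomorphic_on ball 0 1"
  proof -
    have "h \<circ> (\<lambda>w. of_real r * w) holomorphic_on ball 0 1"
      by (rule holomorphic_on_compose_gen[OF _ hh]) (use inb in \<open>auto intro!: holomorphic_intros\<close>)
    then show ?thesis by (simp add: o_def)
  qed
  have phol: "\<phi> holomorphic_on ball 0 1"
    unfolding \<phi>_def using hr nz2 by (intro holomorphic_intros) auto
  have plt: "norm (\<phi> w) < 1" if "norm w < 1" for w
  proof -
    let ?u = "h (of_real r * w)"
    have "(norm ?u)\<^sup>2 < (norm (2 * of_real A - ?u))\<^sup>2"
    proof -
      have "(norm (2 * of_real A - ?u))\<^sup>2 - (norm ?u)\<^sup>2 = 4 * A * (A - Re ?u)"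
        unfolding cmod_power2 by (simp add: power2_eq_square algebra_simps)
      also have "\<dots> > 0" using A hA[OF inb[OF that]] by simp
      finally show ?thesis by simp
    qed
    then have "norm ?u < norm (2 * of_real A - ?u)"
      using power2_less_imp_less norm_ge_zero by blast
    then show ?thesis using nz2[OF that] by (simp add: \<phi>_def norm_divide)
  qed
  have p0: "\<phi> 0 = 0" by (simp add: \<phi>_def h00)
  have r1: "0 \<le> r1" using z(1) norm_ge_zero order_trans by blast
  define w where "w = z / of_real r"
  have w: "norm w < 1" "norm w \<le> r1 / r" and rw: "of_real r * w = z"
    using z r by (auto simp: w_def norm_divide divide_right_mono)
  have sch: "norm (\<phi> w) \<le> r1 / r"
    using Schwarz_Lemma(1)[OF phol p0 plt w(1)] w(2) by simp
  have zb: "z \<in> ball 0 r" using z by simp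
  \<comment> \<open>The half-plane map solved for h: with |\<phi>| at most r1/r it gives |h| <= 2 A
    r1 / (r - r1), and only the lower bound on Re h is used afterwards.\<close>
  have eq: "h z * (1 + \<phi> w) = 2 * of_real A * \<phi> w"
  proof -
    have "2 * of_real A - h z \<noteq> 0" using nz2[OF w(1)] by (simp add: rw)
    then show ?thesis by (simp add: \<phi>_def rw divide_simps)
  qed
  have "norm (h z) * (1 - r1 / r) \<le> norm (h z) * norm (1 + \<phi> w)"
  proof (rule mult_left_mono)
    show "1 - r1 / r \<le> norm (1 + \<phi> w)"
      using sch norm_diff_ineq[of 1 "\<phi> w"] by simp
  qed simp
  also have "\<dots> = 2 * A * norm (\<phi> w)" using eq A by (metis (no_types) norm_mult norm_of_real abs_of_pos norm_numeral)
  also have "\<dots> \<le> 2 * A * (r1 / r)" using sch A by (intro mult_left_mono) auto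
  finally have "r * (norm (h z) * (1 - r1 / r)) \<le> r * (2 * A * (r1 / r))"
    using r by (intro mult_left_mono) auto
  also have "r * (norm (h z) * (1 - r1 / r)) = norm (h z) * (r - r1)"
    using r by (simp add: field_simps)
  also have "r * (2 * A * (r1 / r)) = A * (2 * r1)" using r by simp
  finally have "norm (h z) \<le> A * (2 * r1 / (r - r1))"
    using z by (simp add: pos_le_divide_eq)
  then have "- (A * (2 * r1 / (r - r1))) \<le> Re (h z)"
    using abs_Re_le_cmod[of "h z"] by linarith
  then have "exp (- (A * (2 * r1 / (r - r1)))) \<le> norm (g z) / norm (g 0)"
    using reh[OF zb] by (metis exp_le_cancel_iff)
  moreover have "exp (- (A * (2 * r1 / (r - r1)))) = K powr (- (2 * r1 / (r - r1)))"
    using K1 by (simp add: powr_def A_def mult.commute)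
  ultimately show ?thesis using g0 by (simp add: field_simps)
qed

section \<open>Zeros in a disc: dividing them out, counting them, and a minimum modulus
  bound\<close>

text \<open>One zero a is split off at a time. Its cofactor does not vanish at a because the zero is
  simple, so the zero set in K loses exactly a. The cofactor may still vanish in U outside
  K.\<close>

lemma divide_out_simple_zeros:
  fixes f :: "complex \<Rightarrow> complex"
  assumes "finite Z" "open U" "f holomorphic_on U" "K \<subseteq> U"
    and "Z = {z\<in>K. f z = 0}" "\<And>z. z \<in> Z \<Longrightarrow> deriv f z \<noteq> 0"
  shows "\<exists>g. g holomorphic_on U \<and> (\<forall>z\<in>U. f z = (\<Prod>\<rho>\<in>Z. z - \<rho>) * g z) \<and> (\<forall>z\<in>K. g z \<noteq> 0)"
  using assms
proof (induction Z arbitrary: f rule: finite_induct)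
  case empty
  then show ?case by (intro exI[of _ f]) auto
next
  case (insert a Z)
  have aK: "a \<in> K" "f a = 0" using insert.prems(4) by auto
  define f1 where "f1 = (\<lambda>z. if z = a then deriv f a else (f z - f a) / (z - a))"
  have f1: "f1 holomorphic_on U"
    unfolding f1_def by (rule pole_lemma_open) (use insert.prems in auto)
  have ff: "f z = (z - a) * f1 z" for z by (simp add: f1_def aK)
  have f1a: "f1 a \<noteq> 0" using insert.prems(5)[of a] by (simp add: f1_def)
  have Zeq: "Z = {z\<in>K. f1 z = 0}"
  proof (intro set_eqI iffI)
    fix z assume "z \<in> Z"
    then have "z \<in> K" "f z = 0" "z \<noteq> a" using insert.prems(4) insert.hyps by auto
    then show "z \<in> {z\<in>K. f1 z = 0}" using ff[of z] by simp
  next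
    fix z assume "z \<in> {z\<in>K. f1 z = 0}"
    then have "z \<in> insert a Z" "z \<noteq> a" using f1a ff[of z] insert.prems(4) by auto
    then show "z \<in> Z" by simp
  qed
  \<comment> \<open>By the product rule at a zero of \<open>f1\<close>, f' = (z - a) f1', so the
    other zeros stay simple.\<close>
  have "deriv f1 z \<noteq> 0" if "z \<in> Z" for z
  proof -
    have zU: "z \<in> U" and "f1 z = 0" using that Zeq insert.prems by auto
    have "(f1 has_field_derivative deriv f1 z) (at z)"
      using holomorphic_derivI[OF f1 insert.prems(1) zU] .
    then have "((\<lambda>z. (z - a) * f1 z) has_field_derivative (z - a) * deriv f1 z) (at z)"
      by (auto intro!: derivative_eq_intros simp: \<open>f1 z = 0\<close>)
    then have "deriv f z = (z - a) * deriv f1 z"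
      using DERIV_imp_deriv ff by (metis (no_types, lifting) ext)
    then show ?thesis using insert.prems(5)[of z] that by auto
  qed
  then obtain g where g: "g holomorphic_on U" "\<forall>z\<in>U. f1 z = (\<Prod>\<rho>\<in>Z. z - \<rho>) * g z" "\<forall>z\<in>K. g z \<noteq> 0"
    using insert.IH[of f1] insert.prems f1 Zeq by blast
  show ?case
    by (rule exI[of _ g]) (use g ff insert.hyps in \<open>auto simp: mult.assoc\<close>)
qed

text \<open>Jensen's argument without integrals: the zero-free cofactor g is at most B / (R - r)^N
  on |z| = R, hence inside, while |g 0| >= |f 0| / r^N. Comparing both at 0 bounds N, and 2r < R
  makes the base exceed 1. The same condition bounds |g| / |g 0| independently of N, so
  Borel--Caratheodory on the disc of radius r yields the lower bound for f.\<close>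

lemma simple_zeros_min_modulus:
  fixes f :: "complex \<Rightarrow> complex"
  assumes hol: "f holomorphic_on ball 0 R0" and R: "R < R0" "2 * r < R" and r: "0 < r1" "r1 < r"
    and le: "\<And>z. norm z \<le> R \<Longrightarrow> norm (f z) \<le> B" and f0: "f 0 \<noteq> 0"
    and Z: "Z = {z\<in>cball 0 r. f z = 0}" and simple: "\<And>z. z \<in> Z \<Longrightarrow> deriv f z \<noteq> 0"
  shows "finite Z" "((R - r) / r) ^ card Z \<le> B / norm (f 0)"
    "\<And>z. norm z \<le> r1 \<Longrightarrow> norm (f z) \<ge>
      (\<Prod>\<rho>\<in>Z. norm (z - \<rho>)) * (norm (f 0) / r ^ card Z * (2 * B / norm (f 0)) powr (- (2 * r1 / (r - r1))))"
proof -
  have R0: "0 < R" using R r by linarith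
  show fin: "finite Z"
  proof (cases "f constant_on ball 0 R0")
    case True
    then have *: "f z = f 0" if "z \<in> ball 0 R0" for z
      using that R0 R unfolding constant_on_def by (metis centre_in_ball order_less_trans)
    have "z \<notin> Z" for z using *[of z] f0 R r by (auto simp: Z)
    then have "Z = {}" by blast
    then show ?thesis by simp
  next
    case False
    show ?thesis unfolding Z
      by (rule holomorphic_compact_finite_zeros[OF hol _ _ _ _ False]) (use R r in auto)
  qed
  define K where "K = cball (0::complex) r"
  have KU: "K \<subseteq> ball 0 R0" using R r by (auto simp: K_def)
  obtain g where g: "g holomorphic_on ball 0 R0"
      "\<And>z. z \<in> ball 0 R0 \<Longrightarrow> f z = (\<Prod>\<rho>\<in>Z. z - \<rho>) * g z" "\<And>z. z \<in> K \<Longrightarrow> g z \<noteq> 0"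
    using divide_out_simple_zeros[OF fin open_ball hol KU _ simple] Z unfolding K_def by blast
  define N where "N = card Z"
  have Zr: "norm \<rho> \<le> r" "\<rho> \<noteq> 0" if "\<rho> \<in> Z" for \<rho> using that f0 unfolding Z by auto
  have B0: "0 < B" using le[of 0] f0 R0 by (smt (verit) norm_zero zero_less_norm_iff)
  have q: "R - r > 0" "(R - r) / r > 1" using R r by (auto simp: field_simps)
  have gle: "norm (g z) \<le> B / (R - r) ^ N" if "norm z \<le> R" for z
  proof (rule maximum_modulus_frontier[of g "cball 0 R"])
    show "g holomorphic_on interior (cball 0 R)"
      by (rule holomorphic_on_subset[OF g(1)]) (use R in auto)
    show "continuous_on (closure (cball 0 R)) g"
      by (rule holomorphic_on_imp_continuous_on, rule holomorphic_on_subset[OF g(1)]) (use R in auto)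
    fix w :: complex assume "w \<in> frontier (cball 0 R)"
    then have w: "norm w = R" using R0 by (simp add: frontier_cball)
    have "(R - r) ^ N = (\<Prod>\<rho>\<in>Z. (R - r))" by (simp add: N_def)
    also have "\<dots> \<le> (\<Prod>\<rho>\<in>Z. norm (w - \<rho>))"
    proof (rule prod_mono)
      fix \<rho> assume "\<rho> \<in> Z"
      then show "0 \<le> R - r \<and> R - r \<le> norm (w - \<rho>)"
        using Zr[of \<rho>] q w norm_triangle_ineq2[of w \<rho>] by auto
    qed
    finally have *: "(R - r) ^ N \<le> (\<Prod>\<rho>\<in>Z. norm (w - \<rho>))" .
    have "(R - r) ^ N * norm (g w) \<le> (\<Prod>\<rho>\<in>Z. norm (w - \<rho>)) * norm (g w)"
      using * by (rule mult_right_mono) simp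
    also have "\<dots> = norm (f w)"
      using g(2)[of w] w R by (simp add: norm_mult prod_norm)
    also have "\<dots> \<le> B" using le[of w] w by simp
    finally show "norm (g w) \<le> B / (R - r) ^ N" using q by (simp add: field_simps)
  qed (use that in auto)
  have g0: "norm (g 0) \<ge> norm (f 0) / r ^ N"
  proof -
    have "norm (f 0) = (\<Prod>\<rho>\<in>Z. norm \<rho>) * norm (g 0)"
      using g(2)[of 0] R R0 by (simp add: norm_mult prod_norm[symmetric])
    also have "\<dots> \<le> (\<Prod>\<rho>\<in>Z. r) * norm (g 0)"
      by (intro mult_right_mono prod_mono) (use Zr in auto)
    finally show ?thesis using r by (simp add: N_def field_simps)
  qed
  have "norm (f 0) / r ^ N \<le> B / (R - r) ^ N" using g0 gle[of 0] R0 by simp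
  then show "((R - r) / r) ^ card Z \<le> B / norm (f 0)"
    using q r f0 by (simp add: N_def[symmetric] power_divide field_simps)
  \<comment> \<open>The factor 2 provides the strict inequality that
    \<open>nonvanishing_lower_bound\<close> asks for.\<close>
  define L where "L = 2 * B / norm (f 0)"
  have L: "norm (g z) < L * norm (g 0)" if "z \<in> ball 0 r" for z
  proof -
    have "norm (g z) \<le> B / (R - r) ^ N" using gle that R r by auto
    also have "\<dots> \<le> B / r ^ N"
      using q r R B0 by (intro divide_left_mono power_mono mult_pos_pos) auto
    also have "\<dots> < 2 * B / norm (f 0) * (norm (f 0) / r ^ N)"
      using f0 r B0 by (simp add: divide_strict_right_mono)
    also have "\<dots> \<le> L * norm (g 0)" unfolding L_def
      using g0 B0 by (intro mult_left_mono) auto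
    finally show ?thesis .
  qed
  show "norm (f z) \<ge>
      (\<Prod>\<rho>\<in>Z. norm (z - \<rho>)) * (norm (f 0) / r ^ card Z * (2 * B / norm (f 0)) powr (- (2 * r1 / (r - r1))))"
   if "norm z \<le> r1" for z
  proof -
    have "norm (g z) \<ge> norm (g 0) * L powr (- (2 * r1 / (r - r1)))"
    proof (rule nonvanishing_lower_bound)
      show "g holomorphic_on ball 0 r" by (rule holomorphic_on_subset[OF g(1)]) (use R r in auto)
    qed (use r g(3) L that in \<open>auto simp: K_def\<close>)
    moreover have "norm (g 0) * L powr (- (2 * r1 / (r - r1))) \<ge> norm (f 0) / r ^ N * L powr (- (2 * r1 / (r - r1)))"
      using g0 by (intro mult_right_mono) auto
    ultimately have "norm (f 0) / r ^ N * L powr (- (2 * r1 / (r - r1))) \<le> norm (g z)" by linarith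
    then have "(\<Prod>\<rho>\<in>Z. norm (z - \<rho>)) * (norm (f 0) / r ^ N * L powr (- (2 * r1 / (r - r1))))
       \<le> (\<Prod>\<rho>\<in>Z. norm (z - \<rho>)) * norm (g z)"
      by (intro mult_left_mono prod_nonneg) auto
    also have "\<dots> = norm (f z)" using g(2)[of z] that R r by (simp add: norm_mult prod_norm)
    finally show ?thesis by (simp add: L_def N_def)
  qed
qed

text \<open>Pigeonhole: N + 1 candidates a + j d lie at mutual distance at least d = h / (N + 1), so
  one point of G can spoil (within d/2) at most one of them.\<close>

lemma exists_point_away_from_finite_set:
  fixes G :: "real set"
  assumes "finite G" "card G \<le> N" "h > 0"
  shows "\<exists>t\<in>{a..a + h}. \<forall>\<gamma>\<in>G. \<bar>t - \<gamma>\<bar> \<ge> h / (2 * (real N + 1))"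
proof (rule ccontr)
  assume contr: "\<not> ?thesis"
  define d where "d = h / (real N + 1)"
  have d: "d > 0" using assms by (simp add: d_def)
  have "\<exists>\<gamma>\<in>G. \<bar>a + real j * d - \<gamma>\<bar> < d / 2" if "j \<le> N" for j
  proof -
    have "real j * d \<le> (real N + 1) * d" using that d by (intro mult_right_mono) auto
    moreover have "0 \<le> real j * d" using d by simp
    moreover have "(real N + 1) * d = h" by (simp add: d_def)
    ultimately have "a + real j * d \<in> {a..a+h}" by simp
    then obtain \<gamma> where "\<gamma> \<in> G" "\<bar>a + real j * d - \<gamma>\<bar> < h / (2 * (real N + 1))"
      using contr by (meson not_le)
    moreover have "h / (2 * (real N + 1)) = d / 2" by (simp add: d_def)
    ultimately have "\<gamma> \<in> G \<and> \<bar>a + real j * d - \<gamma>\<bar> < d / 2" by metis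
    then show ?thesis by blast
  qed
  then obtain c where c: "\<And>j. j \<le> N \<Longrightarrow> c j \<in> G \<and> \<bar>a + real j * d - c j\<bar> < d / 2" by metis
  have "inj_on c {..N}"
  proof (rule inj_onI)
    fix i j assume "i \<in> {..N}" "j \<in> {..N}" "c i = c j"
    then have "\<bar>a + real i * d - c i\<bar> < d / 2" "\<bar>a + real j * d - c i\<bar> < d / 2"
      using c[of i] c[of j] by auto
    then have "\<bar>real i * d - real j * d\<bar> < d" by linarith
    then have "\<bar>real i - real j\<bar> * d < 1 * d" using d by (simp add: left_diff_distrib[symmetric] abs_mult)
    then have "\<bar>real i - real j\<bar> < 1" using d mult_less_cancel_right_pos by blast
    then show "i = j" by linarith
  qed
  then have "card {..N} \<le> card G"
    using c assms(1) by (intro card_inj_on_le[of c]) auto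
  then show False using assms(2) by simp
qed

section \<open>Rectangular contours and their limits\<close>

text \<open>Horizontal sides remain contour integrals because only their size will matter; vertical
  sides become real integrals in t, whose limits are wanted.\<close>

lemma contour_integral_rectpath:
  assumes "a < b" "c < (d::real)"
    and cont: "continuous_on (path_image (rectpath (Complex a c) (Complex b d))) f"
  shows "contour_integral (rectpath (Complex a c) (Complex b d)) f =
    contour_integral (linepath (Complex a c) (Complex b c)) f
    + \<i> * integral {c..d} (\<lambda>t. f (Complex b t))
    - contour_integral (linepath (Complex a d) (Complex b d)) f
    - \<i> * integral {c..d} (\<lambda>t. f (Complex a t))"
proof -
  let ?p = "path_image (rectpath (Complex a c) (Complex b d))"
  have p: "?p = closed_segment (Complex a c) (Complex b c) \<union> closed_segment (Complex b c) (Complex b d)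
     \<union> closed_segment (Complex b d) (Complex a d) \<union> closed_segment (Complex a d) (Complex a c)"
    by (simp add: rectpath_def Let_def path_image_join Un_assoc)
  have ci: "f contour_integrable_on linepath u v" if "closed_segment u v \<subseteq> ?p" for u v
    by (rule contour_integrable_continuous_linepath) (use cont continuous_on_subset that in blast)
  have i: "f contour_integrable_on linepath (Complex a c) (Complex b c)"
    "f contour_integrable_on linepath (Complex b c) (Complex b d)"
    "f contour_integrable_on linepath (Complex b d) (Complex a d)"
    "f contour_integrable_on linepath (Complex a d) (Complex a c)"
    by (rule ci; use p in blast)+
  have "contour_integral (rectpath (Complex a c) (Complex b d)) f =
    contour_integral (linepath (Complex a c) (Complex b c)) f
    + (contour_integral (linepath (Complex b c) (Complex b d)) f
    + (contour_integral (linepath (Complex b d) (Complex a d)) f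
    + contour_integral (linepath (Complex a d) (Complex a c)) f))"
    using i by (simp add: rectpath_def Let_def)
  also have "contour_integral (linepath (Complex b d) (Complex a d)) f =
     - contour_integral (linepath (Complex a d) (Complex b d)) f"
    using contour_integral_reversepath[of "linepath (Complex a d) (Complex b d)" f] by simp
  also have "contour_integral (linepath (Complex a d) (Complex a c)) f =
     - contour_integral (linepath (Complex a c) (Complex a d)) f"
    using contour_integral_reversepath[of "linepath (Complex a c) (Complex a d)" f] by simp
  also have "contour_integral (linepath (Complex b c) (Complex b d)) f = \<i> * integral {c..d} (\<lambda>t. f (Complex b t))"
    by (rule contour_integral_linepath_same_Re) (use assms in auto)
  also have "contour_integral (linepath (Complex a c) (Complex a d)) f = \<i> * integral {c..d} (\<lambda>t. f (Complex a t))"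
    by (rule contour_integral_linepath_same_Re) (use assms in auto)
  finally show ?thesis by simp
qed

lemma integrable_exp_minus_abs:
  fixes c :: real
  assumes "c > 0"
  shows "integrable lborel (\<lambda>t. exp (- c * \<bar>t\<bar>))"
proof -
  have 1: "(\<lambda>t. exp (- c * t)) absolutely_integrable_on {0..}"
    using integrable_on_exp_minus_to_infinity[OF assms, of 0]
    by (intro nonnegative_absolutely_integrable_1) auto
  then have 1: "set_integrable lborel {0..} (\<lambda>t. exp (- c * t))"
    unfolding set_integrable_def by (subst (asm) integrable_completion) auto
  then have 2: "integrable lborel (\<lambda>t. indicator {0..} (-t) *\<^sub>R exp (- c * (-t)))"
    unfolding set_integrable_def using lborel_integrable_real_affine[OF 1[unfolded set_integrable_def], of "-1" 0] by simp
  show ?thesis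
    by (rule Bochner_Integration.integrable_bound[OF Bochner_Integration.integrable_add[OF 1[unfolded set_integrable_def] 2]])
       (auto simp: indicator_def)
qed

lemma integral_symmetric_interval_tendsto:
  fixes f :: "real \<Rightarrow> complex"
  assumes f: "integrable lborel f" and T: "filterlim T at_top sequentially"
  shows "(\<lambda>k. integral {- T k..T k} f) \<longlonglongrightarrow> integral\<^sup>L lborel f"
proof -
  have "set_integrable lborel {- T k..T k} f" for k
    unfolding set_integrable_def using f by (intro integrable_mult_indicator) auto
  then have eq: "integral {- T k..T k} f = (\<integral>t. indicator {- T k..T k} t *\<^sub>R f t \<partial>lborel)" for k
    using set_borel_integral_eq_integral(2) unfolding set_lebesgue_integral_def by metis
  show ?thesis unfolding eq
  proof (rule integral_dominated_convergence[where w = "\<lambda>t. norm (f t)"])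
    show "AE t in lborel. (\<lambda>k. indicator {- T k..T k} t *\<^sub>R f t) \<longlonglongrightarrow> f t"
    proof (rule AE_I2)
      fix t :: real
      have "eventually (\<lambda>k. \<bar>t\<bar> \<le> T k) sequentially"
        using T by (simp add: filterlim_at_top)
      then have "eventually (\<lambda>k. indicator {- T k..T k} t *\<^sub>R f t = f t) sequentially"
        by eventually_elim (auto simp: indicator_def abs_le_iff)
      then show "(\<lambda>k. indicator {- T k..T k} t *\<^sub>R f t) \<longlonglongrightarrow> f t"
        by (rule tendsto_eventually)
    qed
  qed (use f in \<open>auto simp: indicator_def\<close>)
qed

lemma integral_tail_tendsto:
  fixes f :: "real \<Rightarrow> complex"
  assumes f: "integrable lborel (\<lambda>x. indicat_real {a..} x *\<^sub>R f x)" and a: "0 \<le> a"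
  shows "(\<lambda>k. integral {a..a + real k} f) \<longlonglongrightarrow> (\<integral>x. indicat_real {a..} x *\<^sub>R f x \<partial>lborel)"
proof -
  \<comment> \<open>Since a >= 0, the indicator cuts the symmetric interval down to [a, a + k],
    which reduces the tail to the symmetric case.\<close>
  have eq: "integral {- (a + real k)..a + real k} (\<lambda>x. indicat_real {a..} x *\<^sub>R f x) = integral {a..a + real k} f" for k
  proof -
    have "integral {- (a + real k)..a + real k} (\<lambda>x. indicat_real {a..} x *\<^sub>R f x)
       = integral {- (a + real k)..a + real k} (\<lambda>x. if x \<in> {a..} then f x else 0)"
      by (intro integral_cong) (auto simp: indicator_def)
    also have "\<dots> = integral ({a..} \<inter> {- (a + real k)..a + real k}) f" by (rule integral_restrict_Int)
    also have "{a..} \<inter> {- (a + real k)..a + real k} = {a..a + real k}" using a by auto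
    finally show ?thesis .
  qed
  have "filterlim (\<lambda>k. a + real k) at_top sequentially" by real_asymp
  from integral_symmetric_interval_tendsto[OF f this] show ?thesis by (simp only: eq)
qed

text \<open>The rectangle sits in a slightly larger open rectangle that may contain further poles;
  their winding numbers vanish.\<close>

lemma residue_sum_tendsto_vertical_integrals:
  fixes G :: "complex \<Rightarrow> complex" and T :: "nat \<Rightarrow> real"
  assumes ab: "\<alpha> < a" "a < b" "b < \<beta>"
    and hol: "G holomorphic_on {s. \<alpha> < Re s \<and> Re s < \<beta>} - P"
    and fin: "\<And>R. finite {p\<in>P. \<bar>Im p\<bar> \<le> R}"
    and P: "\<And>p. p \<in> P \<Longrightarrow> a < Re p \<and> Re p < b"
    and T: "filterlim T at_top sequentially"
    and TP: "\<And>k p. p \<in> P \<Longrightarrow> \<bar>Im p\<bar> \<noteq> T k"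
    and hor: "\<And>k s. a \<le> Re s \<Longrightarrow> Re s \<le> b \<Longrightarrow> \<bar>Im s\<bar> = T k \<Longrightarrow> norm (G s) \<le> h k" "h \<longlonglongrightarrow> 0"
    and inta: "integrable lborel (\<lambda>t. G (Complex a t))"
    and intb: "integrable lborel (\<lambda>t. G (Complex b t))"
  shows "(\<lambda>k. \<Sum>p | p \<in> P \<and> \<bar>Im p\<bar> \<le> T k. residue G p) \<longlonglongrightarrow>
    ((\<integral>t. G (Complex b t) \<partial>lborel) - (\<integral>t. G (Complex a t) \<partial>lborel)) / (2 * pi)"
proof -
  define H where "H c k = contour_integral (linepath (Complex a (c * T k)) (Complex b (c * T k))) G" for c k
  define R where "R k = (\<Sum>p | p \<in> P \<and> \<bar>Im p\<bar> \<le> T k. residue G p)" for k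
  define V where "V c k = integral {- T k..T k} (\<lambda>t. G (Complex c t))" for c k
  have contG: "continuous_on {s. \<alpha> < Re s \<and> Re s < \<beta> \<and> s \<notin> P} G"
    using holomorphic_on_imp_continuous_on[OF hol] by (rule continuous_on_subset) auto
  have main: "R k = (H (-1) k - H 1 k) / (2 * pi * \<i>) + (V b k - V a k) / (2 * pi)
      \<and> norm (H (-1) k) \<le> h k * (b - a) \<and> norm (H 1 k) \<le> h k * (b - a)" if T0: "T k > 0" for k
  proof -
    define S where "S = box (Complex \<alpha> (-(T k + 1))) (Complex \<beta> (T k + 1))"
    define pts where "pts = P \<inter> S"
    let ?rp = "rectpath (Complex a (- T k)) (Complex b (T k))"
    have S: "s \<in> S \<longleftrightarrow> \<alpha> < Re s \<and> Re s < \<beta> \<and> \<bar>Im s\<bar> < T k + 1" for s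
      by (auto simp: S_def in_box_complex_iff)
    have finpts: "finite pts"
      by (rule finite_subset[OF _ fin[of "T k + 1"]]) (auto simp: pts_def S)
    have pim: "path_image ?rp = {z. Re z \<in> {a, b} \<and> Im z \<in> {- T k..T k}} \<union>
           {z. Im z \<in> {- T k, T k} \<and> Re z \<in> {a..b}}"
      using ab T0 by (subst path_image_rectpath) auto
    have notP: "z \<notin> P" if "z \<in> path_image ?rp" for z
      using that P[of z] TP[of z k] T0 ab unfolding pim by auto
    have pS: "path_image ?rp \<subseteq> S - pts"
      using notP T0 ab by (auto simp: pts_def) (auto simp: pim S)
    have res: "contour_integral ?rp G = 2 * pi * \<i> * (\<Sum>p\<in>pts. winding_number ?rp p * residue G p)"
    proof (rule Residue_theorem)
      show "open S" "connected S" unfolding S_def by (auto intro: convex_connected)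
      show "G holomorphic_on S - pts"
        by (rule holomorphic_on_subset[OF hol]) (auto simp: S pts_def)
      show "\<forall>z. z \<notin> S \<longrightarrow> winding_number ?rp z = 0"
      proof (intro allI impI winding_number_rectpath_outside)
        fix z assume "z \<notin> S"
        then show "z \<notin> cbox (Complex a (- T k)) (Complex b (T k))"
          using ab by (auto simp: S in_cbox_complex_iff)
      qed (use ab T0 in auto)
    qed (use finpts pS in auto)
    have "(\<Sum>p\<in>pts. winding_number ?rp p * residue G p) = (\<Sum>p | p \<in> P \<and> \<bar>Im p\<bar> \<le> T k. winding_number ?rp p * residue G p)"
    proof (rule sum.mono_neutral_right[OF finpts])
      show "{p. p \<in> P \<and> \<bar>Im p\<bar> \<le> T k} \<subseteq> pts" using P ab by (force simp: pts_def S)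
      show "\<forall>i\<in>pts - {p. p \<in> P \<and> \<bar>Im p\<bar> \<le> T k}. winding_number ?rp i * residue G i = 0"
      proof
        fix i assume "i \<in> pts - {p. p \<in> P \<and> \<bar>Im p\<bar> \<le> T k}"
        then have "i \<notin> cbox (Complex a (- T k)) (Complex b (T k))"
          by (auto simp: pts_def in_cbox_complex_iff)
        then show "winding_number ?rp i * residue G i = 0"
          using winding_number_rectpath_outside[of "Complex a (- T k)" "Complex b (T k)" i] ab T0 by auto
      qed
    qed
    also have "\<dots> = R k" unfolding R_def
    proof (rule sum.cong)
      fix p assume p: "p \<in> {p. p \<in> P \<and> \<bar>Im p\<bar> \<le> T k}"
      then have "\<bar>Im p\<bar> < T k" using TP[of p k] by auto
      then have "winding_number ?rp p = 1"
        using P[of p] p by (intro winding_number_rectpath) (auto simp: in_box_complex_iff)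
      then show "winding_number ?rp p * residue G p = residue G p" by simp
    qed simp
    finally have res2: "contour_integral ?rp G = 2 * pi * \<i> * R k" using res by simp
    have cont: "continuous_on (path_image ?rp) G"
      by (rule continuous_on_subset[OF contG]) (use pS notP S in auto)
    have "contour_integral ?rp G = H (-1) k + \<i> * V b k - H 1 k - \<i> * V a k"
      using contour_integral_rectpath[OF ab(2) _ cont] T0 by (simp add: H_def V_def)
    then have "R k = (H (-1) k + \<i> * V b k - H 1 k - \<i> * V a k) / (2 * pi * \<i>)"
      using res2 by (subst nonzero_eq_divide_eq) (simp_all add: mult.commute)
    then have 1: "R k = (H (-1) k - H 1 k) / (2 * pi * \<i>) + (V b k - V a k) / (2 * pi)"
      by (simp add: diff_divide_distrib add_divide_distrib)
    have 2: "norm (H c k) \<le> h k * (b - a)" if c: "\<bar>c\<bar> = 1" for c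
    proof -
      have seg: "Re z \<in> {a..b} \<and> \<bar>Im z\<bar> = T k"
        if "z \<in> closed_segment (Complex a (c * T k)) (Complex b (c * T k))" for z
        using that ab c T0 closed_segment_same_Im[of "Complex a (c * T k)" "Complex b (c * T k)"]
        by (auto simp: closed_segment_eq_real_ivl abs_mult)
      have seg2: "z \<in> {s. \<alpha> < Re s \<and> Re s < \<beta> \<and> s \<notin> P}"
        if "z \<in> closed_segment (Complex a (c * T k)) (Complex b (c * T k))" for z
        using seg[OF that] TP[of z k] ab by auto
      have "norm (H c k) \<le> h k * norm (Complex b (c * T k) - Complex a (c * T k))"
        unfolding H_def
      proof (rule contour_integral_bound_linepath)
        show "G contour_integrable_on linepath (Complex a (c * T k)) (Complex b (c * T k))"
          by (rule contour_integrable_continuous_linepath, rule continuous_on_subset[OF contG])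
             (use seg2 in blast)
        have "norm (G (Complex a (T k))) \<le> h k" using hor(1)[of "Complex a (T k)" k] ab T0 by auto
        then show "0 \<le> h k" using norm_ge_zero order_trans by blast
        show "norm (G z) \<le> h k" if "z \<in> closed_segment (Complex a (c * T k)) (Complex b (c * T k))" for z
          using seg[OF that] by (intro hor) auto
      qed
      also have "Complex b (c * T k) - Complex a (c * T k) = of_real (b - a)"
        by (simp add: complex_eq_iff)
      also have "norm (complex_of_real (b - a)) = b - a" using ab by (simp only: norm_of_real)
      finally show ?thesis .
    qed
    show ?thesis using 1 2[of 1] 2[of "-1"] by simp
  qed
  have ev: "eventually (\<lambda>k. T k > 0) sequentially"
    using T by (simp add: filterlim_at_top_dense)
  have hl: "(\<lambda>k. h k * (b - a)) \<longlonglongrightarrow> 0" using tendsto_mult_left_zero[OF hor(2)] by simp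
  have H0: "H (-1) \<longlonglongrightarrow> 0" "H 1 \<longlonglongrightarrow> 0"
    by (rule Lim_null_comparison[OF _ hl], use ev main in \<open>auto elim!: eventually_mono\<close>)+
  have Vl: "V c \<longlonglongrightarrow> (\<integral>t. G (Complex c t) \<partial>lborel)" if "integrable lborel (\<lambda>t. G (Complex c t))" for c
    unfolding V_def using integral_symmetric_interval_tendsto[OF that T] .
  have "(\<lambda>k. (H (-1) k - H 1 k) / (2 * pi * \<i>) + (V b k - V a k) / (2 * pi)) \<longlonglongrightarrow>
     (0 - 0) / (2 * pi * \<i>) + ((\<integral>t. G (Complex b t) \<partial>lborel) - (\<integral>t. G (Complex a t) \<partial>lborel)) / (2 * pi)"
    by (intro tendsto_intros H0 Vl inta intb) auto
  then have "(\<lambda>k. (H (-1) k - H 1 k) / (2 * pi * \<i>) + (V b k - V a k) / (2 * pi)) \<longlonglongrightarrow>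
     ((\<integral>t. G (Complex b t) \<partial>lborel) - (\<integral>t. G (Complex a t) \<partial>lborel)) / (2 * pi)" by simp
  moreover have "eventually (\<lambda>k. (H (-1) k - H 1 k) / (2 * pi * \<i>) + (V b k - V a k) / (2 * pi) = R k) sequentially"
    using ev main by (auto elim!: eventually_mono)
  ultimately show ?thesis unfolding R_def[symmetric] by (rule Lim_transform_eventually)
qed

subsection \<open>Exponential decay of the Gamma function\<close>

text \<open>The quotient of |Gamma(\<sigma> + i \<tau>)| by Gamma(\<sigma>) increases with \<sigma>:
  in Gauss's product each factor (\<sigma> + k) / |\<sigma> + k + i \<tau>| does. This carries decay
  on one vertical line to all lines on its left.\<close>

lemma norm_Gamma_ratio_mono:
  assumes "0 < \<sigma>" "\<sigma> \<le> \<sigma>'"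
  shows "norm (Gamma (Complex \<sigma> \<tau>)) * Gamma \<sigma>' \<le> norm (Gamma (Complex \<sigma>' \<tau>)) * Gamma \<sigma>"
proof -
  \<comment> \<open>Both sides of the cross-multiplied inequality share the numerator, which depends
    only on x + y; the comparison is one of denominators.\<close>
  have n: "norm (Gamma_series (Complex x \<tau>) n) * norm (Gamma_series (complex_of_real y) n)
     = (fact n)\<^sup>2 * exp ((x + y) * ln n) / (\<Prod>k\<le>n. norm (Complex x \<tau> + of_nat k) * (y + real k))"
     if "x > 0" "y > 0" for x y n
  proof -
    have "norm (complex_of_real y + of_nat k) = y + real k" for k
      using that by (metis abs_of_nonneg add_nonneg_nonneg less_imp_le norm_of_real of_nat_0_le_iff of_real_add of_real_of_nat_eq)
    then show ?thesis
      by (simp add: Gamma_series_def norm_mult norm_divide pochhammer_Suc_prod atMost_atLeast0 prod_norm[symmetric] prod.distrib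
        power2_eq_square distrib_right exp_add)
  qed
  have le: "norm (Gamma_series (Complex \<sigma> \<tau>) n) * norm (Gamma_series (complex_of_real \<sigma>') n)
     \<le> norm (Gamma_series (Complex \<sigma>' \<tau>) n) * norm (Gamma_series (complex_of_real \<sigma>) n)" for n
  proof -
    have pos: "norm (Complex x \<tau> + of_nat k) > 0" if "x > 0" for x k
    proof -
      have "Re (Complex x \<tau> + of_nat k) > 0" using that by simp
      then have "Complex x \<tau> + of_nat k \<noteq> 0" by (metis less_irrefl zero_complex.sel(1))
      then show ?thesis by simp
    qed
    have "(\<Prod>k\<le>n. norm (Complex \<sigma>' \<tau> + of_nat k) * (\<sigma> + real k)) \<le>
        (\<Prod>k\<le>n. norm (Complex \<sigma> \<tau> + of_nat k) * (\<sigma>' + real k))"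
    proof (rule prod_mono, intro conjI)
      fix k
      show "0 \<le> norm (Complex \<sigma>' \<tau> + of_nat k) * (\<sigma> + real k)" using assms by simp
      have "(\<sigma> + real k)\<^sup>2 \<le> (\<sigma>' + real k)\<^sup>2" using assms by (intro power_mono) auto
      then have "\<tau>\<^sup>2 * (\<sigma> + real k)\<^sup>2 \<le> \<tau>\<^sup>2 * (\<sigma>' + real k)\<^sup>2" by (intro mult_left_mono) auto
      then have "(norm (Complex \<sigma>' \<tau> + of_nat k) * (\<sigma> + real k))\<^sup>2 \<le> (norm (Complex \<sigma> \<tau> + of_nat k) * (\<sigma>' + real k))\<^sup>2"
        unfolding power_mult_distrib cmod_power2 by (simp add: algebra_simps)
      then show "norm (Complex \<sigma>' \<tau> + of_nat k) * (\<sigma> + real k) \<le> norm (Complex \<sigma> \<tau> + of_nat k) * (\<sigma>' + real k)"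
        by (rule power2_le_imp_le) (use assms in auto)
    qed
    moreover have "(\<Prod>k\<le>n. norm (Complex \<sigma>' \<tau> + of_nat k) * (\<sigma> + real k)) > 0"
      using assms pos by (intro prod_pos) (auto intro!: mult_pos_pos add_pos_nonneg)
    moreover have "(\<sigma>' + \<sigma>) = (\<sigma> + \<sigma>')" by simp
    ultimately show ?thesis using assms
      by (simp only: n) (auto simp: n intro!: divide_left_mono mult_pos_pos)
  qed
  have "norm (Gamma (Complex \<sigma> \<tau>)) * norm (Gamma (complex_of_real \<sigma>')) \<le> norm (Gamma (Complex \<sigma>' \<tau>)) * norm (Gamma (complex_of_real \<sigma>))"
    by (rule LIMSEQ_le[OF tendsto_mult[OF tendsto_norm[OF Gamma_series_LIMSEQ] tendsto_norm[OF Gamma_series_LIMSEQ]]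
      tendsto_mult[OF tendsto_norm[OF Gamma_series_LIMSEQ] tendsto_norm[OF Gamma_series_LIMSEQ]]]) (use le in auto)
  then show ?thesis using assms Gamma_real_pos[of \<sigma>] Gamma_real_pos[of \<sigma>'] by (simp add: Gamma_complex_of_real)
qed

text \<open>Reflection at z = i \<tau> gives the exact value pi \<tau> / sinh(pi \<tau>), because
  \<open>1 - z\<close> is the conjugate of \<open>1 + z\<close>. The estimate of the quotient then
  rests on 1 + 2u <= exp(2u).\<close>

lemma norm_Gamma_1_plus_imag:
  "(norm (Gamma (Complex 1 \<tau>)))\<^sup>2 \<le> (1 + 2 * pi * \<bar>\<tau>\<bar>) * exp (- pi * \<bar>\<tau>\<bar>)"
proof (cases "\<tau> = 0")
  case True
  then have "Complex 1 \<tau> = 1" by (simp add: complex_eq_iff)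
  with True show ?thesis by simp
next
  case False
  define z where "z = \<i> * complex_of_real \<tau>"
  have z: "z \<noteq> 0" "Complex 1 \<tau> = z + 1" "cnj (Complex 1 \<tau>) = 1 - z"
    using False by (auto simp: z_def complex_eq_iff)
  have "of_real ((norm (Gamma (Complex 1 \<tau>)))\<^sup>2) = Gamma (z + 1) * Gamma (1 - z)"
    unfolding complex_norm_square using z(2,3) by (metis cnj_Gamma)
  also have "\<dots> = z * (Gamma z * Gamma (1 - z))"
  proof -
    have "z \<notin> \<int>\<^sub>\<le>\<^sub>0" using False by (auto simp: z_def complex_eq_iff elim!: nonpos_Ints_cases)
    then show ?thesis by (simp add: Gamma_plus1)
  qed
  also have "\<dots> = z * (of_real pi / sin (of_real pi * z))" by (simp only: Gamma_reflection_complex)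
  also have "of_real pi * z = \<i> * of_real (pi * \<tau>)" by (simp add: z_def)
  also have "sin (\<i> * complex_of_real (pi * \<tau>)) = \<i> * of_real (sinh (pi * \<tau>))"
  proof -
    have "complex_of_real (sinh (pi * \<tau>)) = sinh (of_real (pi * \<tau>))"
      by (simp add: sinh_field_def exp_of_real[symmetric] del: of_real_mult)
    then show ?thesis unfolding sinh_conv_sin by simp
  qed
  finally have "of_real ((norm (Gamma (Complex 1 \<tau>)))\<^sup>2) = complex_of_real (pi * \<tau> / sinh (pi * \<tau>))"
    by (simp add: z_def)
  then have eq: "(norm (Gamma (Complex 1 \<tau>)))\<^sup>2 = pi * \<tau> / sinh (pi * \<tau>)" by (simp only: of_real_eq_iff)
  define u where "u = pi * \<bar>\<tau>\<bar>"
  have u: "u > 0" using False by (simp add: u_def)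
  have "pi * \<tau> / sinh (pi * \<tau>) = u / sinh u"
    by (cases "\<tau> > 0") (auto simp: u_def)
  also have "\<dots> = 2 * u * exp (-u) / (1 - exp (-(2*u)))"
  proof -
    have "sinh u * (2 * exp (-u)) = 1 - exp (-(2*u))"
      unfolding sinh_field_def by (simp add: algebra_simps diff_divide_distrib flip: exp_add)
    moreover have "u / sinh u = (u * (2 * exp (-u))) / (sinh u * (2 * exp (-u)))" by simp
    ultimately show ?thesis by (simp add: mult_ac)
  qed
  also have "\<dots> \<le> (1 + 2 * u) * exp (-u)"
  proof -
    have "1 + 2 * u \<le> exp (2 * u)" by (rule exp_ge_add_one_self)
    then have "(1 + 2 * u) * exp (-(2*u)) \<le> exp (2 * u) * exp (-(2*u))" by (intro mult_right_mono) auto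
    then have "2 * u \<le> (1 + 2 * u) * (1 - exp (-(2*u)))" by (simp add: algebra_simps flip: exp_add)
    then have "2 * u * exp (-u) \<le> (1 + 2 * u) * (1 - exp (-(2*u))) * exp (-u)" by (intro mult_right_mono) auto
    moreover have "1 - exp (-(2*u)) > 0" using u by simp
    ultimately show ?thesis by (simp add: pos_divide_le_eq mult_ac)
  qed
  finally have "pi * \<tau> / sinh (pi * \<tau>) \<le> (1 + 2 * u) * exp (-u)" .
  moreover have "(1 + 2 * u) * exp (-u) = (1 + 2 * pi * \<bar>\<tau>\<bar>) * exp (- pi * \<bar>\<tau>\<bar>)"
    by (simp add: u_def mult.assoc)
  ultimately show ?thesis using eq by (simp only:)
qed

text \<open>Any rate below pi/2 would do; 3/2 is a convenient rational one. The line Re z = 2 is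
  reached from Re z = 1 by the recurrence, and \<open>norm_Gamma_ratio_mono\<close> spreads the
  bound to the left.\<close>

lemma Gamma_exp_decay:
  assumes "0 < \<delta>"
  obtains C where "C > 0" "\<And>z. \<delta> \<le> Re z \<Longrightarrow> Re z \<le> 2 \<Longrightarrow> norm (Gamma z) \<le> C * exp (- (3/2) * \<bar>Im z\<bar>)"
proof -
  \<comment> \<open>The known bound on Re z = 2 divided by the desired one. It is continuous and
    tends to 0, hence bounded on the half line.\<close>
  define p where "p \<tau> = sqrt (1 + \<tau>\<^sup>2) * sqrt (1 + 2 * pi * \<tau>) * exp (- (pi / 2) * \<tau>) / exp (- (3/2) * \<tau>)" for \<tau> :: real
  have "(p \<longlongrightarrow> 0) at_top"
  proof -
    have "pi / 2 > 3 / 2" using pi_gt3 by simp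
    then show ?thesis unfolding p_def by real_asymp
  qed
  then have "eventually (\<lambda>\<tau>. p \<tau> < 1) at_top" by (rule order_tendstoD) simp
  then obtain M where M: "\<And>\<tau>. \<tau> \<ge> M \<Longrightarrow> p \<tau> < 1" by (auto simp: eventually_at_top_linorder)
  have "continuous_on {0..max 0 M} p" unfolding p_def by (intro continuous_intros) auto
  then have "bounded (p ` {0..max 0 M})" by (intro compact_imp_bounded compact_continuous_image) auto
  then obtain B where B: "\<And>\<tau>. \<tau> \<in> {0..max 0 M} \<Longrightarrow> \<bar>p \<tau>\<bar> \<le> B"
    unfolding bounded_iff by fastforce
  have pB: "p \<tau> \<le> max 1 B" if "\<tau> \<ge> 0" for \<tau>
    using M[of \<tau>] B[of \<tau>] that by fastforce
  have "bounded ((Gamma :: real \<Rightarrow> real) ` {\<delta>..2})"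
    using assms by (intro compact_imp_bounded compact_continuous_image continuous_intros) (auto elim!: nonpos_Ints_cases)
  then obtain D where D: "\<And>x. x \<in> {\<delta>..2} \<Longrightarrow> \<bar>Gamma x :: real\<bar> \<le> D"
    unfolding bounded_iff by fastforce
  have key: "norm (Gamma z) \<le> (\<bar>D\<bar> + 1) * max 1 B * exp (- (3/2) * \<bar>Im z\<bar>)" if z: "\<delta> \<le> Re z" "Re z \<le> 2" for z
  proof -
    let ?t = "\<bar>Im z\<bar>"
    have G1: "(norm (Gamma (Complex 1 (Im z)))) \<le> sqrt (1 + 2 * pi * ?t) * exp (- (pi / 2) * ?t)"
    proof (rule power2_le_imp_le)
      have "(exp (- (pi / 2) * ?t))\<^sup>2 = exp (- pi * ?t)" by (simp flip: exp_double)
      then show "(norm (Gamma (Complex 1 (Im z))))\<^sup>2 \<le> (sqrt (1 + 2 * pi * ?t) * exp (- (pi / 2) * ?t))\<^sup>2"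
        using norm_Gamma_1_plus_imag[of "Im z"] by (simp add: power_mult_distrib)
    qed auto
    have "Gamma (Complex 2 (Im z)) = Complex 1 (Im z) * Gamma (Complex 1 (Im z))"
    proof -
      have "Complex 1 (Im z) \<notin> \<int>\<^sub>\<le>\<^sub>0" by (auto elim!: nonpos_Ints_cases simp: complex_eq_iff)
      moreover have "Complex 1 (Im z) + 1 = Complex 2 (Im z)" by (simp add: complex_eq_iff)
      ultimately show ?thesis using Gamma_plus1 by metis
    qed
    then have "norm (Gamma (Complex 2 (Im z))) = sqrt (1 + ?t\<^sup>2) * norm (Gamma (Complex 1 (Im z)))"
      by (simp only: norm_mult) (simp add: cmod_def)
    also have "\<dots> \<le> sqrt (1 + ?t\<^sup>2) * (sqrt (1 + 2 * pi * ?t) * exp (- (pi / 2) * ?t))"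
      using G1 by (intro mult_left_mono) auto
    also have "\<dots> = p ?t * exp (- (3/2) * ?t)" by (simp add: p_def)
    also have "\<dots> \<le> max 1 B * exp (- (3/2) * ?t)" using pB[of ?t] by (intro mult_right_mono) auto
    finally have G2: "norm (Gamma (Complex 2 (Im z))) \<le> max 1 B * exp (- (3/2) * ?t)" .
    have "norm (Gamma z) = norm (Gamma (Complex (Re z) (Im z))) * Gamma (2::real)"
      by (simp add: Gamma_numeral)
    also have "\<dots> \<le> norm (Gamma (Complex 2 (Im z))) * Gamma (Re z)"
      by (rule norm_Gamma_ratio_mono) (use z assms in auto)
    also have "\<dots> \<le> (max 1 B * exp (- (3/2) * ?t)) * (\<bar>D\<bar> + 1)"
      using G2 D[of "Re z"] z assms Gamma_real_pos[of "Re z"] by (intro mult_mono) auto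
    finally show ?thesis by (simp add: mult_ac)
  qed
  show ?thesis by (rule that[of "(\<bar>D\<bar> + 1) * max 1 B"]) (use key in auto)
qed

subsection \<open>Continuation of zeta by a trapezoidal remainder\<close>

text \<open>A non-integrable f has integral 0 by convention, which also obeys the bound. A pointwise
  majorant therefore suffices, which later covers the integral of \<open>cos_series\<close>.\<close>

lemma norm_lebesgue_integral_le:
  fixes f :: "'a \<Rightarrow> 'b::{banach,second_countable_topology}"
  assumes "integrable M g" "\<And>x. norm (f x) \<le> g x"
  shows "norm (integral\<^sup>L M f) \<le> integral\<^sup>L M g"
proof (cases "integrable M f")
  case True
  have "norm (integral\<^sup>L M f) \<le> (\<integral>x. norm (f x) \<partial>M)" by simp
  also have "\<dots> \<le> integral\<^sup>L M g"
    using True assms by (intro Bochner_Integration.integral_mono) auto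
  finally show ?thesis .
next
  case False
  moreover have "0 \<le> integral\<^sup>L M g"
    using assms(2) norm_ge_zero order_trans by (intro Bochner_Integration.integral_nonneg) blast
  ultimately show ?thesis by (simp add: not_integrable_integral_eq)
qed

text \<open>The Peano kernel, up to the factor 1/2, of the trapezoidal rule on unit intervals; in
  Bernoulli terms it is 1/6 - B_2({x}).\<close>

definition parab :: "real \<Rightarrow> real" where
  "parab x = frac x * (1 - frac x)"

lemma parab_bounds: "0 \<le> parab x" "parab x \<le> 1"
  using frac_lt_1[of x] frac_ge_0[of x] mult_le_one[of "frac x" "1 - frac x"]
  by (auto simp: parab_def intro!: mult_nonneg_nonneg)

lemma parab_measurable [measurable]: "parab \<in> borel_measurable borel"
  unfolding parab_def frac_def by measurable

lemma parab_unit_interval: "real n \<le> x \<Longrightarrow> x \<le> real n + 1 \<Longrightarrow> parab x = (x - real n) * (real n + 1 - x)"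
proof (cases "x = real n + 1")
  case True
  then have "x = of_int (int n + 1)" by simp
  then have "frac x = 0" by (metis frac_of_int)
  then show ?thesis using True by (simp add: parab_def)
next
  case False
  assume "real n \<le> x" "x \<le> real n + 1"
  then have "frac x = x - real n" using False by (intro frac_unique_iff[THEN iffD2]) auto
  then show ?thesis by (simp add: parab_def)
qed

lemma has_integral_parab_second_derivative:
  fixes f f' f'' F :: "real \<Rightarrow> 'a::banach"
  assumes F: "\<And>x. x \<in> {real n..real n + 1} \<Longrightarrow> (F has_vector_derivative f x) (at x within {real n..real n + 1})"
    and f: "\<And>x. x \<in> {real n..real n + 1} \<Longrightarrow> (f has_vector_derivative f' x) (at x within {real n..real n + 1})"
    and f': "\<And>x. x \<in> {real n..real n + 1} \<Longrightarrow> (f' has_vector_derivative f'' x) (at x within {real n..real n + 1})"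
  shows "((\<lambda>x. parab x *\<^sub>R f'' x) has_integral
     f (real n) + f (real n + 1) - 2 *\<^sub>R (F (real n + 1) - F (real n))) {real n..real n + 1}"
proof -
  \<comment> \<open>The primitive obtained by integrating by parts twice. The first term vanishes at
    both ends, which leaves the trapezoidal error.\<close>
  define \<Phi> where "\<Phi> x = ((x - real n) * (real n + 1 - x)) *\<^sub>R f' x - (2 * real n + 1 - 2 * x) *\<^sub>R f x - 2 *\<^sub>R F x" for x
  have "((\<lambda>x. ((x - real n) * (real n + 1 - x)) *\<^sub>R f'' x) has_integral \<Phi> (real n + 1) - \<Phi> (real n)) {real n..real n + 1}"
  proof (rule fundamental_theorem_of_calculus)
    fix x assume x: "x \<in> {real n..real n + 1}"
    have "(\<Phi> has_vector_derivative
       (((x - real n) * (real n + 1 - x)) *\<^sub>R f'' x + (2 * real n + 1 - 2 * x) *\<^sub>R f' x)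
       - ((2 * real n + 1 - 2 * x) *\<^sub>R f' x + (- 2) *\<^sub>R f x) - 2 *\<^sub>R f x) (at x within {real n..real n + 1})"
      unfolding \<Phi>_def
    proof (intro has_vector_derivative_diff has_vector_derivative_scaleR f[OF x] f'[OF x])
      show "((\<lambda>x. (x - real n) * (real n + 1 - x)) has_field_derivative 2 * real n + 1 - 2 * x) (at x within {real n..real n + 1})"
        by (auto intro!: derivative_eq_intros)
      show "((\<lambda>x. 2 * real n + 1 - 2 * x) has_field_derivative -2) (at x within {real n..real n + 1})"
        by (auto intro!: derivative_eq_intros)
      show "((\<lambda>x. 2 *\<^sub>R F x) has_vector_derivative 2 *\<^sub>R f x) (at x within {real n..real n + 1})"
        using bounded_linear.has_vector_derivative[OF bounded_linear_scaleR_right F[OF x]] .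
    qed
    then show "(\<Phi> has_vector_derivative ((x - real n) * (real n + 1 - x)) *\<^sub>R f'' x) (at x within {real n..real n + 1})"
      by (simp add: algebra_simps)
  qed simp
  also have "\<Phi> (real n + 1) - \<Phi> (real n) = f (real n) + f (real n + 1) - 2 *\<^sub>R (F (real n + 1) - F (real n))"
    by (simp add: \<Phi>_def algebra_simps)
  finally show ?thesis
    by (rule has_integral_eq[rotated]) (use parab_unit_interval in auto)
qed

text \<open>With f(x) = x^(-s) in the trapezoidal identity, f'' = s (s + 1) x^(-s-2). Summed over
  all unit intervals this gives \<open>zeta_cont\<close>; the extra power x^(-2) extends convergence
  to Re s > -1.\<close>

definition zeta_rem :: "complex \<Rightarrow> complex" where
  "zeta_rem s = (LINT x:{1..}|lborel. of_real (parab x) * of_real x powr (- s - 2))"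

definition zeta_cont :: "complex \<Rightarrow> complex" where
  "zeta_cont s = 1/2 + 1 / (s - 1) + s * (s + 1) / 2 * zeta_rem s"

lemma powr_tail:
  fixes a :: real
  assumes "a > 1"
  shows "set_integrable lborel {1..} (\<lambda>x. x powr (- a))" "(LINT x:{1..}|lborel. x powr (- a)) = 1 / (a - 1)"
proof -
  have "((\<lambda>x. x powr (- a)) has_integral - (1 powr (- a + 1)) / (- a + 1)) {1..}"
    by (rule has_integral_powr_to_inf) (use assms in auto)
  then have hi: "((\<lambda>x. x powr (- a)) has_integral 1 / (a - 1)) {1..}"
    using assms by (simp add: minus_divide_right)
  then have "(\<lambda>x. x powr (- a)) absolutely_integrable_on {1..}"
    by (intro nonnegative_absolutely_integrable_1) auto
  then show 1: "set_integrable lborel {1..} (\<lambda>x. x powr (- a))"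
    unfolding set_integrable_def by (subst (asm) integrable_completion) auto
  show "(LINT x:{1..}|lborel. x powr (- a)) = 1 / (a - 1)"
    using set_borel_integral_eq_integral(2)[OF 1] hi by (simp add: integral_unique)
qed

lemma norm_zeta_rem_integrand:
  "x \<ge> 1 \<Longrightarrow> norm (of_real (parab x) * of_real x powr (- s - 2) :: complex) \<le> x powr (- (Re s + 2))"
  using parab_bounds[of x]
  by (auto simp: norm_mult norm_powr_real_powr algebra_simps intro!: mult_left_le_one_le)

lemma zeta_rem_integrand_integrable:
  assumes "Re s > -1"
  shows "set_integrable lborel {1..} (\<lambda>x. of_real (parab x) * of_real x powr (- s - 2) :: complex)"
  unfolding set_integrable_def
proof (rule Bochner_Integration.integrable_bound[OF powr_tail(1)[unfolded set_integrable_def]])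
  show "Re s + 2 > 1" using assms by simp
  show "AE x in lborel. norm (indicat_real {1..} x *\<^sub>R (of_real (parab x) * of_real x powr (- s - 2) :: complex))
    \<le> norm (indicat_real {1..} x *\<^sub>R x powr (- (Re s + 2)))"
    using norm_zeta_rem_integrand[of _ s] by (intro AE_I2) (auto simp: indicator_def)
  show "(\<lambda>x. indicat_real {1..} x *\<^sub>R (of_real (parab x) * of_real x powr (- s - 2) :: complex)) \<in> borel_measurable lborel"
    by measurable
qed

lemma norm_zeta_rem: "Re s > -1 \<Longrightarrow> norm (zeta_rem s) \<le> 1 / (Re s + 1)"
proof -
  assume s: "Re s > -1"
  have "norm (zeta_rem s) \<le> (LINT x:{1..}|lborel. x powr (- (Re s + 2)))"
    unfolding zeta_rem_def set_lebesgue_integral_def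
  proof (rule norm_lebesgue_integral_le)
    show "integrable lborel (\<lambda>x. indicat_real {1..} x *\<^sub>R x powr (- (Re s + 2)))"
      using powr_tail(1)[of "Re s + 2"] s by (simp add: set_integrable_def)
    show "norm (indicat_real {1..} x *\<^sub>R (of_real (parab x) * of_real x powr (- s - 2) :: complex)) \<le> indicat_real {1..} x *\<^sub>R x powr (- (Re s + 2))" for x
      using norm_zeta_rem_integrand[of x s] by (auto simp: indicator_def)
  qed
  also have "\<dots> = 1 / (Re s + 1)" using powr_tail(2)[of "Re s + 2"] s by simp
  finally show ?thesis .
qed

lemma zeta_rem_holomorphic: "zeta_rem holomorphic_on {s. Re s > -1}"
  unfolding zeta_rem_def set_lebesgue_integral_def
proof (rule holomorphic_on_lebesgue_integral)
  show "open {s. Re s > -1}" by (rule open_halfspace_Re_gt)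
  show "(\<lambda>w. indicat_real {1..} t *\<^sub>R (of_real (parab t) * of_real t powr (- w - 2))) holomorphic_on {s. - 1 < Re s}" for t
    by (cases "t \<ge> 1") (auto intro!: holomorphic_intros)
  fix w0 :: complex assume w0: "w0 \<in> {s. - 1 < Re s}"
  define r where "r = (Re w0 + 1) / 2"
  have r: "r > 0" "Re w > r - 1" if "w \<in> ball w0 r" for w
  proof -
    show "r > 0" using w0 by (simp add: r_def)
    have "\<bar>Re (w0 - w)\<bar> < r" using that abs_Re_le_cmod[of "w0 - w"] by (simp add: dist_norm)
    then have "\<bar>Re w0 - Re w\<bar> < r" by simp
    then show "Re w > r - 1" unfolding r_def by argo
  qed
  have r0: "r > 0" using w0 by (simp add: r_def)
  show "\<exists>r>0. \<exists>g. ball w0 r \<subseteq> {s. - 1 < Re s} \<and> integrable lborel g \<and>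
     (\<forall>w\<in>ball w0 r. \<forall>t\<in>space lborel. norm (indicat_real {1..} t *\<^sub>R (of_real (parab t) * of_real t powr (- w - 2))) \<le> g t)"
  proof (intro exI[of _ r] exI[of _ "\<lambda>t. indicat_real {1..} t *\<^sub>R t powr (- (r + 1))"] conjI ballI r0)
    show "ball w0 r \<subseteq> {s. - 1 < Re s}" using r r0 by force
    show "integrable lborel (\<lambda>t. indicat_real {1..} t *\<^sub>R t powr (- (r + 1)))"
      using powr_tail(1)[of "r + 1"] r0 by (simp add: set_integrable_def)
    fix w t assume w: "w \<in> ball w0 r"
    have "t powr (- (Re w + 2)) \<le> t powr (- (r + 1))" if "t \<ge> 1"
      using r(2)[OF w] that by (intro powr_mono) auto
    then show "norm (indicat_real {1..} t *\<^sub>R (of_real (parab t) * of_real t powr (- w - 2))) \<le> indicat_real {1..} t *\<^sub>R t powr (- (r + 1))"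
      using norm_zeta_rem_integrand[of t w] by (auto simp: indicator_def)
  qed
qed measurable

lemma zeta_cont_holomorphic: "zeta_cont holomorphic_on {s. Re s > -1} - {1}"
  unfolding zeta_cont_def
  by (intro holomorphic_intros holomorphic_on_subset[OF zeta_rem_holomorphic]) auto

lemma zeta_rem_partial:
  fixes s :: complex
  assumes "s \<noteq> 1" "n \<ge> 1"
  shows "((\<lambda>x. parab x *\<^sub>R (s * (s + 1) * of_real x powr (- s - 2))) has_integral
     of_nat n powr (- s) + of_nat (n + 1) powr (- s) - 2 * (of_nat (n + 1) powr (1 - s) - of_nat n powr (1 - s)) / (1 - s)) {real n..real n + 1}"
proof -
  have pos: "x > 0" if "x \<in> {real n..real n + 1}" for x using that assms by auto
  have d: "((\<lambda>x. of_real x powr a) has_vector_derivative a * of_real x powr (a - 1)) (at x within {real n..real n + 1})"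
    if "x \<in> {real n..real n + 1}" for x and a :: complex
    using has_vector_derivative_real_field[OF has_field_derivative_powr[of "of_real x" a], of "{real n..real n + 1}"] pos[OF that]
    by simp
  have "((\<lambda>x. parab x *\<^sub>R (- s * ((- s - 1) * of_real x powr (- s - 2)))) has_integral
     of_real (real n) powr (- s) + of_real (real n + 1) powr (- s)
     - 2 *\<^sub>R (of_real (real n + 1) powr (1 - s) / (1 - s) - of_real (real n) powr (1 - s) / (1 - s))) {real n..real n + 1}"
  proof (rule has_integral_parab_second_derivative)
    fix x assume x: "x \<in> {real n..real n + 1}"
    show "((\<lambda>x. of_real x powr (1 - s) / (1 - s)) has_vector_derivative of_real x powr (- s)) (at x within {real n..real n + 1})"
      using has_vector_derivative_divide[OF d[OF x, of "1 - s"], of "1 - s"] assms by simp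
    show "((\<lambda>x. of_real x powr (- s)) has_vector_derivative - s * of_real x powr (- s - 1)) (at x within {real n..real n + 1})"
      using d[OF x, of "- s"] by simp
    show "((\<lambda>x. - s * of_real x powr (- s - 1)) has_vector_derivative - s * ((- s - 1) * of_real x powr (- s - 2))) (at x within {real n..real n + 1})"
      using has_vector_derivative_mult_right[OF d[OF x, of "- s - 1"], of "- s"] by (simp add: algebra_simps)
  qed
  then show ?thesis by (simp add: scaleR_conv_of_real algebra_simps diff_divide_distrib)
qed

lemma zeta_cont_sums:
  assumes s: "Re s > 1"
  shows "(\<lambda>n. 1 / of_nat (Suc n) powr s) sums zeta_cont s"
proof -
  define f where "f x = of_real (parab x) * complex_of_real x powr (- s - 2)" for x
  define P where "P N = (\<Sum>n<N. 1 / of_nat (Suc n) powr s)" for N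
  have s1: "s \<noteq> 1" using s by auto
  \<comment> \<open>Adding up the trapezoids counts interior terms twice and the two end terms once;
    hence twice the partial sum minus its ends.\<close>
  have J: "((\<lambda>x. s * (s + 1) * f x) has_integral
      2 * P (Suc N) - 1 - of_nat (Suc N) powr (- s) - 2 * (of_nat (Suc N) powr (1 - s) - 1) / (1 - s)) {1..real N + 1}" for N
  proof (induction N)
    case 0
    have "((\<lambda>x. s * (s + 1) * f x) has_integral 0) (cbox 1 1)" by (intro has_integral_null) simp
    then show ?case by (simp add: P_def)
  next
    case (Suc N)
    have "((\<lambda>x. s * (s + 1) * f x) has_integral
      of_nat (Suc N) powr (- s) + of_nat (Suc N + 1) powr (- s) - 2 * (of_nat (Suc N + 1) powr (1 - s) - of_nat (Suc N) powr (1 - s)) / (1 - s)) {real (Suc N)..real (Suc N) + 1}"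
      using zeta_rem_partial[OF s1, of "Suc N"] by (simp add: f_def scaleR_conv_of_real mult_ac)
    then have "((\<lambda>x. s * (s + 1) * f x) has_integral
      (2 * P (Suc N) - 1 - of_nat (Suc N) powr (- s) - 2 * (of_nat (Suc N) powr (1 - s) - 1) / (1 - s)) +
      (of_nat (Suc N) powr (- s) + of_nat (Suc N + 1) powr (- s) - 2 * (of_nat (Suc N + 1) powr (1 - s) - of_nat (Suc N) powr (1 - s)) / (1 - s))) {1..real (Suc N) + 1}"
      using Suc by (intro has_integral_combine[where c = "real (Suc N)"]) (auto simp: add_ac)
    then show ?case
      by (rule has_integral_eq_rhs) (simp add: P_def powr_minus divide_simps, simp add: algebra_simps)
  qed
  have int: "integrable lborel (\<lambda>x. indicat_real {1..} x *\<^sub>R f x)"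
    using zeta_rem_integrand_integrable[of s] s unfolding f_def set_integrable_def by simp
  have lim: "(\<lambda>N. s * (s + 1) * integral {1..real N + 1} f) \<longlonglongrightarrow> s * (s + 1) * zeta_rem s"
    using integral_tail_tendsto[OF int]
    by (intro tendsto_mult_left) (simp add: zeta_rem_def set_lebesgue_integral_def f_def[abs_def] add.commute)
  have "s * (s + 1) * integral {1..real N + 1} f =
     2 * P (Suc N) - 1 - of_nat (Suc N) powr (- s) - 2 * (of_nat (Suc N) powr (1 - s) - 1) / (1 - s)" for N
    using integral_unique[OF J[of N]] by (simp only: integral_mult_right)
  then have PP: "P (Suc N) = (s * (s + 1) * integral {1..real N + 1} f + 1 + of_nat (Suc N) powr (- s)
       + 2 * (of_nat (Suc N) powr (1 - s) - 1) / (1 - s)) / 2" for N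
    by (simp add: field_simps)
  have z: "(\<lambda>N. complex_of_nat (Suc N) powr a) \<longlonglongrightarrow> 0" if "Re a < 0" for a
  proof (rule tendsto_norm_zero_cancel)
    have "(\<lambda>N. real (Suc N) powr (Re a)) \<longlonglongrightarrow> 0" using that by real_asymp
    moreover have "norm (complex_of_nat (Suc N) powr a) = real (Suc N) powr (Re a)" for N
      using norm_powr_real_powr[of "of_nat (Suc N)" a] by simp
    ultimately show "(\<lambda>N. norm (complex_of_nat (Suc N) powr a)) \<longlonglongrightarrow> 0" by simp
  qed
  have "(\<lambda>N. P (Suc N)) \<longlonglongrightarrow> (s * (s + 1) * zeta_rem s + 1 + 0 + 2 * (0 - 1) / (1 - s)) / 2"
    unfolding PP by (intro tendsto_intros lim z) (use s s1 in auto)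
  also have "(s * (s + 1) * zeta_rem s + 1 + 0 + 2 * (0 - 1) / (1 - s)) / 2 = zeta_cont s"
    using s1 by (simp add: zeta_cont_def divide_simps) (simp add: algebra_simps)
  finally have "(\<lambda>N. P (Suc N)) \<longlonglongrightarrow> zeta_cont s" .
  then show ?thesis unfolding sums_def P_def by (rule LIMSEQ_imp_Suc)
qed

subsection \<open>The functional equation\<close>

lemma nn_integral_Gamma_scaled:
  fixes a y :: real
  assumes "a > 0" "y > 0"
  shows "(\<integral>\<^sup>+x. indicator {0<..} x * ennreal (x powr (a - 1) * exp (- (x * y))) \<partial>lborel) = ennreal (Gamma a * y powr (- a))"
proof -
  have "((\<lambda>t. t powr (a - 1) / exp t) has_integral Gamma a) {0..}"
    by (rule Gamma_integral_real) fact
  then have "((\<lambda>t. if t \<in> {0<..} then t powr (a - 1) / exp t else 0) has_integral Gamma a) {0..}"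
    by (rule has_integral_spike[of "{0}", rotated 2]) auto
  then have "((\<lambda>t. if t \<in> {0<..} then t powr (a - 1) / exp t else 0) has_integral Gamma a) UNIV"
    by (rule has_integral_on_superset) auto
  then have "(\<integral>\<^sup>+t. ennreal (if t \<in> {0<..} then t powr (a - 1) / exp t else 0) \<partial>lborel) = ennreal (Gamma a)"
    by (rule nn_integral_has_integral_lborel[rotated 2]) auto
  also have "(\<integral>\<^sup>+t. ennreal (if t \<in> {0<..} then t powr (a - 1) / exp t else 0) \<partial>lborel)
     = ennreal \<bar>y\<bar> * (\<integral>\<^sup>+t. ennreal (if 0 + y * t \<in> {0<..} then (0 + y * t) powr (a - 1) / exp (0 + y * t) else 0) \<partial>lborel)"
    by (rule nn_integral_real_affine) (use assms in auto)
  also have "\<dots> = ennreal y * (\<integral>\<^sup>+t. ennreal (y powr (a - 1)) * (indicator {0<..} t * ennreal (t powr (a - 1) * exp (- (t * y)))) \<partial>lborel)"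
    using assms
    by (intro arg_cong2[where f = "(*)"] nn_integral_cong)
       (auto simp: indicator_def powr_mult zero_less_mult_iff exp_minus field_simps simp flip: ennreal_mult')
  also have "\<dots> = ennreal (y powr a) * (\<integral>\<^sup>+t. indicator {0<..} t * ennreal (t powr (a - 1) * exp (- (t * y))) \<partial>lborel)"
  proof -
    have "ennreal y * ennreal (y powr (a - 1)) = ennreal (y powr a)"
      using assms by (simp flip: ennreal_mult' add: powr_mult_base)
    then show ?thesis by (subst nn_integral_cmult) (auto simp flip: mult.assoc)
  qed
  finally have eq: "ennreal (y powr a) * (\<integral>\<^sup>+t. indicator {0<..} t * ennreal (t powr (a - 1) * exp (- (t * y))) \<partial>lborel) = ennreal (Gamma a)" .
  have "ennreal (y powr (- a)) * (ennreal (y powr a) * (\<integral>\<^sup>+t. indicator {0<..} t * ennreal (t powr (a - 1) * exp (- (t * y))) \<partial>lborel)) = ennreal (y powr (- a)) * ennreal (Gamma a)"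
    by (simp only: eq)
  moreover have "ennreal (y powr (- a)) * ennreal (y powr a) = 1"
    using assms by (simp flip: ennreal_mult' add: powr_minus)
  ultimately show ?thesis using assms Gamma_real_pos[of a]
    by (simp flip: mult.assoc ennreal_mult' add: mult.commute)
qed

text \<open>The substitution v = x^2 leads to a Gamma integral with parameter (\<sigma> + 1) / 2;
  the final factor 1/2 is the Jacobian.\<close>

lemma nn_integral_gauss_moment:
  fixes \<sigma> u :: real
  assumes "\<sigma> > -1" "u > 0"
  shows "(\<integral>\<^sup>+x. indicator {0<..} x * ennreal (x powr \<sigma> * exp (- (u * x\<^sup>2))) \<partial>lborel) = ennreal (Gamma ((\<sigma> + 1) / 2) * u powr (- ((\<sigma> + 1) / 2)) / 2)"
proof -
  define a where "a = (\<sigma> + 1) / 2"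
  define f where "f v = v powr (a - 1) * exp (- (v * u))" for v
  have a: "a > 0" using assms by (simp add: a_def)
  have G: "(\<integral>\<^sup>+x. indicator {0<..} x * ennreal (f x) \<partial>lborel) = ennreal (Gamma a * u powr (- a))"
    unfolding f_def by (rule nn_integral_Gamma_scaled[OF a assms(2)])
  have Gpos: "0 \<le> Gamma a * u powr (- a)" using a by (simp add: Gamma_real_pos less_imp_le)
  have "has_bochner_integral lborel (\<lambda>x. indicator {0<..} x * f x) (Gamma a * u powr (- a))"
    by (rule has_bochner_integral_nn_integral) (use G Gpos in \<open>auto simp: f_def ennreal_mult' ennreal_indicator\<close>)
  then have "((\<lambda>x. indicator {0<..} x * f x) has_integral Gamma a * u powr (- a)) UNIV"
    using has_integral_integral_lborel by (metis has_bochner_integral_iff)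
  then have "((\<lambda>x. if x \<in> {0<..} then f x else 0) has_integral Gamma a * u powr (- a)) UNIV"
    by (rule has_integral_eq[rotated]) (auto simp: indicator_def)
  then have fi: "(f has_integral Gamma a * u powr (- a)) {0<..}" by (simp only: has_integral_restrict_UNIV)
  have im: "(\<lambda>x::real. x\<^sup>2) ` {0<..} = {0<..}"
  proof (intro set_eqI iffI)
    fix y :: real assume "y \<in> {0<..}"
    then have "y = (sqrt y)\<^sup>2" "sqrt y \<in> {0<..}" by auto
    then show "y \<in> (\<lambda>x. x\<^sup>2) ` {0<..}" by blast
  qed auto
  have "(\<lambda>x. \<bar>2 * x\<bar> * f (x\<^sup>2)) absolutely_integrable_on {0<..} \<and> integral {0<..} (\<lambda>x. \<bar>2 * x\<bar> * f (x\<^sup>2)) = Gamma a * u powr (- a)"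
  proof (rule iffD2[OF has_absolute_integral_change_of_variables_1'[where S = "{0<..}" and g = "\<lambda>x. x\<^sup>2" and g' = "\<lambda>x. 2 * x"]])
    show "((\<lambda>x. x\<^sup>2) has_real_derivative 2 * x) (at x within {0<..})" for x
      by (auto intro!: derivative_eq_intros)
    show "inj_on (\<lambda>x::real. x\<^sup>2) {0<..}" by (auto intro!: inj_onI simp: power2_eq_iff)
    show "f absolutely_integrable_on (\<lambda>x. x\<^sup>2) ` {0<..} \<and> integral ((\<lambda>x. x\<^sup>2) ` {0<..}) f = Gamma a * u powr (- a)"
      unfolding im using fi by (auto intro!: nonnegative_absolutely_integrable_1 simp: integral_unique f_def has_integral_integrable)
  qed auto
  then have "((\<lambda>x. \<bar>2 * x\<bar> * f (x\<^sup>2)) has_integral Gamma a * u powr (- a)) {0<..}"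
    using set_lebesgue_integral_eq_integral(1) by (metis has_integral_integral)
  then have "((\<lambda>x. \<bar>2 * x\<bar> * f (x\<^sup>2) / 2) has_integral Gamma a * u powr (- a) / 2) {0<..}"
    by (rule has_integral_divide)
  then have "((\<lambda>x. x powr \<sigma> * exp (- (u * x\<^sup>2))) has_integral Gamma a * u powr (- a) / 2) {0<..}"
  proof (rule has_integral_eq[rotated])
    fix x :: real assume x: "x \<in> {0<..}"
    have "x * (x\<^sup>2) powr (a - 1) = x powr 1 * x powr (2 * (a - 1))"
    proof -
      have "x\<^sup>2 = x powr 2" using x by simp
      then show ?thesis using x by (simp only: powr_powr) simp
    qed
    also have "\<dots> = x powr (1 + 2 * (a - 1))" by (simp only: powr_add)
    also have "1 + 2 * (a - 1) = \<sigma>" by (simp add: a_def field_simps)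
    finally show "\<bar>2 * x\<bar> * f (x\<^sup>2) / 2 = x powr \<sigma> * exp (- (u * x\<^sup>2))"
      using x by (simp add: f_def mult_ac)
  qed
  then have "((\<lambda>x. if x \<in> {0<..} then x powr \<sigma> * exp (- (u * x\<^sup>2)) else 0) has_integral Gamma a * u powr (- a) / 2) UNIV"
    by (simp only: has_integral_restrict_UNIV)
  then have "(\<integral>\<^sup>+x. ennreal (if x \<in> {0<..} then x powr \<sigma> * exp (- (u * x\<^sup>2)) else 0) \<partial>lborel) = ennreal (Gamma a * u powr (- a) / 2)"
    by (rule nn_integral_has_integral_lborel[rotated 2]) auto
  then show ?thesis unfolding a_def
    by (subst nn_integral_cong[where v = "\<lambda>x. ennreal (if x \<in> {0<..} then x powr \<sigma> * exp (- (u * x\<^sup>2)) else 0)"]) (auto simp: indicator_def)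
qed

text \<open>Writing 1 / (x^2 + a^2) as a Laplace integral in u and exchanging by Tonelli leaves a
  Gaussian moment in x and then a Gamma integral in u.\<close>

lemma nn_integral_powr_over_quadratic:
  fixes \<sigma> a :: real
  assumes \<sigma>: "\<bar>\<sigma>\<bar> < 1" and a: "a > 0"
  shows "(\<integral>\<^sup>+x. indicator {0<..} x * ennreal (x powr \<sigma> / (x\<^sup>2 + a\<^sup>2)) \<partial>lborel)
     = ennreal (Gamma ((1 + \<sigma>) / 2) * Gamma ((1 - \<sigma>) / 2) / 2 * a powr (\<sigma> - 1))"
proof -
  have q: "x\<^sup>2 + a\<^sup>2 > 0" for x using a by (simp add: add_nonneg_pos)
  have inner: "ennreal (1 / (x\<^sup>2 + a\<^sup>2)) = (\<integral>\<^sup>+u. indicator {0<..} u * ennreal (exp (- (u * (x\<^sup>2 + a\<^sup>2)))) \<partial>lborel)" for x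
  proof -
    have "(\<integral>\<^sup>+u. indicator {0<..} u * ennreal (exp (- (u * (x\<^sup>2 + a\<^sup>2)))) \<partial>lborel) =
      (\<integral>\<^sup>+u. indicator {0<..} u * ennreal (u powr (1 - 1) * exp (- (u * (x\<^sup>2 + a\<^sup>2)))) \<partial>lborel)"
      by (intro nn_integral_cong) (auto simp: indicator_def)
    also have "\<dots> = ennreal (1 / (x\<^sup>2 + a\<^sup>2))"
      using nn_integral_Gamma_scaled[of 1 "x\<^sup>2 + a\<^sup>2"] q[of x] by (simp add: powr_minus_divide)
    finally show ?thesis ..
  qed
  have "(\<integral>\<^sup>+x. indicator {0<..} x * ennreal (x powr \<sigma> / (x\<^sup>2 + a\<^sup>2)) \<partial>lborel) =
    (\<integral>\<^sup>+x. \<integral>\<^sup>+u. indicator {0<..} x * indicator {0<..} u * ennreal (x powr \<sigma> * exp (- (u * (x\<^sup>2 + a\<^sup>2)))) \<partial>lborel \<partial>lborel)"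
  proof (rule nn_integral_cong)
    fix x :: real
    have "indicator {0<..} x * ennreal (x powr \<sigma> / (x\<^sup>2 + a\<^sup>2)) = indicator {0<..} x * ennreal (x powr \<sigma>) * ennreal (1 / (x\<^sup>2 + a\<^sup>2))"
      using q[of x] by (simp add: mult.assoc flip: ennreal_mult')
    also have "\<dots> = (\<integral>\<^sup>+u. indicator {0<..} x * ennreal (x powr \<sigma>) * (indicator {0<..} u * ennreal (exp (- (u * (x\<^sup>2 + a\<^sup>2))))) \<partial>lborel)"
      unfolding inner by (rule nn_integral_cmult[symmetric]) simp
    also have "\<dots> = (\<integral>\<^sup>+u. indicator {0<..} x * indicator {0<..} u * ennreal (x powr \<sigma> * exp (- (u * (x\<^sup>2 + a\<^sup>2)))) \<partial>lborel)"
      by (intro nn_integral_cong) (simp add: ennreal_mult' mult_ac)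
    finally show "indicator {0<..} x * ennreal (x powr \<sigma> / (x\<^sup>2 + a\<^sup>2)) = \<dots>" .
  qed
  also have "\<dots> = (\<integral>\<^sup>+u. \<integral>\<^sup>+x. indicator {0<..} x * indicator {0<..} u * ennreal (x powr \<sigma> * exp (- (u * (x\<^sup>2 + a\<^sup>2)))) \<partial>lborel \<partial>lborel)"
    by (rule lborel_pair.Fubini') measurable
  also have "\<dots> = (\<integral>\<^sup>+u. ennreal (Gamma ((\<sigma> + 1) / 2) / 2) * (indicator {0<..} u * ennreal (u powr ((1 - \<sigma>) / 2 - 1) * exp (- (u * a\<^sup>2)))) \<partial>lborel)"
  proof (rule nn_integral_cong)
    fix u :: real
    show "(\<integral>\<^sup>+x. indicator {0<..} x * indicator {0<..} u * ennreal (x powr \<sigma> * exp (- (u * (x\<^sup>2 + a\<^sup>2)))) \<partial>lborel) =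
      ennreal (Gamma ((\<sigma> + 1) / 2) / 2) * (indicator {0<..} u * ennreal (u powr ((1 - \<sigma>) / 2 - 1) * exp (- (u * a\<^sup>2))))"
    proof (cases "u > 0")
      case True
      have "(\<integral>\<^sup>+x. indicator {0<..} x * indicator {0<..} u * ennreal (x powr \<sigma> * exp (- (u * (x\<^sup>2 + a\<^sup>2)))) \<partial>lborel) =
        (\<integral>\<^sup>+x. ennreal (exp (- (u * a\<^sup>2))) * (indicator {0<..} x * ennreal (x powr \<sigma> * exp (- (u * x\<^sup>2)))) \<partial>lborel)"
        using True by (intro nn_integral_cong) (auto simp: indicator_def distrib_left mult_ac simp flip: ennreal_mult' exp_add)
      also have "\<dots> = ennreal (exp (- (u * a\<^sup>2))) * ennreal (Gamma ((\<sigma> + 1) / 2) * u powr (- ((\<sigma> + 1) / 2)) / 2)"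
        using nn_integral_gauss_moment[of \<sigma> u] \<sigma> True by (subst nn_integral_cmult) auto
      also have "- ((\<sigma> + 1) / 2) = (1 - \<sigma>) / 2 - 1" by (simp add: field_simps)
      finally show ?thesis using True \<sigma> Gamma_real_pos[of "(\<sigma> + 1) / 2"]
        by (simp add: mult_ac flip: ennreal_mult')
    qed simp
  qed
  also have "\<dots> = ennreal (Gamma ((\<sigma> + 1) / 2) / 2) * ennreal (Gamma ((1 - \<sigma>) / 2) * (a\<^sup>2) powr (- ((1 - \<sigma>) / 2)))"
    using nn_integral_Gamma_scaled[of "(1 - \<sigma>) / 2" "a\<^sup>2"] \<sigma> a by (subst nn_integral_cmult) auto
  also have "(a\<^sup>2) powr (- ((1 - \<sigma>) / 2)) = a powr (\<sigma> - 1)"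
  proof -
    have "(a\<^sup>2) powr (- ((1 - \<sigma>) / 2)) = a powr (2 * (- ((1 - \<sigma>) / 2)))"
      using a by (simp only: powr_powr powr_numeral[symmetric])
    also have "2 * (- ((1 - \<sigma>) / 2)) = \<sigma> - 1" by (simp add: field_simps)
    finally show ?thesis .
  qed
  finally show ?thesis
    using \<sigma> Gamma_real_pos[of "(\<sigma> + 1) / 2"] by (simp add: mult_ac add_ac flip: ennreal_mult')
qed

text \<open>The sum is coth(x/2) - 2/x, that is, the cotangent expansion at the imaginary point z =
  i x / (2 pi). The cotangent arises as the logarithmic derivative of the reflection formula, its
  series from the series of Digamma.\<close>

lemma coth_partial_fractions:
  fixes x :: real
  assumes "x > 0"
  shows "(\<lambda>n. 4 * x / (x\<^sup>2 + (2 * pi * real (Suc n))\<^sup>2)) sums ((1 + exp (- x)) / (1 - exp (- x)) - 2 / x)"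
proof -
  define y where "y = x / (2 * pi)"
  define z where "z = \<i> * complex_of_real y"
  have y: "y > 0" using assms by (simp add: y_def)
  have nonint: "z \<notin> \<int>" "1 - z \<notin> \<int>\<^sub>\<le>\<^sub>0" "z \<notin> \<int>\<^sub>\<le>\<^sub>0" "1 + z \<notin> \<int>\<^sub>\<le>\<^sub>0"
    using y by (auto simp: z_def complex_eq_iff elim!: nonpos_Ints_cases Ints_cases)
  have snz: "sin (of_real pi * z) \<noteq> 0"
    using nonint(1) by (auto simp: sin_eq_0 elim!: Ints_cases)
  \<comment> \<open>The same derivative is computed twice, through Digamma here and through pi /
    sin(pi w) next; comparison gives the reflection formula of Digamma.\<close>
  have D1: "((\<lambda>w. Gamma w * Gamma (1 - w)) has_field_derivative
     Gamma z * Digamma z * Gamma (1 - z) - Gamma z * (Gamma (1 - z) * Digamma (1 - z))) (at z)"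
    by (rule derivative_eq_intros nonint refl | simp add: nonint)+
  have "((\<lambda>w. of_real pi / sin (of_real pi * w)) has_field_derivative
     - (of_real pi * (of_real pi * cos (of_real pi * z))) / (sin (of_real pi * z))\<^sup>2) (at z)"
    using snz by (auto intro!: derivative_eq_intros simp: power2_eq_square)
  then have "((\<lambda>w. Gamma w * Gamma (1 - w)) has_field_derivative
     - (of_real pi * (of_real pi * cos (of_real pi * z))) / (sin (of_real pi * z))\<^sup>2) (at z)"
    by (simp add: Gamma_reflection_complex)
  from DERIV_unique[OF D1 this]
  have "Gamma z * Gamma (1 - z) * (Digamma z - Digamma (1 - z)) = - (of_real pi * (of_real pi * cos (of_real pi * z))) / (sin (of_real pi * z))\<^sup>2"
    by (simp add: algebra_simps)
  then have refl: "Digamma z - Digamma (1 - z) = - (of_real pi * cos (of_real pi * z) / sin (of_real pi * z))"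
    using snz unfolding Gamma_reflection_complex
    by (simp add: divide_simps power2_eq_square) (metis mult_cancel_left mult_minus_right of_real_eq_0_iff pi_neq_zero)
  have znz: "z \<noteq> 0" using y by (auto simp: z_def)
  have "(\<lambda>k. inverse (of_nat (Suc k)) - inverse (w + of_nat k)) sums (Digamma w + euler_mascheroni)" if "w \<noteq> 0" for w :: complex
    using summable_sums[OF summable_Digamma[OF that]] by (simp add: Digamma_def)
  from sums_diff[OF this[of "1 + z"] this[of "1 - z"]]
  have "(\<lambda>k. inverse (1 - z + of_nat k) - inverse (1 + z + of_nat k)) sums (Digamma (1 + z) - Digamma (1 - z))"
  proof -
    have "1 + z \<noteq> 0" "z \<noteq> 1" using nonint(4) nonint(1) by auto
    then show ?thesis using \<open>1 + z \<noteq> 0 \<Longrightarrow> 1 - z \<noteq> 0 \<Longrightarrow> _\<close> by simp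
  qed
  also have "Digamma (1 + z) = Digamma z + 1 / z" using Digamma_plus1[OF znz] by (simp add: add_ac)
  also have "Digamma z + 1 / z - Digamma (1 - z) = 1 / z - of_real pi * cos (of_real pi * z) / sin (of_real pi * z)"
    using refl by (simp add: algebra_simps)
  finally have S: "(\<lambda>k. inverse (1 - z + of_nat k) - inverse (1 + z + of_nat k)) sums (1 / z - of_real pi * cos (of_real pi * z) / sin (of_real pi * z))" .
  have T: "inverse (1 - z + of_nat k) - inverse (1 + z + of_nat k) = \<i> * of_real (2 * y / (real (Suc k) ^ 2 + y\<^sup>2))" for k
  proof -
    have nz: "1 - z + of_nat k \<noteq> 0" "1 + z + of_nat k \<noteq> 0" using y by (auto simp: z_def complex_eq_iff)
    have p: "(1 - z + of_nat k) * (1 + z + of_nat k) = of_real (real (Suc k) ^ 2 + y\<^sup>2)"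
      by (simp add: z_def complex_eq_iff power2_eq_square algebra_simps)
    have "inverse (1 - z + of_nat k) - inverse (1 + z + of_nat k) = 2 * z / ((1 - z + of_nat k) * (1 + z + of_nat k))"
      using nz by (simp add: divide_simps)
    then show ?thesis unfolding p by (simp add: z_def)
  qed
  have eqx: "of_real pi * z = \<i> * of_real (x / 2)" by (simp add: z_def y_def)
  define q where "q = exp (- x)"
  have q: "q < 1" "q > 0" using assms by (auto simp: q_def)
  have R: "1 / z - of_real pi * cos (of_real pi * z) / sin (of_real pi * z) = \<i> * of_real (pi * ((1 + q) / (1 - q)) - 1 / y)"
  proof -
    have c: "cos (\<i> * of_real (x / 2)) = complex_of_real (cosh (x / 2))"
      unfolding cos_i_times exp_of_real by (simp add: cosh_field_def exp_minus)
    have s: "sin (\<i> * of_real (x / 2)) = \<i> * complex_of_real (sinh (x / 2))"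
      unfolding sin_i_times exp_of_real by (simp add: sinh_field_def exp_minus)
    have "cosh (x / 2) * (2 * exp (- (x / 2))) = 1 + q" "sinh (x / 2) * (2 * exp (- (x / 2))) = 1 - q"
      unfolding cosh_field_def sinh_field_def q_def
      by (simp_all add: algebra_simps add_divide_distrib diff_divide_distrib flip: exp_add)
    moreover have "cosh (x / 2) / sinh (x / 2) = (cosh (x / 2) * (2 * exp (- (x / 2)))) / (sinh (x / 2) * (2 * exp (- (x / 2))))"
      by simp
    ultimately have cs: "cosh (x / 2) / sinh (x / 2) = (1 + q) / (1 - q)" by simp
    have "of_real pi * cos (of_real pi * z) / sin (of_real pi * z) = of_real (pi * (cosh (x / 2) / sinh (x / 2))) / \<i>"
      unfolding eqx c s by (simp add: divide_simps)
    moreover have "1 / z = - \<i> * of_real (1 / y)"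
      using y znz by (simp add: nonzero_divide_eq_eq) (simp add: z_def)
    moreover have "- \<i> * of_real (1 / y) - of_real (pi * C) / \<i> = \<i> * of_real (pi * C - 1 / y)" for C
      by (simp add: algebra_simps)
    ultimately show ?thesis unfolding cs by (simp only:)
  qed
  have "(\<lambda>k. \<i> * of_real (2 * y / (real (Suc k) ^ 2 + y\<^sup>2))) sums (\<i> * of_real (pi * ((1 + q) / (1 - q)) - 1 / y))"
    using S unfolding T R .
  then have "(\<lambda>k. complex_of_real (2 * y / (real (Suc k) ^ 2 + y\<^sup>2))) sums of_real (pi * ((1 + q) / (1 - q)) - 1 / y)"
    by (subst (asm) sums_mult_iff) auto
  then have "(\<lambda>k. 2 * y / (real (Suc k) ^ 2 + y\<^sup>2)) sums (pi * ((1 + q) / (1 - q)) - 1 / y)"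
    by (simp only: sums_of_real_iff)
  then have "(\<lambda>k. (2 * y / (real (Suc k) ^ 2 + y\<^sup>2)) / pi) sums ((pi * ((1 + q) / (1 - q)) - 1 / y) / pi)"
    by (rule sums_divide)
  moreover have "(2 * y / (real (Suc k) ^ 2 + y\<^sup>2)) / pi = 4 * x / (x\<^sup>2 + (2 * pi * real (Suc k))\<^sup>2)" for k
  proof -
    have "real (Suc k) ^ 2 + y\<^sup>2 = (x\<^sup>2 + (2 * pi * real (Suc k))\<^sup>2) / (4 * pi\<^sup>2)"
      by (simp add: y_def power_divide power_mult_distrib add_divide_distrib)
    then show ?thesis by (simp add: y_def power2_eq_square)
  qed
  moreover have "(pi * ((1 + q) / (1 - q)) - 1 / y) / pi = (1 + q) / (1 - q) - 2 / x"
    by (simp add: y_def diff_divide_distrib)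
  ultimately show ?thesis by (simp add: q_def)
qed

text \<open>The Laplace transform of \<open>parab\<close>: the trapezoidal identity for exp(-x y)
  makes the unit intervals contribute a geometric series with total coth(x/2) - 2/x, which is then
  expanded in partial fractions.\<close>

lemma nn_integral_parab_exp:
  fixes x :: real
  assumes "x > 0"
  shows "(\<integral>\<^sup>+y. indicator {0<..} y * ennreal (parab y * exp (- (x * y))) \<partial>lborel)
     = (\<Sum>n. ennreal (4 / (x * (x\<^sup>2 + (2 * pi * real (Suc n))\<^sup>2))))"
proof -
  define q where "q = exp (- x)"
  have q: "0 < q" "q < 1" using assms by (auto simp: q_def)
  define c where "c = (1 + q) / (1 - q) - 2 / x"
  have qp: "exp (- (x * real n)) = q ^ n" for n by (simp add: q_def exp_of_nat_mult[symmetric] mult.commute)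
  have J: "((\<lambda>y. parab y * (x\<^sup>2 * exp (- (x * y)))) has_integral (1 - q ^ N) * c) {0..real N}" for N
  proof (induction N)
    case 0
    have "((\<lambda>y. parab y * (x\<^sup>2 * exp (- (x * y)))) has_integral 0) (cbox 0 0)" by (intro has_integral_null) simp
    then show ?case by simp
  next
    case (Suc N)
    have "((\<lambda>y. parab y *\<^sub>R (x\<^sup>2 * exp (- (x * y)))) has_integral
       exp (- (x * real N)) + exp (- (x * (real N + 1))) - 2 *\<^sub>R (- exp (- (x * (real N + 1))) / x - (- exp (- (x * real N)) / x))) {real N..real N + 1}"
    proof (rule has_integral_parab_second_derivative)
      fix y assume "y \<in> {real N..real N + 1}"
      show "((\<lambda>y. - exp (- (x * y)) / x) has_vector_derivative exp (- (x * y))) (at y within {real N..real N + 1})"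
        using assms by (auto intro!: derivative_eq_intros simp flip: has_real_derivative_iff_has_vector_derivative)
      show "((\<lambda>y. exp (- (x * y))) has_vector_derivative - x * exp (- (x * y))) (at y within {real N..real N + 1})"
        by (auto intro!: derivative_eq_intros simp flip: has_real_derivative_iff_has_vector_derivative)
      show "((\<lambda>y. - x * exp (- (x * y))) has_vector_derivative x\<^sup>2 * exp (- (x * y))) (at y within {real N..real N + 1})"
        by (auto intro!: derivative_eq_intros simp: power2_eq_square simp flip: has_real_derivative_iff_has_vector_derivative)
    qed
    moreover have "exp (- (x * (real N + 1))) = q ^ Suc N" using qp[of "Suc N"] by (simp add: add.commute)
    ultimately have "((\<lambda>y. parab y * (x\<^sup>2 * exp (- (x * y)))) has_integral
       q ^ N + q ^ Suc N - 2 * (- (q ^ Suc N) / x - (- (q ^ N) / x))) {real N..real N + 1}"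
      by (simp add: qp)
    then have "((\<lambda>y. parab y * (x\<^sup>2 * exp (- (x * y)))) has_integral
      (1 - q ^ N) * c + (q ^ N + q ^ Suc N - 2 * (- (q ^ Suc N) / x - (- (q ^ N) / x)))) {0..real N + 1}"
      using Suc by (intro has_integral_combine[where c = "real N"]) auto
    moreover have "(1 - q ^ N) * c + (q ^ N + q ^ Suc N - 2 * (- (q ^ Suc N) / x - (- (q ^ N) / x))) = (1 - q ^ Suc N) * c"
      using q assms by (simp add: c_def divide_simps) (simp add: algebra_simps)
    ultimately show ?case by (simp add: add.commute)
  qed
  define f where "f N y = ennreal (indicator {0..real N} y * (parab y * (x\<^sup>2 * exp (- (x * y)))))" for N y
  have fN: "(\<integral>\<^sup>+y. f N y \<partial>lborel) = ennreal ((1 - q ^ N) * c)" for N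
    unfolding f_def
  proof (rule nn_integral_has_integral_lborel)
    have "((\<lambda>y. if y \<in> {0..real N} then parab y * (x\<^sup>2 * exp (- (x * y))) else 0) has_integral (1 - q ^ N) * c) UNIV"
      using J[of N] by (simp only: has_integral_restrict_UNIV)
    then show "((\<lambda>y. indicator {0..real N} y * (parab y * (x\<^sup>2 * exp (- (x * y))))) has_integral (1 - q ^ N) * c) UNIV"
      by (rule has_integral_eq[rotated]) (auto simp: indicator_def)
  qed (use parab_bounds in \<open>auto simp: indicator_def\<close>)
  have mono: "incseq f"
    unfolding incseq_def le_fun_def f_def using parab_bounds
    by (auto simp: indicator_def intro!: ennreal_leI)
  have sup: "(SUP N. f N y) = indicator {0<..} y * ennreal (parab y * (x\<^sup>2 * exp (- (x * y))))" for y
  proof -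
    obtain N0 :: nat where N0: "y \<le> real N0" using real_arch_simple by blast
    \<comment> \<open>The closed intervals contain 0 and the target set does not; the kernel
      vanishes there.\<close>
    have "parab 0 = 0" by (simp add: parab_def)
    have "eventually (\<lambda>N. f N y = indicator {0<..} y * ennreal (parab y * (x\<^sup>2 * exp (- (x * y))))) sequentially"
      using eventually_ge_at_top[of N0]
    proof eventually_elim
      case (elim N)
      then have "y \<le> real N" using N0 by linarith
      then show ?case using \<open>parab 0 = 0\<close> by (cases "y = 0") (auto simp: f_def indicator_def)
    qed
    then have "(\<lambda>N. f N y) \<longlonglongrightarrow> indicator {0<..} y * ennreal (parab y * (x\<^sup>2 * exp (- (x * y))))"
      by (rule tendsto_eventually)
    moreover have "(\<lambda>N. f N y) \<longlonglongrightarrow> (SUP N. f N y)"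
      using mono by (intro LIMSEQ_SUP) (auto simp: incseq_def le_fun_def)
    ultimately show ?thesis using LIMSEQ_unique by blast
  qed
  have "(\<lambda>N. \<integral>\<^sup>+y. f N y \<partial>lborel) \<longlonglongrightarrow> (\<integral>\<^sup>+y. (SUP N. f N y) \<partial>lborel)"
  proof -
    have meas: "f N \<in> borel_measurable lborel" for N unfolding f_def by measurable
    have "(\<integral>\<^sup>+y. (SUP N. f N y) \<partial>lborel) = (SUP N. \<integral>\<^sup>+y. f N y \<partial>lborel)"
      by (rule nn_integral_monotone_convergence_SUP[OF mono meas])
    moreover have "incseq (\<lambda>N. \<integral>\<^sup>+y. f N y \<partial>lborel)"
      using mono by (auto simp: incseq_def le_fun_def intro!: nn_integral_mono)
    ultimately show ?thesis using LIMSEQ_SUP by metis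
  qed
  moreover have "(\<lambda>N. ennreal ((1 - q ^ N) * c)) \<longlonglongrightarrow> ennreal ((1 - 0) * c)"
    using q by (intro tendsto_intros LIMSEQ_realpow_zero) auto
  ultimately have "(\<integral>\<^sup>+y. indicator {0<..} y * ennreal (parab y * (x\<^sup>2 * exp (- (x * y)))) \<partial>lborel) = ennreal c"
    unfolding fN sup using LIMSEQ_unique by fastforce
  moreover have "(\<integral>\<^sup>+y. indicator {0<..} y * ennreal (parab y * (x\<^sup>2 * exp (- (x * y)))) \<partial>lborel)
     = ennreal (x\<^sup>2) * (\<integral>\<^sup>+y. indicator {0<..} y * ennreal (parab y * exp (- (x * y))) \<partial>lborel)"
    using parab_bounds(1)
    by (subst nn_integral_cmult[symmetric]) (auto simp: mult_ac simp flip: ennreal_mult' intro!: nn_integral_cong)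
  ultimately have "ennreal (1 / x\<^sup>2) * (ennreal (x\<^sup>2) * (\<integral>\<^sup>+y. indicator {0<..} y * ennreal (parab y * exp (- (x * y))) \<partial>lborel)) = ennreal (1 / x\<^sup>2) * ennreal c"
    by (simp only:)
  moreover have "ennreal (1 / x\<^sup>2) * ennreal (x\<^sup>2) = 1" using assms by (simp flip: ennreal_mult')
  ultimately have L: "(\<integral>\<^sup>+y. indicator {0<..} y * ennreal (parab y * exp (- (x * y))) \<partial>lborel) = ennreal (c / x\<^sup>2)"
    by (simp flip: mult.assoc ennreal_mult')
  have "(\<lambda>n. 4 * x / (x\<^sup>2 + (2 * pi * real (Suc n))\<^sup>2) / x\<^sup>2) sums (c / x\<^sup>2)"
    using coth_partial_fractions[OF assms] unfolding c_def q_def by (rule sums_divide)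
  moreover have "4 * x / (x\<^sup>2 + (2 * pi * real (Suc n))\<^sup>2) / x\<^sup>2 = 4 / (x * (x\<^sup>2 + (2 * pi * real (Suc n))\<^sup>2))" for n
    using assms by (simp add: power2_eq_square)
  ultimately have S: "(\<lambda>n. 4 / (x * (x\<^sup>2 + (2 * pi * real (Suc n))\<^sup>2))) sums (c / x\<^sup>2)" by simp
  show ?thesis unfolding L
    by (rule suminf_ennreal_eq[OF _ S, symmetric]) (use assms in auto)
qed

text \<open>For -1 < \<sigma> < 0 the remainder integral may start at 0, since
  \<open>parab y\<close> behaves like y there. The added piece over (0,1), times \<sigma> (\<sigma>
  + 1) / 2, is exactly 1/2 + 1/(\<sigma> - 1), so \<open>zeta_cont\<close> becomes a single Mellin
  integral.\<close>

lemma zeta_cont_strip_nn_integral: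
  fixes \<sigma> :: real
  assumes "-1 < \<sigma>" "\<sigma> < 0"
  obtains r where "r \<ge> 0" "(\<integral>\<^sup>+y. indicator {0<..} y * ennreal (parab y * y powr (- \<sigma> - 2)) \<partial>lborel) = ennreal r"
    "zeta_cont (of_real \<sigma>) = of_real (\<sigma> * (\<sigma> + 1) / 2 * r)"
proof -
  define g where "g y = parab y * y powr (- \<sigma> - 2)" for y
  have g0: "g y \<ge> 0" for y using parab_bounds by (simp add: g_def)
  have [measurable]: "g \<in> borel_measurable borel" unfolding g_def by measurable
  define r1 where "r1 = (LINT x:{1..}|lborel. g x)"
  have co: "of_real (g x) = of_real (parab x) * complex_of_real x powr (- of_real \<sigma> - 2)" if "x \<ge> 1" for x
    using that by (simp add: g_def powr_of_real[symmetric])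
  have eqs: "complex_of_real (indicat_real {1..} x *\<^sub>R g x) = indicat_real {1..} x *\<^sub>R (of_real (parab x) * complex_of_real x powr (- of_real \<sigma> - 2))" for x
    using co[of x] by (auto simp: indicator_def)
  have zr: "zeta_rem (of_real \<sigma>) = of_real r1"
    unfolding zeta_rem_def r1_def set_lebesgue_integral_def eqs[symmetric] by (rule integral_complex_of_real)
  have int1: "integrable lborel (\<lambda>x. indicat_real {1..} x * g x)"
    using zeta_rem_integrand_integrable[of "of_real \<sigma>"] assms
    unfolding set_integrable_def eqs[symmetric] complex_of_real_integrable_eq by simp
  have n1: "(\<integral>\<^sup>+x. ennreal (indicat_real {1..} x * g x) \<partial>lborel) = ennreal r1"
    using nn_integral_eq_integral[OF int1] g0 by (simp add: r1_def set_lebesgue_integral_def)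
  have r1: "r1 \<ge> 0" unfolding r1_def set_lebesgue_integral_def using g0 by (intro Bochner_Integration.integral_nonneg) auto
  define r0 where "r0 = 1 / (- \<sigma>) - 1 / (1 - \<sigma>)"
  have p: "((\<lambda>x. x powr a) has_integral 1 powr (a + 1) / (a + 1)) {0..1}" if "a > -1" for a :: real
    by (rule has_integral_powr_from_0) (use that in auto)
  have "((\<lambda>x. x powr (- \<sigma> - 1) - x powr (- \<sigma>)) has_integral r0) {0..1}"
    using has_integral_diff[OF p[of "- \<sigma> - 1"] p[of "- \<sigma>"]] assms by (simp add: r0_def)
  then have "((\<lambda>x. if x \<in> {0<..<1} then g x else 0) has_integral r0) {0..1}"
  proof (rule has_integral_spike[of "{0,1}", rotated 2])
    fix x :: real assume x: "x \<in> {0..1} - {0,1}"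
    then have "frac x = x" by (simp add: frac_eq)
    then have "g x = x * x powr (- \<sigma> - 2) - x * (x * x powr (- \<sigma> - 2))" by (simp add: g_def parab_def algebra_simps)
    also have "\<dots> = x powr (- \<sigma> - 1) - x powr (- \<sigma>)"
    proof -
      have "1 + (- \<sigma> - 2) = - \<sigma> - 1" "1 + (- \<sigma> - 1) = - \<sigma>" by simp_all
      then have "x * x powr (- \<sigma> - 2) = x powr (- \<sigma> - 1)" "x * x powr (- \<sigma> - 1) = x powr (- \<sigma>)"
        using x by (auto simp only: powr_mult_base atLeastAtMost_iff Diff_iff)
      then show ?thesis by (simp only:)
    qed
    finally show "(if x \<in> {0<..<1} then g x else 0) = x powr (- \<sigma> - 1) - x powr (- \<sigma>)" using x by auto
  qed auto
  then have hi: "((\<lambda>x. if x \<in> {0<..<1} then g x else 0) has_integral r0) UNIV"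
    by (rule has_integral_on_superset) auto
  have n0: "(\<integral>\<^sup>+x. ennreal (if x \<in> {0<..<1} then g x else 0) \<partial>lborel) = ennreal r0"
    by (rule nn_integral_has_integral_lborel[OF _ _ hi]) (use g0 in auto)
  have r0: "r0 \<ge> 0" using has_integral_nonneg[OF hi] g0 by simp
  have "(\<integral>\<^sup>+y. indicator {0<..} y * ennreal (g y) \<partial>lborel) = (\<integral>\<^sup>+y. ennreal (if y \<in> {0<..<1} then g y else 0) + ennreal (indicat_real {1..} y * g y) \<partial>lborel)"
    by (intro nn_integral_cong) (auto simp: indicator_def)
  also have "\<dots> = ennreal r0 + ennreal r1" by (subst nn_integral_add) (auto simp: n1 n0[simplified])
  also have "\<dots> = ennreal (r0 + r1)" using r0 r1 by simp
  finally have N: "(\<integral>\<^sup>+y. indicator {0<..} y * ennreal (g y) \<partial>lborel) = ennreal (r0 + r1)" .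
  have "zeta_cont (of_real \<sigma>) = of_real (1/2 + 1 / (\<sigma> - 1) + \<sigma> * (\<sigma> + 1) / 2 * r1)"
    by (simp add: zeta_cont_def zr)
  also have "1/2 + 1 / (\<sigma> - 1) = \<sigma> * (\<sigma> + 1) / 2 * r0"
    using assms by (simp add: r0_def divide_simps) (simp add: algebra_simps power2_eq_square)
  finally show ?thesis using that[of "r0 + r1"] r0 r1 N by (simp add: g_def distrib_left)
qed

text \<open>For real \<open>\<sigma>\<close> in the strip every integrand is nonnegative, so all interchanges are
  Tonelli; the identity theorem takes care of complex arguments later.\<close>

lemma zeta_cont_functional_equation_real:
  fixes \<sigma> :: real
  assumes \<sigma>: "-1 < \<sigma>" "\<sigma> < 0"
  shows "zeta_cont (of_real \<sigma>) = of_real (2 * (2 * pi) powr (\<sigma> - 1) * sin (pi * \<sigma> / 2) * Gamma (1 - \<sigma>)) * zeta_cont (of_real (1 - \<sigma>))"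
proof -
  obtain r where r: "r \<ge> 0" "(\<integral>\<^sup>+y. indicator {0<..} y * ennreal (parab y * y powr (- \<sigma> - 2)) \<partial>lborel) = ennreal r"
    "zeta_cont (of_real \<sigma>) = of_real (\<sigma> * (\<sigma> + 1) / 2 * r)"
    using zeta_cont_strip_nn_integral[OF \<sigma>] .
  define G where "G = Gamma ((1 + \<sigma>) / 2) * Gamma ((1 - \<sigma>) / 2)"
  have G: "G > 0" using \<sigma> by (simp add: G_def Gamma_real_pos)
  have Gpos: "Gamma (\<sigma> + 2) > 0" using \<sigma> by (simp add: Gamma_real_pos)
  \<comment> \<open>The factor \<open>Gamma (\<sigma> + 2)\<close> lets the power of y be written as
    a Laplace integral in x; after the exchange the y-integral is the Laplace transform of
    \<open>parab\<close>.\<close>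
  have "ennreal (Gamma (\<sigma> + 2)) * ennreal r = (\<integral>\<^sup>+y. indicator {0<..} y * ennreal (parab y) * ennreal (Gamma (\<sigma> + 2) * y powr (- (\<sigma> + 2))) \<partial>lborel)"
  proof -
    have "ennreal (Gamma (\<sigma> + 2)) * ennreal r = (\<integral>\<^sup>+y. ennreal (Gamma (\<sigma> + 2)) * (indicator {0<..} y * ennreal (parab y * y powr (- \<sigma> - 2))) \<partial>lborel)"
      unfolding r(2)[symmetric] by (rule nn_integral_cmult[symmetric]) measurable
    also have "\<dots> = (\<integral>\<^sup>+y. indicator {0<..} y * ennreal (parab y) * ennreal (Gamma (\<sigma> + 2) * y powr (- (\<sigma> + 2))) \<partial>lborel)"
    proof (rule nn_integral_cong)
      fix y :: real
      have e: "- \<sigma> - 2 = - (\<sigma> + 2)" by simp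
      show "ennreal (Gamma (\<sigma> + 2)) * (indicator {0<..} y * ennreal (parab y * y powr (- \<sigma> - 2))) = indicator {0<..} y * ennreal (parab y) * ennreal (Gamma (\<sigma> + 2) * y powr (- (\<sigma> + 2)))"
        unfolding e using Gpos parab_bounds(1)[of y] by (simp only: ennreal_mult' less_imp_le mult_ac)
    qed
    finally show ?thesis .
  qed
  also have "\<dots> = (\<integral>\<^sup>+y. \<integral>\<^sup>+x. indicator {0<..} y * ennreal (parab y) * (indicator {0<..} x * ennreal (x powr (\<sigma> + 1) * exp (- (x * y)))) \<partial>lborel \<partial>lborel)"
  proof (rule nn_integral_cong)
    fix y :: real
    show "indicator {0<..} y * ennreal (parab y) * ennreal (Gamma (\<sigma> + 2) * y powr (- (\<sigma> + 2)))
      = (\<integral>\<^sup>+x. indicator {0<..} y * ennreal (parab y) * (indicator {0<..} x * ennreal (x powr (\<sigma> + 1) * exp (- (x * y)))) \<partial>lborel)"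
    proof (cases "y > 0")
      case True
      have "(\<integral>\<^sup>+x. indicator {0<..} x * ennreal (x powr (\<sigma> + 1) * exp (- (x * y))) \<partial>lborel) = ennreal (Gamma (\<sigma> + 2) * y powr (- (\<sigma> + 2)))"
        using nn_integral_Gamma_scaled[of "\<sigma> + 2" y] True \<sigma> by (simp add: add_ac)
      moreover have "(\<integral>\<^sup>+x. indicator {0<..} y * ennreal (parab y) * (indicator {0<..} x * ennreal (x powr (\<sigma> + 1) * exp (- (x * y)))) \<partial>lborel)
         = indicator {0<..} y * ennreal (parab y) * (\<integral>\<^sup>+x. indicator {0<..} x * ennreal (x powr (\<sigma> + 1) * exp (- (x * y))) \<partial>lborel)"
        by (rule nn_integral_cmult) measurable
      ultimately show ?thesis by (simp only:)
    qed simp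
  qed
  also have "\<dots> = (\<integral>\<^sup>+x. \<integral>\<^sup>+y. indicator {0<..} y * ennreal (parab y) * (indicator {0<..} x * ennreal (x powr (\<sigma> + 1) * exp (- (x * y)))) \<partial>lborel \<partial>lborel)"
    by (rule lborel_pair.Fubini') measurable
  also have "\<dots> = (\<integral>\<^sup>+x. (\<Sum>n. ennreal 4 * (indicator {0<..} x * ennreal (x powr \<sigma> / (x\<^sup>2 + (2 * pi * real (Suc n))\<^sup>2)))) \<partial>lborel)"
  proof (rule nn_integral_cong)
    fix x :: real
    show "(\<integral>\<^sup>+y. indicator {0<..} y * ennreal (parab y) * (indicator {0<..} x * ennreal (x powr (\<sigma> + 1) * exp (- (x * y)))) \<partial>lborel)
      = (\<Sum>n. ennreal 4 * (indicator {0<..} x * ennreal (x powr \<sigma> / (x\<^sup>2 + (2 * pi * real (Suc n))\<^sup>2))))"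
    proof (cases "x > 0")
      case True
      have "(\<integral>\<^sup>+y. indicator {0<..} y * ennreal (parab y) * (indicator {0<..} x * ennreal (x powr (\<sigma> + 1) * exp (- (x * y)))) \<partial>lborel)
        = (\<integral>\<^sup>+y. ennreal (x powr (\<sigma> + 1)) * (indicator {0<..} y * ennreal (parab y * exp (- (x * y)))) \<partial>lborel)"
        using True by (intro nn_integral_cong) (simp add: ennreal_mult' parab_bounds mult_ac)
      also have "\<dots> = ennreal (x powr (\<sigma> + 1)) * (\<Sum>n. ennreal (4 / (x * (x\<^sup>2 + (2 * pi * real (Suc n))\<^sup>2))))"
        using nn_integral_parab_exp[OF True] by (subst nn_integral_cmult) auto
      also have "\<dots> = (\<Sum>n. ennreal (x powr (\<sigma> + 1)) * ennreal (4 / (x * (x\<^sup>2 + (2 * pi * real (Suc n))\<^sup>2))))"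
        by (rule ennreal_suminf_cmult[symmetric])
      also have "\<dots> = (\<Sum>n. ennreal 4 * (indicator {0<..} x * ennreal (x powr \<sigma> / (x\<^sup>2 + (2 * pi * real (Suc n))\<^sup>2))))"
      proof (rule suminf_cong)
        fix n
        have "x powr (\<sigma> + 1) = x * x powr \<sigma>" using True by (simp add: powr_add)
        then have "x powr (\<sigma> + 1) * (4 / (x * (x\<^sup>2 + (2 * pi * real (Suc n))\<^sup>2))) = 4 * (x powr \<sigma> / (x\<^sup>2 + (2 * pi * real (Suc n))\<^sup>2))"
          using True by simp
        then show "ennreal (x powr (\<sigma> + 1)) * ennreal (4 / (x * (x\<^sup>2 + (2 * pi * real (Suc n))\<^sup>2))) = ennreal 4 * (indicator {0<..} x * ennreal (x powr \<sigma> / (x\<^sup>2 + (2 * pi * real (Suc n))\<^sup>2)))"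
          using True by (simp flip: ennreal_mult' ennreal_numeral)
      qed
      finally show ?thesis .
    qed simp
  qed
  also have "\<dots> = (\<Sum>n. \<integral>\<^sup>+x. ennreal 4 * (indicator {0<..} x * ennreal (x powr \<sigma> / (x\<^sup>2 + (2 * pi * real (Suc n))\<^sup>2))) \<partial>lborel)"
    by (rule nn_integral_suminf) measurable
  \<comment> \<open>Each partial fraction integrates to a multiple of (2 pi n)^(\<sigma> - 1), so
    the Dirichlet series at 1 - \<sigma> appears.\<close>
  also have "\<dots> = (\<Sum>n. ennreal (2 * G * (2 * pi * real (Suc n)) powr (\<sigma> - 1)))"
  proof (rule suminf_cong)
    fix n
    have "(\<integral>\<^sup>+x. ennreal 4 * (indicator {0<..} x * ennreal (x powr \<sigma> / (x\<^sup>2 + (2 * pi * real (Suc n))\<^sup>2))) \<partial>lborel)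
      = ennreal 4 * ennreal (G / 2 * (2 * pi * real (Suc n)) powr (\<sigma> - 1))"
      using nn_integral_powr_over_quadratic[of \<sigma> "2 * pi * real (Suc n)"] \<sigma>
      by (subst nn_integral_cmult) (auto simp: G_def)
    also have "\<dots> = ennreal (4 * (G / 2 * (2 * pi * real (Suc n)) powr (\<sigma> - 1)))" using G by (intro ennreal_mult'[symmetric]) auto
    also have "\<dots> = ennreal (2 * G * (2 * pi * real (Suc n)) powr (\<sigma> - 1))" by (rule arg_cong[where f = ennreal]) simp
    finally show "(\<integral>\<^sup>+x. ennreal 4 * (indicator {0<..} x * ennreal (x powr \<sigma> / (x\<^sup>2 + (2 * pi * real (Suc n))\<^sup>2))) \<partial>lborel) = ennreal (2 * G * (2 * pi * real (Suc n)) powr (\<sigma> - 1))" .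
  qed
  finally have E1: "ennreal (Gamma (\<sigma> + 2) * r) = (\<Sum>n. ennreal (2 * G * (2 * pi * real (Suc n)) powr (\<sigma> - 1)))"
    using Gpos r by (simp add: ennreal_mult')
  have cn: "1 / of_nat (Suc n) powr of_real (1 - \<sigma>) = complex_of_real (real (Suc n) powr (\<sigma> - 1))" for n
  proof -
    have "of_nat (Suc n) powr of_real (1 - \<sigma>) = complex_of_real (real (Suc n) powr (1 - \<sigma>))"
      by (subst powr_of_real[symmetric]) auto
    moreover have "real (Suc n) powr (\<sigma> - 1) = 1 / real (Suc n) powr (1 - \<sigma>)"
      by (metis minus_diff_eq powr_minus_divide)
    ultimately show ?thesis by simp
  qed
  have "(\<lambda>n. complex_of_real (real (Suc n) powr (\<sigma> - 1))) sums zeta_cont (of_real (1 - \<sigma>))"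
    using zeta_cont_sums[of "of_real (1 - \<sigma>)"] \<sigma> unfolding cn by simp
  then have cs: "(\<lambda>n. complex_of_real (real (Suc n) powr (\<sigma> - 1))) sums zeta_cont (of_real (1 - \<sigma>))" .
  define Z where "Z = Re (zeta_cont (of_real (1 - \<sigma>)))"
  have Zs: "(\<lambda>n. real (Suc n) powr (\<sigma> - 1)) sums Z"
    using sums_Re[OF cs] by (simp add: Z_def)
  have "(\<lambda>n. 0 :: real) sums Im (zeta_cont (of_real (1 - \<sigma>)))" using sums_Im[OF cs] by simp
  then have "Im (zeta_cont (of_real (1 - \<sigma>))) = 0" using sums_zero sums_unique2 by blast
  then have Z: "zeta_cont (of_real (1 - \<sigma>)) = of_real Z" by (simp add: Z_def complex_eq_iff)
  have "(\<lambda>n. 2 * G * (2 * pi) powr (\<sigma> - 1) * real (Suc n) powr (\<sigma> - 1)) sums (2 * G * (2 * pi) powr (\<sigma> - 1) * Z)"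
    by (rule sums_mult[OF Zs])
  moreover have "2 * G * (2 * pi * real (Suc n)) powr (\<sigma> - 1) = 2 * G * (2 * pi) powr (\<sigma> - 1) * real (Suc n) powr (\<sigma> - 1)" for n
    by (simp only: powr_mult mult.assoc)
  ultimately have S: "(\<lambda>n. 2 * G * (2 * pi * real (Suc n)) powr (\<sigma> - 1)) sums (2 * G * (2 * pi) powr (\<sigma> - 1) * Z)"
    by (simp only:)
  have "ennreal (Gamma (\<sigma> + 2) * r) = ennreal (2 * G * (2 * pi) powr (\<sigma> - 1) * Z)"
    unfolding E1 by (rule suminf_ennreal_eq[OF _ S]) (use G in auto)
  moreover have "0 \<le> 2 * G * (2 * pi) powr (\<sigma> - 1) * Z"
    by (rule sums_le[OF _ sums_zero S]) (use G in auto)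
  ultimately have E2: "Gamma (\<sigma> + 2) * r = 2 * G * (2 * pi) powr (\<sigma> - 1) * Z"
    using Gpos r by simp
  have "\<sigma> \<notin> \<int>" using \<sigma> by (auto elim!: Ints_cases)
  then have np: "\<sigma> \<notin> \<int>\<^sub>\<le>\<^sub>0" "\<sigma> + 1 \<notin> \<int>\<^sub>\<le>\<^sub>0" using \<sigma> by (auto elim!: nonpos_Ints_cases)
  have G2: "Gamma (\<sigma> + 2) = \<sigma> * (\<sigma> + 1) * Gamma \<sigma>"
    using Gamma_plus1[OF np(1)] Gamma_plus1[OF np(2)] by (simp add: add_ac)
  have refl: "Gamma x * Gamma (1 - x) * sin (pi * x) = pi" if "sin (pi * x) \<noteq> 0" for x :: real
  proof -
    have "complex_of_real (Gamma x * Gamma (1 - x)) = Gamma (of_real x) * Gamma (1 - of_real x)"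
      by (simp only: of_real_mult of_real_diff of_real_1 flip: Gamma_complex_of_real)
    also have "\<dots> = of_real pi / sin (of_real pi * of_real x)" by (rule Gamma_reflection_complex)
    also have "\<dots> = of_real (pi / sin (pi * x))"
      by (simp only: of_real_divide of_real_mult flip: sin_of_real)
    finally have "complex_of_real (Gamma x * Gamma (1 - x)) = of_real (pi / sin (pi * x))" .
    then have "Gamma x * Gamma (1 - x) = pi / sin (pi * x)" by (simp only: of_real_eq_iff)
    then show ?thesis using that by simp
  qed
  have p1: "- pi < pi * \<sigma>" using mult_strict_left_mono[OF \<sigma>(1) pi_gt_zero] by simp
  have \<sigma>1: "\<sigma> < 1" using \<sigma> by simp
  have p2: "pi * \<sigma> < 0" using \<sigma>(2) by (simp add: mult_pos_neg)
  have c: "cos (pi * \<sigma> / 2) > 0" using p1 p2 \<sigma>1 by (intro cos_gt_zero_pi) auto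
  have s: "sin (pi * \<sigma> / 2) \<noteq> 0"
  proof -
    have "sin (- (pi * \<sigma> / 2)) > 0" using p1 p2 pi_gt_zero by (intro sin_gt_zero) auto
    then show ?thesis by simp
  qed
  have sc: "sin (pi * \<sigma>) = 2 * sin (pi * \<sigma> / 2) * cos (pi * \<sigma> / 2)"
    using sin_double[of "pi * \<sigma> / 2"] by simp
  have "sin (pi * ((1 + \<sigma>) / 2)) = cos (pi * \<sigma> / 2)"
    using cos_sin_eq[of "- (pi * \<sigma> / 2)"] by (simp add: field_simps)
  \<comment> \<open>Reflection at (1 + \<sigma>) / 2 removes the product \<open>G\<close>;
    reflection at \<sigma> then removes the remaining \<open>Gamma \<sigma>\<close>, and the cosine
    cancels.\<close>
  then have GG: "G * cos (pi * \<sigma> / 2) = pi"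
    using refl[of "(1 + \<sigma>) / 2"] c by (simp add: G_def field_simps)
  have R: "Gamma \<sigma> * Gamma (1 - \<sigma>) * (2 * sin (pi * \<sigma> / 2) * cos (pi * \<sigma> / 2)) = pi"
    using refl[of \<sigma>] s c unfolding sc by simp
  define W where "W = \<sigma> * (\<sigma> + 1) / 2 * r"
  have E3: "Gamma \<sigma> * W = G * (2 * pi) powr (\<sigma> - 1) * Z"
    using E2 unfolding G2 W_def by (simp add: algebra_simps)
  have "pi * W = (Gamma \<sigma> * W) * Gamma (1 - \<sigma>) * (2 * sin (pi * \<sigma> / 2) * cos (pi * \<sigma> / 2))"
    using R by (metis (no_types, opaque_lifting) mult.assoc mult.commute)
  also have "\<dots> = (G * cos (pi * \<sigma> / 2)) * ((2 * pi) powr (\<sigma> - 1) * Z * Gamma (1 - \<sigma>) * 2 * sin (pi * \<sigma> / 2))"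
    unfolding E3 by (simp only: mult_ac)
  finally have "W = (2 * pi) powr (\<sigma> - 1) * Z * Gamma (1 - \<sigma>) * 2 * sin (pi * \<sigma> / 2)"
    unfolding GG by simp
  then show ?thesis using r(3) unfolding Z W_def by (simp flip: of_real_mult add: mult_ac)
qed

subsection \<open>A lower bound to the right of the critical strip\<close>

text \<open>Sieving out the multiples of finitely many primes: what remains of the Dirichlet series
  is dominated by its first term.\<close>

lemma has_sum_sieve:
  fixes Z :: complex
  assumes "finite P" "\<And>p. p \<in> P \<Longrightarrow> prime p"
    and Z: "((\<lambda>n. of_nat n powr (- s)) has_sum Z) {1..}"
  shows "((\<lambda>n. of_nat n powr (- s)) has_sum (Z * (\<Prod>p\<in>P. 1 - of_nat p powr (- s)))) {n. n \<ge> (1::nat) \<and> (\<forall>p\<in>P. \<not> p dvd n)}"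
  using assms(1,2)
proof (induction P rule: finite_induct)
  case empty
  have "{n. n \<ge> (1::nat)} = {1..}" by auto
  then show ?case using Z by simp
next
  case (insert p P)
  let ?f = "\<lambda>n. complex_of_nat n powr (- s)"
  define A where "A = {n. n \<ge> (1::nat) \<and> (\<forall>p\<in>P. \<not> p dvd n)}"
  define W where "W = Z * (\<Prod>p\<in>P. 1 - of_nat p powr (- s))"
  have IH: "(?f has_sum W) A" using insert unfolding A_def W_def by auto
  have p: "prime p" "p > 0" using insert.prems by (auto simp: prime_gt_0_nat)
  \<comment> \<open>As p differs from the primes already sieved, multiplying by p keeps a number in
    A. Hence the multiples of p contribute p^(-s) times the whole sum.\<close>
  have img: "(\<lambda>n. p * n) ` A = {n \<in> A. p dvd n}"
  proof (intro set_eqI iffI)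
    fix m assume "m \<in> (\<lambda>n. p * n) ` A"
    then obtain n where n: "m = p * n" "n \<in> A" by auto
    have "\<not> q dvd p * n" if "q \<in> P" for q
    proof
      assume "q dvd p * n"
      moreover have "prime q" "q \<noteq> p" using insert that by auto
      ultimately have "q dvd n" using p(1) by (metis prime_dvd_mult_iff primes_dvd_imp_eq)
      then show False using n that by (auto simp: A_def)
    qed
    then show "m \<in> {n \<in> A. p dvd n}" using n p by (auto simp: A_def)
  next
    fix m assume "m \<in> {n \<in> A. p dvd n}"
    then obtain k where "m = p * k" "m \<in> A" by auto
    moreover then have "k \<in> A" by (auto simp: A_def)
    ultimately show "m \<in> (\<lambda>n. p * n) ` A" by auto
  qed
  have "((\<lambda>n. of_nat p powr (- s) * ?f n) has_sum (of_nat p powr (- s) * W)) A"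
    using IH by (rule has_sum_cmult_right)
  then have "((?f \<circ> (\<lambda>n. p * n)) has_sum (of_nat p powr (- s) * W)) A"
    by (rule has_sum_cong[THEN iffD1, rotated]) (simp add: powr_times_real)
  then have "(?f has_sum (of_nat p powr (- s) * W)) ((\<lambda>n. p * n) ` A)"
    using p by (subst has_sum_reindex) (auto intro!: inj_onI)
  then have "(?f has_sum (W - of_nat p powr (- s) * W)) (A - {n \<in> A. p dvd n})"
    unfolding img using IH by (intro has_sum_Diff) auto
  moreover have "A - {n \<in> A. p dvd n} = {n. n \<ge> (1::nat) \<and> (\<forall>q\<in>insert p P. \<not> q dvd n)}"
    by (auto simp: A_def)
  moreover have "W - of_nat p powr (- s) * W = Z * (\<Prod>q\<in>insert p P. 1 - of_nat q powr (- s))"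
    using insert.hyps by (simp add: W_def algebra_simps)
  ultimately show ?case by simp
qed

text \<open>N makes the tail from N on at most 1/2 and depends on \<sigma>0 only. After sieving by
  the primes up to N the sum differs from 1 by at most 1/2, while every removed factor has norm at
  most 2, so the bound is uniform in Im s.\<close>

lemma zeta_cont_lower_bound:
  assumes "\<sigma>0 > (1::real)"
  obtains c where "c > 0" "\<And>s. Re s \<ge> \<sigma>0 \<Longrightarrow> norm (zeta_cont s) \<ge> c"
proof -
  have "summable (\<lambda>n. real n powr (- \<sigma>0))" using assms by (subst summable_real_powr_iff) auto
  then obtain N where N: "\<And>n. (\<Sum>k\<in>{N..<n}. real k powr (- \<sigma>0)) < 1/2"
  proof -
    from \<open>summable (\<lambda>n. real n powr (- \<sigma>0))\<close> obtain N where "\<forall>m\<ge>N. \<forall>n. norm (\<Sum>k\<in>{m..<n}. real k powr (- \<sigma>0)) < 1/2"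
      unfolding summable_Cauchy by (meson half_gt_zero zero_less_one)
    then show ?thesis using that[of N] by (smt (verit) le_refl real_norm_def)
  qed
  define P where "P = {p. prime p \<and> p \<le> N}"
  have P: "finite P" "\<And>p. p \<in> P \<Longrightarrow> prime p" unfolding P_def by auto
  show ?thesis
  proof (rule that[of "1 / (2 * 2 ^ card P)"])
    fix s :: complex assume s: "Re s \<ge> \<sigma>0"
    let ?f = "\<lambda>n. complex_of_nat n powr (- s)"
    have nf: "norm (?f n) = real n powr (- Re s)" for n
      using norm_powr_real_powr[of "of_nat n" "- s"] by simp
    have "(\<lambda>n. 1 / of_nat (Suc n) powr s) sums zeta_cont s" by (rule zeta_cont_sums) (use s assms in auto)
    then have sm: "(\<lambda>n. ?f (Suc n)) sums zeta_cont s" by (simp add: powr_minus_divide)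
    have "summable (\<lambda>n. norm (?f n))" unfolding nf using s assms by (subst summable_real_powr_iff) auto
    then have "summable (\<lambda>n. norm (?f (Suc n)))" by (subst summable_Suc_iff)
    then have "((\<lambda>n. ?f (Suc n)) has_sum zeta_cont s) UNIV" using sm by (rule norm_summable_imp_has_sum)
    then have "((?f \<circ> Suc) has_sum zeta_cont s) UNIV" by (simp add: o_def)
    then have "(?f has_sum zeta_cont s) (Suc ` UNIV)" by (subst has_sum_reindex) auto
    also have "Suc ` UNIV = {1..}" by (metis atLeast_Suc_greaterThan greaterThan_0 One_nat_def)
    finally have hs: "(?f has_sum zeta_cont s) {1..}" .
    define A where "A = {n. n \<ge> (1::nat) \<and> (\<forall>p\<in>P. \<not> p dvd n)}"
    define V where "V = zeta_cont s * (\<Prod>p\<in>P. 1 - of_nat p powr (- s))"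
    have V: "(?f has_sum V) A" unfolding A_def V_def by (rule has_sum_sieve[OF P hs])
    have "1 \<notin> P" using P(2) not_prime_1 by metis
    then have 1: "1 \<in> A" by (auto simp: A_def)
    have V1: "(?f has_sum (V - 1)) (A - {1})"
    proof (rule has_sum_Diff[OF V])
      show "(?f has_sum 1) {1}" using has_sum_finite[of "{1}" ?f] by simp
    qed (use 1 in auto)
    have gt: "n \<ge> N" if n: "n \<in> A - {1}" for n
    proof (rule ccontr)
      assume "\<not> n \<ge> N"
      moreover obtain p where "prime p" "p dvd n" using n prime_factor_nat[of n] by auto
      moreover have "p \<le> n" using \<open>p dvd n\<close> n by (intro dvd_imp_le) (auto simp: A_def)
      ultimately have "p \<in> P" by (auto simp: P_def)
      then show False using n \<open>p dvd n\<close> by (auto simp: A_def)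
    qed
    \<comment> \<open>The tail estimate concerns finite intervals of integers, so the infinite sum
      is reached through finite approximations.\<close>
    have "norm (V - 1) \<le> 1/2"
    proof (rule field_le_epsilon)
      fix e :: real assume "e > 0"
      then obtain F where F: "finite F" "F \<subseteq> A - {1}" "dist (sum ?f F) (V - 1) \<le> e"
        using has_sum_finite_approximation[OF V1] by blast
      have "norm (sum ?f F) \<le> (\<Sum>n\<in>F. real n powr (- \<sigma>0))"
      proof (rule sum_norm_le)
        fix n assume "n \<in> F"
        then have "real n \<ge> 1" using F by (auto simp: A_def)
        then show "norm (?f n) \<le> real n powr (- \<sigma>0)" unfolding nf using s by (intro powr_mono) auto
      qed
      also have "\<dots> \<le> (\<Sum>n\<in>{N..<Suc (Max (insert 0 F))}. real n powr (- \<sigma>0))"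
      proof (rule sum_mono2)
        show "F \<subseteq> {N..<Suc (Max (insert 0 F))}"
          using F gt by (fastforce simp: less_Suc_eq_le intro!: Max_ge)
      qed auto
      also have "\<dots> < 1/2" by (rule N)
      finally have "norm (sum ?f F) < 1/2" .
      moreover have "norm (V - 1) \<le> norm (sum ?f F) + dist (sum ?f F) (V - 1)"
        by (metis dist_commute dist_norm add.commute norm_triangle_sub)
      ultimately show "norm (V - 1) \<le> 1/2 + e" using F by linarith
    qed
    then have "norm V \<ge> 1/2" using norm_triangle_ineq2[of 1 "1 - V"] by (simp add: norm_minus_commute)
    also have "norm V \<le> norm (zeta_cont s) * 2 ^ card P"
    proof -
      have "norm (\<Prod>p\<in>P. 1 - of_nat p powr (- s)) \<le> (\<Prod>p\<in>P. 2)"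
        unfolding prod_norm[symmetric]
      proof (intro prod_mono conjI)
        fix p assume "p \<in> P"
        then have "real p \<ge> 1" using P(2) prime_ge_1_nat by force
        then have "real p powr (- Re s) \<le> real p powr 0" using s assms by (intro powr_mono) auto
        then have "norm (?f p) \<le> 1" using \<open>real p \<ge> 1\<close> unfolding nf by simp
        then show "norm (1 - ?f p) \<le> 2" using norm_triangle_ineq4[of 1 "?f p"] by simp
      qed simp
      then show ?thesis unfolding V_def norm_mult by (intro mult_left_mono) auto
    qed
    finally show "1 / (2 * 2 ^ card P) \<le> norm (zeta_cont s)" by (simp add: field_simps)
  qed simp
qed

subsection \<open>Basic properties of zeta\<close>

definition chi :: "complex \<Rightarrow> complex" where
  "chi s = 2 * of_real (2 * pi) powr (s - 1) * sin (of_real pi * s / 2) * Gamma (1 - s)"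

lemma chi_holomorphic: "chi holomorphic_on {s. Re s < 1}"
proof -
  have "1 - s \<notin> \<int>\<^sub>\<le>\<^sub>0" if "Re s < 1" for s
    using that by (auto elim!: nonpos_Ints_cases simp: complex_eq_iff)
  then show ?thesis unfolding chi_def
    by (auto intro!: holomorphic_intros)
qed

text \<open>The case k = 0 is included: at s = 0 the zero of \<open>chi\<close> meets the pole of
  zeta at 1 - s = 1. Later uses rule this point out separately.\<close>

lemma chi_eq_0_iff:
  assumes "Re s < 1"
  shows "chi s = 0 \<longleftrightarrow> (\<exists>k::nat. s = - of_nat (2 * k))"
proof -
  have "1 - s \<notin> \<int>\<^sub>\<le>\<^sub>0" using assms by (auto elim!: nonpos_Ints_cases simp: complex_eq_iff)
  then have "chi s = 0 \<longleftrightarrow> sin (of_real pi * s / 2) = 0"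
    by (auto simp: chi_def Gamma_eq_zero_iff)
  also have "\<dots> \<longleftrightarrow> (\<exists>n::int. s = of_int (2 * n))"
  proof -
    have "of_real pi * s / 2 = of_real (real_of_int n * pi) \<longleftrightarrow> s = of_int (2 * n)" for n
    proof -
      have "of_real pi * s / 2 = of_real (real_of_int n * pi) \<longleftrightarrow> of_real pi * s = of_real pi * of_int (2 * n)"
        by (simp add: divide_eq_eq mult_ac)
      then show ?thesis by simp
    qed
    then show ?thesis unfolding sin_eq_0 by (simp only:)
  qed
  also have "\<dots> \<longleftrightarrow> (\<exists>k::nat. s = - of_nat (2 * k))"
  proof
    assume "\<exists>n::int. s = of_int (2 * n)"
    then obtain n :: int where n: "s = of_int (2 * n)" by blast
    have "real_of_int (2 * n) < 1" using assms n by simp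
    then have "n \<le> 0" by linarith
    then have "s = - of_nat (2 * nat (- n))" using n by simp
    then show "\<exists>k::nat. s = - of_nat (2 * k)" by blast
  next
    assume "\<exists>k::nat. s = - of_nat (2 * k)"
    then obtain k :: nat where "s = - of_nat (2 * k)" by blast
    then have "s = of_int (2 * (- int k))" by simp
    then show "\<exists>n::int. s = of_int (2 * n)" by blast
  qed
  finally show ?thesis .
qed

text \<open>Identity theorem: both sides agree on the real segment (-1, 0), which accumulates at
  -1/2.\<close>

lemma zeta_cont_functional_equation_strip:
  assumes "-1 < Re s" "Re s < 0"
  shows "zeta_cont s = chi s * zeta_cont (1 - s)"
proof -
  define S where "S = {s. -1 < Re s \<and> Re s < 0}"
  define U where "U = complex_of_real ` {-1<..<0}"
  have S: "S = {s. -1 < Re s} \<inter> {s. Re s < 0}" by (auto simp: S_def)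
  have "zeta_cont s - chi s * zeta_cont (1 - s) = 0"
  proof (rule analytic_continuation[where f = "\<lambda>s. zeta_cont s - chi s * zeta_cont (1 - s)" and S = S and U = U and \<xi> = "-1/2"])
    have "(zeta_cont \<circ> (\<lambda>s. 1 - s)) holomorphic_on S"
      by (rule holomorphic_on_compose_gen[OF _ zeta_cont_holomorphic]) (auto simp: S_def intro!: holomorphic_intros)
    then show "(\<lambda>s. zeta_cont s - chi s * zeta_cont (1 - s)) holomorphic_on S"
      by (auto simp: o_def S_def intro!: holomorphic_intros holomorphic_on_subset[OF zeta_cont_holomorphic] holomorphic_on_subset[OF chi_holomorphic])
    show "open S" unfolding S by (intro open_Int open_halfspace_Re_gt open_halfspace_Re_lt)
    show "connected S" unfolding S
      by (intro convex_connected convex_Int convex_halfspace_Re_gt convex_halfspace_Re_lt)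
    show "U \<subseteq> S" by (auto simp: U_def S_def)
    show "-1/2 \<in> S" by (simp add: S_def)
    show "(-1/2 :: complex) islimpt U"
      unfolding islimpt_approachable
    proof (intro allI impI)
      fix e :: real assume e: "e > 0"
      define d where "d = min (e / 2) (1/4)"
      have d: "0 < d" "d < e" "d \<le> 1/4" using e by (auto simp: d_def)
      have "of_real (-1/2 + d) \<in> U" unfolding U_def using d by (intro imageI) auto
      moreover have "complex_of_real (-1/2 + d) - (-1/2) = of_real d" by simp
      then have "dist (complex_of_real (-1/2 + d)) (-1/2) = d" unfolding dist_norm using d by (simp only: norm_of_real abs_of_pos)
      moreover have "complex_of_real (-1/2 + d) \<noteq> -1/2" using d by (simp add: complex_eq_iff)
      ultimately show "\<exists>x'\<in>U. x' \<noteq> - 1 / 2 \<and> dist x' (- 1 / 2) < e" using d by (metis)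
    qed
    fix z assume "z \<in> U"
    then obtain \<sigma> where z: "z = of_real \<sigma>" "-1 < \<sigma>" "\<sigma> < 0" by (auto simp: U_def)
    have "chi z = of_real (2 * (2 * pi) powr (\<sigma> - 1) * sin (pi * \<sigma> / 2) * Gamma (1 - \<sigma>))"
    proof -
      have "complex_of_real (2 * pi) powr (z - 1) = of_real ((2 * pi) powr (\<sigma> - 1))"
        unfolding z by (subst powr_of_real[symmetric]) auto
      moreover have "sin (of_real pi * z / 2) = complex_of_real (sin (pi * \<sigma> / 2))"
        unfolding z by (simp flip: sin_of_real)
      moreover have "Gamma (1 - z) = complex_of_real (Gamma (1 - \<sigma>))"
        unfolding z by (simp flip: Gamma_complex_of_real)
      ultimately show ?thesis unfolding chi_def by simp
    qed
    then show "zeta_cont z - chi z * zeta_cont (1 - z) = 0"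
      using zeta_cont_functional_equation_real[OF z(2,3)] z by simp
  qed (use assms in \<open>auto simp: S_def\<close>)
  then show ?thesis by simp
qed

text \<open>The witness for the definite description of \<open>zeta\<close>. The two formulas agree
  on -1 < Re s < 0, so the gluing is holomorphic across Re s = -1.\<close>

definition zeta_full :: "complex \<Rightarrow> complex" where
  "zeta_full s = (if s = 1 then 0 else if Re s > -1 then zeta_cont s else chi s * zeta_cont (1 - s))"

lemma zeta_full_props:
  "zeta_full holomorphic_on - {1}"
  "\<And>s. Re s > 1 \<Longrightarrow> (\<lambda>n. 1 / of_nat (Suc n) powr s) sums zeta_full s"
  "zeta_full 1 = 0"
proof -
  have 1: "zeta_full holomorphic_on {s. Re s > -1} - {1}"
    by (rule holomorphic_transform[OF zeta_cont_holomorphic]) (auto simp: zeta_full_def)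
  have "(zeta_cont \<circ> (\<lambda>s. 1 - s)) holomorphic_on {s. Re s < 0}"
    by (rule holomorphic_on_compose_gen[OF _ zeta_cont_holomorphic]) (auto intro!: holomorphic_intros)
  then have "(\<lambda>s. chi s * zeta_cont (1 - s)) holomorphic_on {s. Re s < 0}"
    by (auto simp: o_def intro!: holomorphic_intros holomorphic_on_subset[OF chi_holomorphic])
  then have 2: "zeta_full holomorphic_on {s. Re s < 0}"
  proof (rule holomorphic_transform)
    show "chi s * zeta_cont (1 - s) = zeta_full s" if "s \<in> {s. Re s < 0}" for s
      using that zeta_cont_functional_equation_strip[of s] by (cases "Re s > -1") (auto simp: zeta_full_def)
  qed
  have "zeta_full holomorphic_on ({s. Re s > -1} - {1}) \<union> {s. Re s < 0}"
    by (rule holomorphic_on_Un[OF 1 2]) (auto intro!: open_halfspace_Re_gt open_halfspace_Re_lt open_delete)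
  also have "({s. Re s > -1} - {1}) \<union> {s. Re s < 0} = - {1::complex}"
    by (auto simp: complex_eq_iff)
  finally show "zeta_full holomorphic_on - {1}" .
  show "(\<lambda>n. 1 / of_nat (Suc n) powr s) sums zeta_full s" if "Re s > 1" for s
    using zeta_cont_sums[OF that] that by (auto simp: zeta_full_def)
qed (simp add: zeta_full_def)

lemma connected_complement_singleton_complex: "connected (- {1::complex})"
  by (rule connected_punctured_universe) simp

lemma zeta_unique:
  assumes "f holomorphic_on - {1}" "\<And>s. Re s > 1 \<Longrightarrow> (\<lambda>n. 1 / of_nat (Suc n) powr s) sums f s" "f 1 = 0"
  shows "f = zeta_full"
proof
  fix s
  show "f s = zeta_full s"
  proof (cases "s = 1")
    case False
    show ?thesis
    proof (rule analytic_continuation_open[of "{s. Re s > 1}" "- {1}" f zeta_full])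
      show "{s. 1 < Re s} \<noteq> {}" by (auto intro!: exI[of _ 2])
      show "f z = zeta_full z" if "z \<in> {s. 1 < Re s}" for z
        using assms(2)[of z] zeta_full_props(2)[of z] that sums_unique2 by blast
    qed (use assms False zeta_full_props connected_complement_singleton_complex in \<open>auto simp: open_halfspace_Re_gt\<close>)
  qed (simp add: assms zeta_full_props)
qed

lemma zeta_eq_full: "zeta = zeta_full"
  unfolding zeta_def
proof (rule the_equality)
  show "zeta_full holomorphic_on - {1} \<and> (\<forall>s. 1 < Re s \<longrightarrow> (\<lambda>n. 1 / of_nat (Suc n) powr s) sums zeta_full s) \<and> zeta_full 1 = 0"
    using zeta_full_props by blast
qed (use zeta_unique in blast)

lemma zeta_holomorphic: "zeta holomorphic_on - {1}"
  unfolding zeta_eq_full by (rule zeta_full_props)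

lemma zeta_1 [simp]: "zeta 1 = 0"
  by (simp add: zeta_eq_full zeta_full_props)

lemma zeta_eq_cont: "Re s > -1 \<Longrightarrow> s \<noteq> 1 \<Longrightarrow> zeta s = zeta_cont s"
  by (simp add: zeta_eq_full zeta_full_def)

lemma zeta_0: "zeta 0 = -1/2"
  by (simp add: zeta_eq_cont zeta_cont_def)

text \<open>At s = 0 the formula would involve the junk value of \<open>zeta\<close> at 1 and give 0
  instead of -1/2. The punctured half plane is still connected, so the identity theorem
  applies.\<close>

lemma zeta_functional_equation:
  assumes "Re s < 1" "s \<noteq> 0"
  shows "zeta s = chi s * zeta (1 - s)"
proof (rule analytic_continuation_open[of "{s. Re s < 0}" "{s. Re s < 1} - {0}" zeta "\<lambda>s. chi s * zeta (1 - s)"])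
  show "open {s. Re s < 0}" "open ({s. Re s < 1} - {0::complex})"
    by (auto intro!: open_halfspace_Re_lt open_delete)
  show "connected ({s. Re s < 1} - {0::complex})"
    by (rule connected_open_delete) (auto intro!: open_halfspace_Re_lt convex_connected convex_halfspace_Re_lt)
  have "(zeta \<circ> (\<lambda>s. 1 - s)) holomorphic_on {s. Re s < 1} - {0}"
    by (rule holomorphic_on_compose_gen[OF _ zeta_holomorphic]) (auto intro!: holomorphic_intros)
  then show "(\<lambda>s. chi s * zeta (1 - s)) holomorphic_on {s. Re s < 1} - {0}"
    by (auto simp: o_def intro!: holomorphic_intros holomorphic_on_subset[OF chi_holomorphic])
  show "zeta holomorphic_on {s. Re s < 1} - {0}"
    by (rule holomorphic_on_subset[OF zeta_holomorphic]) auto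
  show "{s. Re s < 0} \<noteq> {}" by (auto intro!: exI[of _ "-1"])
  fix z :: complex assume "z \<in> {s. Re s < 0}"
  then have z: "Re z < 0" by simp
  have "zeta (1 - z) = zeta_cont (1 - z)" using z by (intro zeta_eq_cont) auto
  then show "zeta z = chi z * zeta (1 - z)"
    using z zeta_cont_functional_equation_strip[of z]
    by (cases "Re z > -1") (auto simp: zeta_eq_full zeta_full_def)
qed (use assms in auto)

text \<open>The conjugated function satisfies the description that characterises
  \<open>zeta\<close>.\<close>

lemma zeta_cnj: "zeta (cnj s) = cnj (zeta s)"
proof -
  define f where "f = cnj \<circ> zeta \<circ> cnj"
  have "f = zeta_full"
  proof (rule zeta_unique)
    show "f holomorphic_on - {1}"
      unfolding f_def
    proof (rule holomorphic_on_compose_cnj_cnj)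
      have "cnj ` (- {1}) = - {1}"
      proof (intro set_eqI iffI)
        fix x assume "x \<in> - {1::complex}"
        then have "cnj x \<in> - {1}" by (auto simp: complex_eq_iff)
        then show "x \<in> cnj ` (- {1})" by (intro image_eqI[of _ _ "cnj x"]) auto
      qed (auto simp: complex_eq_iff)
      then show "zeta holomorphic_on cnj ` (- {1})" using zeta_holomorphic by simp
    qed auto
    show "f 1 = 0" by (simp add: f_def)
    fix s :: complex assume "Re s > 1"
    then have "(\<lambda>n. cnj (1 / of_nat (Suc n) powr cnj s)) sums cnj (zeta (cnj s))"
      unfolding sums_cnj zeta_eq_full by (intro zeta_full_props) simp
    moreover have "cnj (1 / of_nat (Suc n) powr cnj s) = 1 / of_nat (Suc n) powr s" for n
      using cnj_powr[of "of_nat (Suc n)" "cnj s"] by (simp add: complex_nonpos_Reals_iff)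
    ultimately show "(\<lambda>n. 1 / of_nat (Suc n) powr s) sums f s" by (simp add: f_def)
  qed
  then have "f = zeta" by (simp add: zeta_eq_full)
  then have "cnj (zeta (cnj (cnj s))) = zeta (cnj s)" unfolding f_def by (metis o_apply)
  then show ?thesis by simp
qed

lemma norm_zeta_cnj: "norm (zeta (cnj s)) = norm (zeta s)"
  by (simp add: zeta_cnj)

lemma zeta_lower_bound:
  assumes "\<sigma>0 > (1::real)"
  obtains c where "c > 0" "\<And>s. Re s \<ge> \<sigma>0 \<Longrightarrow> norm (zeta s) \<ge> c"
proof -
  obtain c where c: "c > 0" "\<And>s. Re s \<ge> \<sigma>0 \<Longrightarrow> norm (zeta_cont s) \<ge> c"
    using zeta_cont_lower_bound[OF assms] by blast
  show ?thesis
    by (rule that[OF c(1)]) (subst zeta_eq_cont, use c assms in auto)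
qed

lemma zeta_nonzero_right: "Re s > 1 \<Longrightarrow> zeta s \<noteq> 0"
proof -
  assume "Re s > 1"
  then obtain c where "c > 0" "\<And>z. Re z \<ge> Re s \<Longrightarrow> norm (zeta z) \<ge> c"
    using zeta_lower_bound[of "Re s"] by blast
  then have "norm (zeta s) > 0" by (meson less_le_trans order_refl)
  then show ?thesis by simp
qed

text \<open>\<open>nontrivial_zeros\<close> excludes only the negative even integers, so the strip
  has to be derived: left of 0 the value zeta(1 - \<rho>) is nonzero, hence a zero must come from
  \<open>chi\<close> and be trivial.\<close>

lemma nontrivial_zero_strip:
  assumes "\<rho> \<in> nontrivial_zeros"
  shows "0 \<le> Re \<rho>" "Re \<rho> \<le> 1" "zeta \<rho> = 0" "\<rho> \<noteq> 1" "\<rho> \<noteq> 0"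
proof -
  show z: "zeta \<rho> = 0" "\<rho> \<noteq> 1" using assms by (auto simp: nontrivial_zeros_def)
  show "\<rho> \<noteq> 0" using z zeta_0 by auto
  show "Re \<rho> \<le> 1" using zeta_nonzero_right[of \<rho>] z by force
  show "0 \<le> Re \<rho>"
  proof (rule ccontr)
    assume "\<not> 0 \<le> Re \<rho>"
    then have r: "Re \<rho> < 0" by simp
    have "chi \<rho> * zeta (1 - \<rho>) = 0" using zeta_functional_equation[of \<rho>] r z \<open>\<rho> \<noteq> 0\<close> by simp
    moreover have "zeta (1 - \<rho>) \<noteq> 0" using r by (intro zeta_nonzero_right) simp
    ultimately have "chi \<rho> = 0" by simp
    then obtain k :: nat where k: "\<rho> = - of_nat (2 * k)" using chi_eq_0_iff[of \<rho>] r by auto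
    with \<open>\<rho> \<noteq> 0\<close> have "k \<ge> 1" by (cases k) auto
    then show False using assms k unfolding nontrivial_zeros_def by blast
  qed
qed

lemma nontrivial_zerosI:
  assumes "Re s > -1" "s \<noteq> 1" "zeta s = 0"
  shows "s \<in> nontrivial_zeros"
  using assms by (auto simp: nontrivial_zeros_def)

lemma nontrivial_zero_reflect:
  assumes "\<rho> \<in> nontrivial_zeros" "Re \<rho> < 1"
  shows "1 - \<rho> \<in> nontrivial_zeros"
proof -
  note r = nontrivial_zero_strip[OF assms(1)]
  have "chi \<rho> \<noteq> 0"
  proof
    assume "chi \<rho> = 0"
    then obtain k :: nat where "\<rho> = - of_nat (2 * k)" using chi_eq_0_iff[of \<rho>] assms by auto
    then have "\<rho> = 0" using r(1) by auto
    then show False using r by simp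
  qed
  then have "zeta (1 - \<rho>) = 0" using zeta_functional_equation[of \<rho>] assms r by simp
  then show ?thesis using r assms by (intro nontrivial_zerosI) auto
qed

section \<open>Growth of zeta, its reciprocal, and finiteness of the zeros below a height\<close>

text \<open>The bound -19/20 is how far the disc of radius 49/20 about a point with real part 3/2
  reaches in \<open>zeta_lower_bound_at_height\<close>; it makes the remainder at most 20.\<close>

lemma zeta_growth:
  assumes "Re s \<ge> -19/20" "\<bar>Im s\<bar> \<ge> 1"
  shows "norm (zeta s) \<le> 2 + 10 * (norm s + 1)\<^sup>2"
proof -
  have s1: "s \<noteq> 1" using assms by auto
  have "norm (s - 1) \<ge> 1" using abs_Im_le_cmod[of "s - 1"] assms by simp
  then have 1: "norm (1 / (s - 1)) \<le> 1" by (simp add: norm_divide divide_le_eq)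
  have "norm (zeta_rem s) \<le> 1 / (Re s + 1)" using assms by (intro norm_zeta_rem) auto
  also have "\<dots> \<le> 1 / (1/20)" using assms by (intro divide_left_mono) auto
  finally have 2: "norm (zeta_rem s) \<le> 20" by simp
  have "norm (s * (s + 1) / 2 * zeta_rem s) = norm s * norm (s + 1) / 2 * norm (zeta_rem s)"
    by (simp add: norm_mult norm_divide)
  also have "\<dots> \<le> (norm s + 1) * (norm s + 1) / 2 * 20"
    using 2 norm_triangle_ineq[of s 1] by (intro mult_mono divide_right_mono) auto
  finally have 3: "norm (s * (s + 1) / 2 * zeta_rem s) \<le> 10 * (norm s + 1)\<^sup>2" by (simp add: power2_eq_square)
  have "norm (zeta s) \<le> norm (1/2 + 1 / (s - 1)) + norm (s * (s + 1) / 2 * zeta_rem s)"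
  proof -
    have "zeta s = 1/2 + 1 / (s - 1) + s * (s + 1) / 2 * zeta_rem s"
      using assms s1 by (subst zeta_eq_cont) (auto simp: zeta_cont_def)
    then show ?thesis by (simp only: norm_triangle_ineq)
  qed
  also have "norm (1/2 + 1 / (s - 1)) \<le> 1/2 + 1"
    using norm_triangle_ineq[of "1/2" "1 / (s - 1)"] 1 by simp
  finally show ?thesis using 3 by simp
qed

text \<open>(s - 1) zeta(s) with its removable point filled in: the value at 1 is 1, the residue of
  zeta.\<close>

definition zeta_numerator :: "complex \<Rightarrow> complex" where
  "zeta_numerator s = (s - 1) / 2 + 1 + (s - 1) * (s * (s + 1) / 2 * zeta_rem s)"

lemma zeta_numerator: "Re s > -1 \<Longrightarrow> s \<noteq> 1 \<Longrightarrow> zeta_numerator s = (s - 1) * zeta s"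
  by (simp add: zeta_eq_cont zeta_cont_def zeta_numerator_def field_simps)

lemma zeta_numerator_holomorphic: "zeta_numerator holomorphic_on {s. Re s > -1}"
  unfolding zeta_numerator_def[abs_def] by (intro holomorphic_intros zeta_rem_holomorphic) auto

text \<open>At the pole the conventions \<open>zeta 1 = 0\<close> and 1 / 0 = 0 happen to give the
  true limit 0 of the reciprocal, so 1 need not be removed from the domain.\<close>

lemma inverse_zeta_holomorphic: "(\<lambda>s. 1 / zeta s) holomorphic_on {s. Re s > -1} - nontrivial_zeros"
proof -
  have "(\<lambda>s. (s - 1) / zeta_numerator s) holomorphic_on {s. Re s > -1} - nontrivial_zeros"
  proof (intro holomorphic_intros)
    show "zeta_numerator holomorphic_on {s. Re s > -1} - nontrivial_zeros"
      by (rule holomorphic_on_subset[OF zeta_numerator_holomorphic]) auto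
    show "zeta_numerator s \<noteq> 0" if "s \<in> {s. Re s > -1} - nontrivial_zeros" for s
    proof (cases "s = 1")
      case True
      then show ?thesis by (simp add: zeta_numerator_def)
    next
      case False
      then show ?thesis using that zeta_numerator[of s] nontrivial_zerosI[of s] by auto
    qed
  qed
  then show ?thesis
  proof (rule holomorphic_transform)
    fix s assume s: "s \<in> {s. Re s > -1} - nontrivial_zeros"
    show "(s - 1) / zeta_numerator s = 1 / zeta s"
    proof (cases "s = 1")
      case False
      then show ?thesis using s zeta_numerator[of s] by simp
    qed simp
  qed
qed

lemma finite_nontrivial_zeros: "finite {\<rho> \<in> nontrivial_zeros. \<bar>Im \<rho>\<bar> \<le> R}"
proof -
  define K where "K = cbox (Complex 0 (-R)) (Complex 1 R)"
  have "finite {s \<in> K. zeta_numerator s = 0}"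
  proof (rule holomorphic_compact_finite_zeros[of zeta_numerator "{s. Re s > -1}"])
    show "zeta_numerator holomorphic_on {s. Re s > -1}"
      by (rule zeta_numerator_holomorphic)
    show "connected {s. Re s > -1}" by (intro convex_connected convex_halfspace_Re_gt)
    show "\<not> zeta_numerator constant_on {s. Re s > -1}"
    proof
      assume "zeta_numerator constant_on {s. Re s > -1}"
      then have "zeta_numerator 0 = zeta_numerator 1" unfolding constant_on_def by auto
      then show False using zeta_numerator[of 0] by (simp add: zeta_0 zeta_numerator_def)
    qed
  qed (auto simp: K_def in_cbox_complex_iff open_halfspace_Re_gt)
  moreover have "{\<rho> \<in> nontrivial_zeros. \<bar>Im \<rho>\<bar> \<le> R} \<subseteq> {s \<in> K. zeta_numerator s = 0}"
  proof
    fix \<rho> assume "\<rho> \<in> {\<rho> \<in> nontrivial_zeros. \<bar>Im \<rho>\<bar> \<le> R}"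
    then have r: "\<rho> \<in> nontrivial_zeros" "\<bar>Im \<rho>\<bar> \<le> R" by auto
    note s = nontrivial_zero_strip[OF r(1)]
    show "\<rho> \<in> {s \<in> K. zeta_numerator s = 0}"
      using r(2) s zeta_numerator[of \<rho>] by (auto simp: K_def in_cbox_complex_iff)
  qed
  ultimately show ?thesis by (rule finite_subset[rotated])
qed

lemma deriv_nonzero_at_simple_zero:
  assumes "f holomorphic_on S" "open S" "connected S" "z \<in> S" "f z = 0" "w \<in> S" "f w \<noteq> 0" "zorder f z = 1"
  shows "deriv f z \<noteq> 0"
proof -
  obtain r where r: "r > 0" "cball z r \<subseteq> S" "zor_poly f z holomorphic_on cball z r"
     "\<forall>w\<in>cball z r. f w = zor_poly f z w * (w - z) ^ nat (zorder f z) \<and> zor_poly f z w \<noteq> 0"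
    using zorder_exist_zero[OF assms(1-4)] assms by blast
  have "zor_poly f z field_differentiable at z"
    using r by (meson analytic_on_imp_differentiable_at at_within_interior ball_subset_cball centre_in_ball holomorphic_on_def holomorphic_on_imp_differentiable_at holomorphic_on_subset open_ball)
  then obtain d where "(zor_poly f z has_field_derivative d) (at z)" by (auto simp: field_differentiable_def)
  then have "((\<lambda>w. zor_poly f z w * (w - z)) has_field_derivative zor_poly f z z) (at z)"
    by (auto intro!: derivative_eq_intros)
  then have "(f has_field_derivative zor_poly f z z) (at z)"
    by (rule has_field_derivative_transform_within_open[where S = "ball z r"]) (use r assms(8) in auto)
  then show ?thesis using r by (simp add: DERIV_imp_deriv)
qed

subsection \<open>The Mellin kernel\<close>

definition Fz :: "complex \<Rightarrow> complex" where
  "Fz s = Gamma (1 - s / 2) / zeta s"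

lemma Fz_holomorphic: "Fz holomorphic_on {s. -1 < Re s \<and> Re s < 2} - nontrivial_zeros"
proof -
  have "1 - s / 2 \<notin> \<int>\<^sub>\<le>\<^sub>0" if "Re s < 2" for s
    using that by (auto elim!: nonpos_Ints_cases simp: complex_eq_iff)
  then have "(\<lambda>s. Gamma (1 - s / 2) * (1 / zeta s)) holomorphic_on {s. -1 < Re s \<and> Re s < 2} - nontrivial_zeros"
    by (intro holomorphic_intros holomorphic_on_subset[OF inverse_zeta_holomorphic]) auto
  then show ?thesis by (simp add: Fz_def[abs_def])
qed

text \<open>Re s <= 7/4 keeps the real part of 1 - s/2 at least 1/8, away from the pole of Gamma;
  halving Im s turns the rate 3/2 into 3/4.\<close>

lemma Fz_bound_right:
  obtains C where "C > 0" "\<And>s. -2 \<le> Re s \<Longrightarrow> Re s \<le> 7/4 \<Longrightarrow> norm (Fz s) \<le> C * exp (- (3/4) * \<bar>Im s\<bar>) / norm (zeta s)"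
proof -
  obtain C where C: "C > 0" "\<And>z. 1/8 \<le> Re z \<Longrightarrow> Re z \<le> 2 \<Longrightarrow> norm (Gamma z) \<le> C * exp (- (3/2) * \<bar>Im z\<bar>)"
    using Gamma_exp_decay[of "1/8"] by auto
  show ?thesis
  proof (rule that[OF C(1)])
    fix s assume s: "-2 \<le> Re s" "Re s \<le> 7/4"
    have "norm (Gamma (1 - s / 2)) \<le> C * exp (- (3/2) * \<bar>Im (1 - s / 2)\<bar>)"
      by (rule C) (use s in auto)
    also have "- (3/2) * \<bar>Im (1 - s / 2)\<bar> = - (3/4) * \<bar>Im s\<bar>" by simp
    finally show "norm (Fz s) \<le> C * exp (- (3/4) * \<bar>Im s\<bar>) / norm (zeta s)"
      by (simp add: Fz_def norm_divide divide_right_mono)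
  qed
qed

text \<open>Away from the real axis the cotangent is bounded: with v = |Im w| >= 1, exp(v) >= 3
  exp(-v) yields the factor 2.\<close>

lemma norm_cot_le:
  assumes "\<bar>Im w\<bar> \<ge> 1"
  shows "norm (cos w) \<le> 2 * norm (sin w)"
proof -
  define v where "v = \<bar>Im w\<bar>"
  have e: "exp v \<ge> 3 * exp (- v)"
  proof -
    have "3 \<le> 1 + 2 * v" using assms by (simp add: v_def)
    also have "\<dots> \<le> exp (2 * v)" by (rule exp_ge_add_one_self)
    finally have "3 * exp (- v) \<le> exp (2 * v) * exp (- v)" by (intro mult_right_mono) auto
    also have "\<dots> = exp v" by (simp flip: exp_add)
    finally show ?thesis .
  qed
  have n: "{norm (exp (\<i> * w)), norm (exp (- (\<i> * w)))} = {exp v, exp (- v)}"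
    by (auto simp: v_def abs_if)
  have c: "norm (cos w) \<le> (exp v + exp (- v)) / 2"
  proof -
    have "norm (cos w) = norm (exp (\<i> * w) + exp (- (\<i> * w))) / 2"
      by (simp add: cos_exp_eq norm_divide)
    also have "\<dots> \<le> (norm (exp (\<i> * w)) + norm (exp (- (\<i> * w)))) / 2"
      by (intro divide_right_mono norm_triangle_ineq) simp
    also have "\<dots> = (exp v + exp (- v)) / 2" using n by (auto simp: doubleton_eq_iff)
    finally show ?thesis .
  qed
  have s: "norm (sin w) \<ge> (exp v - exp (- v)) / 2"
  proof -
    have "exp v - exp (- v) = \<bar>norm (exp (\<i> * w)) - norm (exp (- (\<i> * w)))\<bar>"
      using n by (auto simp: doubleton_eq_iff abs_if v_def)
    also have "\<dots> \<le> norm (exp (\<i> * w) - exp (- (\<i> * w)))" by (rule norm_triangle_ineq3)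
    finally show ?thesis by (simp add: sin_exp_eq norm_divide norm_mult)
  qed
  show ?thesis using e c s by argo
qed

text \<open>The functional equation alone would leave a quotient of two Gamma values. Duplication
  and reflection condense it into one decaying factor and a cotangent, and zeta moves to 1 - s,
  where a lower bound is available.\<close>

lemma Fz_reflect:
  assumes "-1 < Re s" "Re s < 1" "s \<noteq> 0"
  shows "Fz s = of_real (sqrt pi) * of_real pi powr (- s) * Gamma ((1 + s) / 2) * cos (of_real pi * s / 2) / (sin (of_real pi * s / 2) * zeta (1 - s))"
proof (cases "zeta (1 - s) = 0")
  \<comment> \<open>Both sides are 0 here by the convention for division by zero.\<close>
  case True
  then show ?thesis using zeta_functional_equation[of s] assms by (simp add: Fz_def)
next
  case False
  define g where "g = Gamma ((1 - s) / 2)"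
  have np: "1 - s / 2 \<notin> \<int>\<^sub>\<le>\<^sub>0" "(1 - s) / 2 \<notin> \<int>\<^sub>\<le>\<^sub>0" "(1 + s) / 2 \<notin> \<int>\<^sub>\<le>\<^sub>0" "1 - s \<notin> \<int>\<^sub>\<le>\<^sub>0"
    using assms by (auto elim!: nonpos_Ints_cases simp: complex_eq_iff)
  have gnz: "g \<noteq> 0" "Gamma (1 - s) \<noteq> 0" using np by (auto simp: g_def Gamma_eq_zero_iff)
  have "chi s \<noteq> 0"
  proof
    assume "chi s = 0"
    then obtain k :: nat where "s = - of_nat (2 * k)" using chi_eq_0_iff[of s] assms by auto
    then show False using assms by (cases k) auto
  qed
  then have snz: "sin (of_real pi * s / 2) \<noteq> 0" by (auto simp: chi_def)
  have e: "(1 - s) / 2 + 1/2 = 1 - s / 2" "1 - 2 * ((1 - s) / 2) = s" "2 * ((1 - s) / 2) = 1 - s"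
    by (simp_all add: field_simps)
  have "(1 - s) / 2 + 1/2 \<notin> \<int>\<^sub>\<le>\<^sub>0" unfolding e by (rule np)
  from Gamma_legendre_duplication[OF np(2) this]
  have dup: "g * Gamma (1 - s / 2) = exp (s * of_real (ln 2)) * of_real (sqrt pi) * Gamma (1 - s)"
    unfolding e g_def by simp
  have e': "1 - (1 - s) / 2 = (1 + s) / 2" by (simp add: field_simps)
  have "g * Gamma ((1 + s) / 2) = of_real pi / sin (of_real pi * ((1 - s) / 2))"
    using Gamma_reflection_complex[of "(1 - s) / 2"] unfolding e' g_def .
  also have "sin (of_real pi * ((1 - s) / 2)) = cos (of_real pi * s / 2)"
    by (simp add: cos_sin_eq field_simps)
  finally have ref: "g * Gamma ((1 + s) / 2) = of_real pi / cos (of_real pi * s / 2)" .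
  have "Gamma ((1 + s) / 2) \<noteq> 0" using np by (auto simp: Gamma_eq_zero_iff)
  then have cnz: "cos (of_real pi * s / 2) \<noteq> 0" using ref gnz by auto
  have p: "complex_of_real (2 * pi) powr (s - 1) = exp (s * of_real (ln 2)) * of_real pi powr s / (2 * of_real pi)"
  proof -
    have "complex_of_real (2 * pi) powr (s - 1) = exp (s * of_real (ln (2 * pi))) / of_real (2 * pi)"
    proof -
      have l: "Ln (complex_of_real (2 * pi)) = of_real (ln (2 * pi))" by (rule Ln_of_real) simp
      have "exp (complex_of_real (ln (2 * pi))) = of_real (2 * pi)"
        unfolding exp_of_real by (subst exp_ln) simp_all
      then show ?thesis by (simp add: powr_def l left_diff_distrib exp_diff del: of_real_mult)
    qed
    also have "ln (2 * pi) = ln 2 + ln pi" by (simp add: ln_mult)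
    also have "exp (s * of_real (ln 2 + ln pi)) = exp (s * of_real (ln 2)) * of_real pi powr s"
      by (simp add: powr_def Ln_of_real algebra_simps exp_add)
    finally show ?thesis by simp
  qed
  have "Fz s = Gamma (1 - s / 2) / (chi s * zeta (1 - s))"
    using zeta_functional_equation[of s] assms by (simp add: Fz_def)
  also have "Gamma (1 - s / 2) = exp (s * of_real (ln 2)) * of_real (sqrt pi) * Gamma (1 - s) / g"
    using dup gnz by (simp add: field_simps)
  also have "\<dots> / (chi s * zeta (1 - s)) = of_real (sqrt pi) * (of_real pi / g) / (of_real pi powr s * sin (of_real pi * s / 2) * zeta (1 - s))"
    unfolding chi_def p using gnz snz False by (simp add: divide_simps)
  also have "of_real pi / g = Gamma ((1 + s) / 2) * cos (of_real pi * s / 2)"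
    using ref gnz cnz by (simp add: field_simps)
  finally show ?thesis by (simp add: powr_minus field_simps)
qed

lemma Fz_bound_left:
  obtains C where "C > 0" "\<And>s. -1/2 \<le> Re s \<Longrightarrow> Re s \<le> 1/2 \<Longrightarrow> \<bar>Im s\<bar> \<ge> 1 \<Longrightarrow>
    norm (Fz s) \<le> C * exp (- (3/4) * \<bar>Im s\<bar>) / norm (zeta (1 - s))"
proof -
  obtain C where C: "C > 0" "\<And>z. 1/4 \<le> Re z \<Longrightarrow> Re z \<le> 2 \<Longrightarrow> norm (Gamma z) \<le> C * exp (- (3/2) * \<bar>Im z\<bar>)"
    using Gamma_exp_decay[of "1/4"] by auto
  define D where "D = sqrt pi * pi powr (1/2) * C * 2"
  show ?thesis
  proof (rule that[of D])
    show "D > 0" using C by (simp add: D_def)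
    fix s assume s: "-1/2 \<le> Re s" "Re s \<le> 1/2" "\<bar>Im s\<bar> \<ge> 1"
    have "norm (Gamma ((1 + s) / 2)) \<le> C * exp (- (3/2) * \<bar>Im ((1 + s) / 2)\<bar>)"
      by (rule C) (use s in auto)
    also have "- (3/2) * \<bar>Im ((1 + s) / 2)\<bar> = - (3/4) * \<bar>Im s\<bar>" by simp
    finally have G: "norm (Gamma ((1 + s) / 2)) \<le> C * exp (- (3/4) * \<bar>Im s\<bar>)" .
    have P: "norm (complex_of_real pi powr (- s)) \<le> pi powr (1/2)"
    proof -
      have "norm (complex_of_real pi powr (- s)) = pi powr (- Re s)" by (subst norm_powr_real_powr) auto
      also have "\<dots> \<le> pi powr (1/2)" using s pi_gt3 by (intro powr_mono) auto
      finally show ?thesis .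
    qed
    have "\<bar>Im (of_real pi * s / 2)\<bar> = pi / 2 * \<bar>Im s\<bar>" by (simp add: abs_mult)
    also have "\<dots> \<ge> 1 * 1" using s pi_gt3 by (intro mult_mono) auto
    finally have cot: "norm (cos (of_real pi * s / 2)) \<le> 2 * norm (sin (of_real pi * s / 2))"
      by (intro norm_cot_le) simp
    have sp: "norm (cos (of_real pi * s / 2)) / norm (sin (of_real pi * s / 2)) \<le> 2"
      using cot by (cases "sin (of_real pi * s / 2) = 0") (auto simp: divide_le_eq)
    have "norm (Fz s) = sqrt pi * norm (complex_of_real pi powr (- s)) * norm (Gamma ((1 + s) / 2)) * (norm (cos (of_real pi * s / 2)) / norm (sin (of_real pi * s / 2))) / norm (zeta (1 - s))"
      using s by (subst Fz_reflect) (auto simp: norm_mult norm_divide)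
    also have "\<dots> \<le> sqrt pi * pi powr (1/2) * (C * exp (- (3/4) * \<bar>Im s\<bar>)) * 2 / norm (zeta (1 - s))"
      using P G sp C by (intro divide_right_mono mult_mono) auto
    finally show "norm (Fz s) \<le> D * exp (- (3/4) * \<bar>Im s\<bar>) / norm (zeta (1 - s))" by (simp add: D_def mult_ac)
  qed
qed

subsection \<open>Heights avoiding the zeros\<close>

lemma deriv_zeta_nonzero:
  assumes "\<forall>\<rho>\<in>nontrivial_zeros. zorder zeta \<rho> = 1" "\<rho> \<in> nontrivial_zeros"
  shows "deriv zeta \<rho> \<noteq> 0"
proof (rule deriv_nonzero_at_simple_zero[OF zeta_holomorphic])
  show "zeta 0 \<noteq> 0" "0 \<in> - {1::complex}" by (auto simp: zeta_0)
qed (use assms nontrivial_zero_strip[OF assms(2)] connected_complement_singleton_complex in auto)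

text \<open>\<open>simple_zeros_min_modulus\<close> about 3/2 + i n with R = 49/20, r = 6/5, r1 =
  11/10: then 2r < R, (R - r) / r = 25/24 and 2 r1 / (r - r1) = 22. The disc of radius r1 contains
  the box 1/2 <= Re s <= 3/2, n <= Im s <= n + 1/4, as 1 + 1/16 < 1.21. \<open>L\<close> bounds the
  number of zeros, and t avoids their heights.\<close>

lemma zeta_lower_bound_at_height:
  assumes simple: "\<forall>\<rho>\<in>nontrivial_zeros. zorder zeta \<rho> = 1"
    and c0: "c0 > 0" "\<And>s. Re s \<ge> 5/4 \<Longrightarrow> norm (zeta s) \<ge> c0"
    and n: "n \<ge> (10::real)"
  defines "B \<equiv> 2 + 10 * (n + 6)\<^sup>2"
  defines "L \<equiv> ln (B / c0) / ln (25 / 24)"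
  shows "\<exists>t\<in>{n..n + 1/4}. \<forall>s. Im s = t \<longrightarrow> 1/2 \<le> Re s \<longrightarrow> Re s \<le> 3/2 \<longrightarrow>
    norm (zeta s) \<ge> exp (- (L * ln (10 * (L + 1)))) * (c0 * (2 * B / c0) powr (- 22))"
proof -
  define c where "c = Complex (3/2) n"
  define f where "f z = zeta (c + z)" for z
  define Z where "Z = {z\<in>cball 0 (6/5). f z = 0}"
  have nz1: "c + z \<noteq> 1" if "norm z < 5" for z
    using that abs_Im_le_cmod[of z] n by (auto simp: c_def complex_eq_iff)
  have hol: "f holomorphic_on ball 0 5"
  proof -
    have "zeta \<circ> (\<lambda>z. c + z) holomorphic_on ball 0 5"
    proof (rule holomorphic_on_compose_gen[OF _ zeta_holomorphic])
      show "(\<lambda>z. c + z) ` ball 0 5 \<subseteq> - {1}" using nz1 by (force simp del: image_add_ball)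
    qed (auto intro!: holomorphic_intros)
    then show ?thesis by (simp add: f_def[abs_def] o_def)
  qed
  have le: "norm (f z) \<le> B" if "norm z \<le> 49/20" for z
  proof -
    have z: "\<bar>Re z\<bar> \<le> 49/20" "\<bar>Im z\<bar> \<le> 49/20"
      using that abs_Re_le_cmod[of z] abs_Im_le_cmod[of z] by linarith+
    have "norm c \<le> 3/2 + n" using cmod_le[of c] n by (simp add: c_def)
    then have nc: "norm (c + z) \<le> n + 5" using norm_triangle_ineq[of c z] that by linarith
    have "norm (f z) \<le> 2 + 10 * (norm (c + z) + 1)\<^sup>2"
      unfolding f_def using z n by (intro zeta_growth) (auto simp: c_def)
    also have "\<dots> \<le> B" unfolding B_def using nc by (intro add_left_mono mult_left_mono power_mono) auto
    finally show ?thesis .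
  qed
  have f0: "norm (f 0) \<ge> c0" unfolding f_def by (rule c0) (simp add: c_def)
  then have f0': "f 0 \<noteq> 0" using c0 by auto
  have B: "B > 0" using n by (simp add: B_def add_pos_nonneg)
  have simp: "deriv f z \<noteq> 0" if "z \<in> Z" for z
  proof -
    have z: "norm z \<le> 6/5" "zeta (c + z) = 0" using that by (auto simp: Z_def f_def)
    have zz: "c + z \<in> nontrivial_zeros"
    proof (rule nontrivial_zerosI)
      show "-1 < Re (c + z)" using z abs_Re_le_cmod[of z] by (simp add: c_def)
    qed (use z nz1 in auto)
    have "(zeta has_field_derivative deriv zeta (c + z)) (at (c + z))"
      using zz nontrivial_zero_strip[OF zz] by (intro holomorphic_derivI[OF zeta_holomorphic]) auto
    then have "((\<lambda>z. zeta (c + z)) has_field_derivative deriv zeta (c + z)) (at z)"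
      using DERIV_shift[of zeta "deriv zeta (c + z)" z c] by (simp add: add.commute)
    then have "deriv f z = deriv zeta (c + z)" unfolding f_def by (rule DERIV_imp_deriv)
    then show ?thesis using deriv_zeta_nonzero[OF simple zz] by simp
  qed
  note mm = simple_zeros_min_modulus[OF hol, of "49/20" "6/5" "11/10" B Z, OF _ _ _ _ le f0' Z_def simp, simplified]
  define N where "N = card Z"
  have "(25/24) ^ N \<le> B / norm (f 0)" using mm(2) by (simp add: N_def)
  also have "\<dots> \<le> B / c0" using f0 f0' c0(1) B by (intro divide_left_mono mult_pos_pos) auto
  finally have "(25/24) ^ N \<le> B / c0" .
  then have "ln ((25/24) ^ N) \<le> ln (B / c0)" by (subst ln_le_cancel_iff) (use B c0 in auto)
  then have NL: "real N \<le> L" by (simp add: ln_realpow L_def pos_le_divide_eq)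
  define G where "G = (\<lambda>z. n + Im z) ` Z"
  have G: "finite G" "card G \<le> N" using mm(1) card_image_le unfolding G_def N_def by auto
  obtain t where t: "t \<in> {n..n + 1/4}" "\<And>\<gamma>. \<gamma> \<in> G \<Longrightarrow> (1/4) / (2 * (real N + 1)) \<le> \<bar>t - \<gamma>\<bar>"
    using exists_point_away_from_finite_set[OF G, of "1/4" n] by auto
  show ?thesis
  proof (intro bexI[OF _ t(1)] allI impI)
    fix s assume s: "Im s = t" "1/2 \<le> Re s" "Re s \<le> 3/2"
    define z where "z = s - c"
    have sz: "zeta s = f z" by (simp add: f_def z_def)
    have "(norm z)\<^sup>2 = (Re s - 3/2)\<^sup>2 + (t - n)\<^sup>2" by (simp add: z_def c_def cmod_power2 s)
    also have "\<dots> \<le> 1\<^sup>2 + (1/4)\<^sup>2" using s t(1) by (intro add_mono power2_le_iff_abs_le[THEN iffD2]) auto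
    also have "\<dots> \<le> (11/10)\<^sup>2" by (simp add: power2_eq_square)
    finally have nz: "norm z \<le> 11/10" by (rule power2_le_imp_le) simp
    \<comment> \<open>The gap h / (2 (N + 1)) of the pigeonhole argument for h = 1/4.\<close>
    define d where "d = 1 / (8 * (real N + 1))"
    have d: "d > 0" by (simp add: d_def)
    have "d ^ N = (\<Prod>\<rho>\<in>Z. d)" by (simp add: N_def)
    also have "\<dots> \<le> (\<Prod>\<rho>\<in>Z. norm (z - \<rho>))"
    proof (rule prod_mono, intro conjI)
      fix \<rho> assume "\<rho> \<in> Z"
      then have "n + Im \<rho> \<in> G" by (auto simp: G_def)
      then have "d \<le> \<bar>t - (n + Im \<rho>)\<bar>" using t(2)[of "n + Im \<rho>"] by (simp add: d_def)
      also have "\<dots> = \<bar>Im (z - \<rho>)\<bar>" by (simp add: z_def c_def s algebra_simps)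
      also have "\<dots> \<le> norm (z - \<rho>)" by (rule abs_Im_le_cmod)
      finally show "d \<le> norm (z - \<rho>)" .
    qed (use d in simp)
    finally have p: "d ^ N \<le> (\<Prod>\<rho>\<in>Z. norm (z - \<rho>))" .
    have q1: "c0 / (6/5) ^ N \<le> norm (f 0) / (6/5) ^ N" using f0 by (intro divide_right_mono) auto
    have q2: "(2 * B / c0) powr (-22) \<le> (2 * B / norm (f 0)) powr (-22)"
      using B c0(1) f0 f0' by (intro powr_mono2') (auto intro!: divide_left_mono mult_pos_pos)
    have "norm (f z) \<ge> (\<Prod>\<rho>\<in>Z. norm (z - \<rho>)) * (norm (f 0) / (6/5) ^ N * (2 * B / norm (f 0)) powr (-22))"
      using mm(3)[of z] nz by (simp add: N_def)
    moreover have "d ^ N * (c0 / (6/5) ^ N * (2 * B / c0) powr (-22)) \<le> (\<Prod>\<rho>\<in>Z. norm (z - \<rho>)) * (norm (f 0) / (6/5) ^ N * (2 * B / norm (f 0)) powr (-22))"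
      using p q1 q2 c0 d by (intro mult_mono) (auto intro!: prod_nonneg)
    ultimately have A: "d ^ N * (c0 / (6/5) ^ N * (2 * B / c0) powr (-22)) \<le> norm (zeta s)" unfolding sz by linarith
    have "exp (- (L * ln (10 * (L + 1)))) \<le> exp (- (real N * ln (10 * (real N + 1))))"
      using NL by (simp, intro mult_mono) auto
    also have "\<dots> = (1 / (10 * (real N + 1))) ^ N"
      by (simp add: exp_minus exp_of_nat_mult power_divide power_mult_distrib[symmetric] inverse_eq_divide)
    \<comment> \<open>8 times 6/5 is 9.6, which explains the 10 in the statement.\<close>
    also have "\<dots> \<le> (d / (6/5)) ^ N" by (intro power_mono) (auto simp: d_def field_simps)
    finally have "exp (- (L * ln (10 * (L + 1)))) * (c0 * (2 * B / c0) powr (- 22)) \<le> (d / (6/5)) ^ N * (c0 * (2 * B / c0) powr (- 22))"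
      using c0 by (intro mult_right_mono) auto
    also have "\<dots> = d ^ N * (c0 / (6/5) ^ N * (2 * B / c0) powr (-22))" unfolding power_divide by simp
    finally show "exp (- (L * ln (10 * (L + 1)))) * (c0 * (2 * B / c0) powr (- 22)) \<le> norm (zeta s)"
      using A by linarith
  qed
qed

lemma zeta_good_heights:
  assumes simple: "\<forall>\<rho>\<in>nontrivial_zeros. zorder zeta \<rho> = 1"
  obtains T :: "nat \<Rightarrow> real" where "strict_mono T" "filterlim T at_top sequentially" "\<And>k. T k \<ge> 1"
    "\<And>k s. \<bar>Im s\<bar> = T k \<Longrightarrow> Re s \<ge> 1/2 \<Longrightarrow> norm (zeta s) \<ge> exp (- T k / 4)"
proof -
  obtain c0 where c0: "c0 > 0" "\<And>s. Re s \<ge> 5/4 \<Longrightarrow> norm (zeta s) \<ge> c0"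
    using zeta_lower_bound[of "5/4"] by auto
  define B where "B n = 2 + 10 * (n + 6)\<^sup>2" for n :: real
  define \<kappa> where "\<kappa> = 1 / ln (25 / 24 :: real)"
  have \<kappa>: "\<kappa> > 0" by (simp add: \<kappa>_def)
  define L where "L n = ln (B n / c0) / ln (25 / 24)" for n
  \<comment> \<open>The negative logarithm of the lower bound is O(log n log log n), so n/4
    dominates it.\<close>
  have "eventually (\<lambda>n. ln ((2 + 10 * (n + 6)\<^sup>2) / c0) * \<kappa> * ln (10 * (ln ((2 + 10 * (n + 6)\<^sup>2) / c0) * \<kappa> + 1))
      + 22 * ln (2 * (2 + 10 * (n + 6)\<^sup>2) / c0) - ln c0 \<le> n / 4) at_top"
    using c0(1) \<kappa> by real_asymp
  then have ev: "eventually (\<lambda>n. L n * ln (10 * (L n + 1)) + 22 * ln (2 * B n / c0) - ln c0 \<le> n / 4) at_top"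
    by (simp add: L_def B_def \<kappa>_def)
  have "eventually (\<lambda>n. exp (- n / 4) \<le> c0) at_top" using c0(1) by real_asymp
  with ev have "eventually (\<lambda>n. L n * ln (10 * (L n + 1)) + 22 * ln (2 * B n / c0) - ln c0 \<le> n / 4 \<and> exp (- n / 4) \<le> c0 \<and> n \<ge> 10) at_top"
    by (intro eventually_conj eventually_ge_at_top)
  then obtain n0 where n0: "\<And>n. n \<ge> n0 \<Longrightarrow> L n * ln (10 * (L n + 1)) + 22 * ln (2 * B n / c0) - ln c0 \<le> n / 4 \<and> exp (- n / 4) \<le> c0 \<and> n \<ge> 10"
    by (auto simp: eventually_at_top_linorder)
  have ex: "\<exists>t\<in>{n..n + 1/4}. \<forall>s. Im s = t \<longrightarrow> 1/2 \<le> Re s \<longrightarrow> norm (zeta s) \<ge> exp (- t / 4)" if "n \<ge> n0" for n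
  proof -
    note nn = n0[OF that]
    obtain t where t: "t \<in> {n..n + 1/4}" "\<And>s. Im s = t \<Longrightarrow> 1/2 \<le> Re s \<Longrightarrow> Re s \<le> 3/2 \<Longrightarrow>
        norm (zeta s) \<ge> exp (- (L n * ln (10 * (L n + 1)))) * (c0 * (2 * B n / c0) powr (- 22))"
      using zeta_lower_bound_at_height[OF simple c0, of n] nn unfolding L_def B_def by blast
    have Bp: "B n > 0" using nn by (simp add: B_def add_pos_nonneg)
    have "exp (- (L n * ln (10 * (L n + 1)))) * (c0 * (2 * B n / c0) powr (- 22))
      = exp (- (L n * ln (10 * (L n + 1)) + 22 * ln (2 * B n / c0) - ln c0))"
    proof -
      have "(2 * B n / c0) powr (- 22) = exp (- (22 * ln (2 * B n / c0)))"
        using Bp c0(1) by (simp add: powr_def)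
      moreover have "c0 = exp (ln c0)" using c0(1) by simp
      ultimately have "exp (- (L n * ln (10 * (L n + 1)))) * (c0 * (2 * B n / c0) powr (- 22)) =
         exp (- (L n * ln (10 * (L n + 1)))) * (exp (ln c0) * exp (- (22 * ln (2 * B n / c0))))" by simp
      also have "\<dots> = exp (- (L n * ln (10 * (L n + 1))) + (ln c0 + - (22 * ln (2 * B n / c0))))"
        by (simp only: exp_add)
      finally show ?thesis by (simp add: algebra_simps)
    qed
    also have "\<dots> \<ge> exp (- n / 4)" using nn by simp
    finally have low: "exp (- n / 4) \<le> exp (- (L n * ln (10 * (L n + 1)))) * (c0 * (2 * B n / c0) powr (- 22))" .
    have tn: "exp (- t / 4) \<le> exp (- n / 4)" using t(1) by simp
    show ?thesis
    proof (intro bexI[OF _ t(1)] allI impI)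
      fix s assume s: "Im s = t" "1/2 \<le> Re s"
      show "exp (- t / 4) \<le> norm (zeta s)"
      proof (cases "Re s \<le> 3/2")
        case True
        then show ?thesis using t(2)[OF s True] low tn by linarith
      next
        case False
        then have "c0 \<le> norm (zeta s)" by (intro c0) simp
        then show ?thesis using nn tn by linarith
      qed
    qed
  qed
  \<comment> \<open>Windows of length 1/4 start one unit apart, so the chosen heights increase
    strictly. Negative heights follow by conjugation.\<close>
  define T where "T k = (SOME t. t \<in> {max n0 1 + real k..max n0 1 + real k + 1/4} \<and> (\<forall>s. Im s = t \<longrightarrow> 1/2 \<le> Re s \<longrightarrow> norm (zeta s) \<ge> exp (- t / 4)))" for k :: nat
  have T: "T k \<in> {max n0 1 + real k..max n0 1 + real k + 1/4} \<and> (\<forall>s. Im s = T k \<longrightarrow> 1/2 \<le> Re s \<longrightarrow> norm (zeta s) \<ge> exp (- T k / 4))" for k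
    unfolding T_def
  proof (rule someI_ex)
    have "n0 \<le> max n0 1 + real k" by simp
    from ex[OF this] show "\<exists>t. t \<in> {max n0 1 + real k..max n0 1 + real k + 1/4} \<and> (\<forall>s. Im s = t \<longrightarrow> 1/2 \<le> Re s \<longrightarrow> norm (zeta s) \<ge> exp (- t / 4))"
      by blast
  qed
  show ?thesis
  proof (rule that[of T])
    show "strict_mono T"
    proof (rule strict_mono_Suc_iff[THEN iffD2], rule allI)
      fix k
      have "T k \<le> max n0 1 + real k + 1/4" "max n0 1 + real (Suc k) \<le> T (Suc k)" using T[of k] T[of "Suc k"] by auto
      then show "T k < T (Suc k)" by simp
    qed
    show "T k \<ge> 1" for k
    proof -
      have "max n0 1 + real k \<le> T k" using T[of k] by auto
      moreover have "max n0 1 \<ge> 1" by simp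
      ultimately show ?thesis by linarith
    qed
    show "filterlim T at_top sequentially"
    proof (rule filterlim_at_top_mono[OF filterlim_real_sequentially])
      show "\<forall>\<^sub>F k in sequentially. real k \<le> T k"
      proof (rule always_eventually, rule allI)
        fix k
        have "max n0 1 + real k \<le> T k" using T[of k] by auto
        moreover have "max n0 1 \<ge> 1" by simp
        ultimately show "real k \<le> T k" by linarith
      qed
    qed
    fix k s assume s: "\<bar>Im s\<bar> = T k" "Re s \<ge> 1/2"
    show "exp (- T k / 4) \<le> norm (zeta s)"
    proof (cases "Im s \<ge> 0")
      case True
      then show ?thesis using T[of k] s by auto
    next
      case False
      then have "Im (cnj s) = T k" "1/2 \<le> Re (cnj s)" using s by auto
      then have "exp (- T k / 4) \<le> norm (zeta (cnj s))" using T[of k] by blast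
      then show ?thesis by (simp add: norm_zeta_cnj)
    qed
  qed
qed

subsection \<open>The sum over the zeros as a difference of line integrals\<close>

definition zeta_kernel :: "real \<Rightarrow> complex \<Rightarrow> complex" where
  "zeta_kernel x s = Fz s * of_real x powr (s / 2)"

definition line_integral :: "real \<Rightarrow> real \<Rightarrow> complex" where
  "line_integral b x = (\<integral>t. zeta_kernel x (Complex b t) \<partial>lborel)"

text \<open>The common interface of all lines used: from it follow integrability, growth of order
  x^(b/2) and Fubini. Only the source of the constant differs between the left line, the right lines
  and the line under the Riemann hypothesis.\<close>

definition line_bounded :: "real \<Rightarrow> real \<Rightarrow> bool" where
  "line_bounded b C \<longleftrightarrow> -1 < b \<and> b < 2 \<and> (\<forall>\<rho>\<in>nontrivial_zeros. Re \<rho> \<noteq> b) \<and>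
     C > 0 \<and> (\<forall>t. norm (Fz (Complex b t)) \<le> C * exp (- (1/2) * \<bar>t\<bar>))"

lemma continuous_on_Fz_line:
  assumes "-1 < b" "b < 2" "\<forall>\<rho>\<in>nontrivial_zeros. Re \<rho> \<noteq> b"
  shows "continuous_on UNIV (\<lambda>t. Fz (Complex b t))"
proof -
  have "continuous_on ({s. -1 < Re s \<and> Re s < 2} - nontrivial_zeros) Fz"
    by (rule holomorphic_on_imp_continuous_on[OF Fz_holomorphic])
  moreover have "continuous_on UNIV (\<lambda>t. Complex b t)"
    unfolding Complex_eq by (intro continuous_intros)
  ultimately show ?thesis
    by (rule continuous_on_compose2) (use assms in auto)
qed

text \<open>Decay need only be checked for large |t|: the rest of the line is compact and zero-free,
  and the factor exp(|M|/2) makes up for the decaying exponential there.\<close>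

lemma line_boundedI:
  assumes "-1 < b" "b < 2" "\<forall>\<rho>\<in>nontrivial_zeros. Re \<rho> \<noteq> b"
    and "\<And>t. \<bar>t\<bar> \<ge> M \<Longrightarrow> norm (Fz (Complex b t)) \<le> C * exp (- (1/2) * \<bar>t\<bar>)"
  obtains C' where "line_bounded b C'"
proof -
  have "compact ((\<lambda>t. Fz (Complex b t)) ` {- \<bar>M\<bar>..\<bar>M\<bar>})"
    by (intro compact_continuous_image continuous_on_subset[OF continuous_on_Fz_line]) (use assms in auto)
  then have "bounded ((\<lambda>t. Fz (Complex b t)) ` {- \<bar>M\<bar>..\<bar>M\<bar>})" by (rule compact_imp_bounded)
  then obtain D where D: "\<And>t. t \<in> {- \<bar>M\<bar>..\<bar>M\<bar>} \<Longrightarrow> norm (Fz (Complex b t)) \<le> D"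
    unfolding bounded_iff by blast
  define C' where "C' = \<bar>C\<bar> + \<bar>D\<bar> * exp (\<bar>M\<bar> / 2) + 1"
  have "norm (Fz (Complex b t)) \<le> C' * exp (- (1/2) * \<bar>t\<bar>)" for t
  proof (cases "\<bar>t\<bar> \<ge> \<bar>M\<bar>")
    case True
    then have "norm (Fz (Complex b t)) \<le> C * exp (- (1/2) * \<bar>t\<bar>)" by (intro assms) auto
    also have "\<dots> \<le> C' * exp (- (1/2) * \<bar>t\<bar>)" by (intro mult_right_mono) (auto simp: C'_def intro!: add_increasing2)
    finally show ?thesis .
  next
    case False
    then have "norm (Fz (Complex b t)) \<le> \<bar>D\<bar> * 1" using D[of t] by fastforce
    also have "\<dots> \<le> \<bar>D\<bar> * (exp (\<bar>M\<bar> / 2) * exp (- (1/2) * \<bar>t\<bar>))"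
      using False by (intro mult_left_mono) (auto simp flip: exp_add)
    also have "\<dots> \<le> C' * exp (- (1/2) * \<bar>t\<bar>)" by (simp add: C'_def distrib_right mult.assoc)
    finally show ?thesis .
  qed
  moreover have "C' > 0" by (auto simp: C'_def intro!: add_nonneg_pos)
  ultimately show ?thesis using that[of C'] assms by (auto simp: line_bounded_def)
qed

lemma norm_zeta_kernel:
  "x > 0 \<Longrightarrow> norm (zeta_kernel x s) = norm (Fz s) * x powr (Re s / 2)"
  by (simp add: zeta_kernel_def norm_mult norm_powr_real_powr)

lemma integrable_exp_half: "integrable lborel (\<lambda>t::real. C * exp (- (1/2) * \<bar>t\<bar>) * D)" for C D :: real
  using integrable_exp_minus_abs[of "1/2"] by simp

lemma zeta_kernel_line_integrable:
  assumes b: "line_bounded b C" and x: "x > 0"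
  shows "integrable lborel (\<lambda>t. zeta_kernel x (Complex b t))"
proof (rule Bochner_Integration.integrable_bound[OF integrable_exp_half[of C "x powr (b / 2)"]])
  have c: "continuous_on UNIV (\<lambda>t. Fz (Complex b t))"
    using b by (intro continuous_on_Fz_line) (auto simp: line_bounded_def)
  have "continuous_on UNIV (\<lambda>t. zeta_kernel x (Complex b t))"
    unfolding zeta_kernel_def Complex_eq using x by (intro continuous_intros c[unfolded Complex_eq]) auto
  then show "(\<lambda>t. zeta_kernel x (Complex b t)) \<in> borel_measurable lborel"
    by (simp add: borel_measurable_continuous_onI)
  show "AE t in lborel. norm (zeta_kernel x (Complex b t)) \<le> norm (C * exp (- (1 / 2) * \<bar>t\<bar>) * x powr (b / 2))"
    using b x by (intro AE_I2) (auto simp: norm_zeta_kernel line_bounded_def intro!: mult_right_mono)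
qed

lemma norm_line_integral:
  assumes b: "line_bounded b C" and x: "x > 0"
  shows "norm (line_integral b x) \<le> (\<integral>t. C * exp (- (1/2) * \<bar>t\<bar>) \<partial>lborel) * x powr (b / 2)"
proof -
  have "norm (line_integral b x) \<le> (\<integral>t. C * exp (- (1/2) * \<bar>t\<bar>) * x powr (b / 2) \<partial>lborel)"
    unfolding line_integral_def
    by (rule norm_lebesgue_integral_le[OF integrable_exp_half])
       (use b x in \<open>auto simp: norm_zeta_kernel line_bounded_def intro!: mult_right_mono\<close>)
  then show ?thesis by simp
qed

text \<open>Reflection sends this line to Re s = 3/2, where zeta is bounded away from 0.\<close>

lemma line_bounded_left: obtains C where "line_bounded (-1/2) C"
proof -
  obtain C where C: "C > 0" "\<And>s. -1/2 \<le> Re s \<Longrightarrow> Re s \<le> 1/2 \<Longrightarrow> \<bar>Im s\<bar> \<ge> 1 \<Longrightarrow>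
    norm (Fz s) \<le> C * exp (- (3/4) * \<bar>Im s\<bar>) / norm (zeta (1 - s))"
    using Fz_bound_left by blast
  obtain c where c: "c > 0" "\<And>s. Re s \<ge> 3/2 \<Longrightarrow> norm (zeta s) \<ge> c"
    using zeta_lower_bound[of "3/2"] by auto
  show ?thesis
  proof (rule line_boundedI[of "-1/2" 1 "C / c"])
    show "\<forall>\<rho>\<in>nontrivial_zeros. Re \<rho> \<noteq> -1/2" using nontrivial_zero_strip(1) by force
    fix t :: real assume t: "\<bar>t\<bar> \<ge> 1"
    have "norm (Fz (Complex (-1/2) t)) \<le> C * exp (- (3/4) * \<bar>t\<bar>) / norm (zeta (1 - Complex (-1/2) t))"
      using C(2)[of "Complex (-1/2) t"] t by simp
    also have "\<dots> \<le> C * exp (- (3/4) * \<bar>t\<bar>) / c"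
    proof -
      have "norm (zeta (1 - Complex (-1/2) t)) \<ge> c" by (rule c(2)) simp
      then show ?thesis using c(1) C(1) by (intro divide_left_mono mult_pos_pos) auto
    qed
    also have "\<dots> \<le> C * exp (- (1/2) * \<bar>t\<bar>) / c"
      using C c by (intro divide_right_mono mult_left_mono) auto
    finally show "norm (Fz (Complex (-1/2) t)) \<le> C / c * exp (- (1/2) * \<bar>t\<bar>)" by simp
  qed (use that in auto)
qed

text \<open>Uniform in the strip, because shifting a line from 5/4 to 7/4 also involves the
  horizontal sides.\<close>

lemma Fz_bound_right_strip:
  obtains C where "C > 0" "\<And>s. 5/4 \<le> Re s \<Longrightarrow> Re s \<le> 7/4 \<Longrightarrow> norm (Fz s) \<le> C * exp (- (1/2) * \<bar>Im s\<bar>)"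
proof -
  obtain C where C: "C > 0" "\<And>s. -2 \<le> Re s \<Longrightarrow> Re s \<le> 7/4 \<Longrightarrow> norm (Fz s) \<le> C * exp (- (3/4) * \<bar>Im s\<bar>) / norm (zeta s)"
    using Fz_bound_right by blast
  obtain c where c: "c > 0" "\<And>s. Re s \<ge> 5/4 \<Longrightarrow> norm (zeta s) \<ge> c"
    using zeta_lower_bound[of "5/4"] by auto
  show ?thesis
  proof (rule that[of "C / c"])
    fix s assume s: "5/4 \<le> Re s" "Re s \<le> 7/4"
    have "norm (Fz s) \<le> C * exp (- (3/4) * \<bar>Im s\<bar>) / norm (zeta s)" using C(2)[of s] s by simp
    also have "\<dots> \<le> C * exp (- (3/4) * \<bar>Im s\<bar>) / c"
    proof -
      have "norm (zeta s) \<ge> c" by (rule c(2)) (use s in simp)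
      then show ?thesis using c(1) C(1) by (intro divide_left_mono mult_pos_pos) auto
    qed
    also have "\<dots> \<le> C * exp (- (1/2) * \<bar>Im s\<bar>) / c"
      using C c by (intro divide_right_mono mult_left_mono) auto
    finally show "norm (Fz s) \<le> C / c * exp (- (1/2) * \<bar>Im s\<bar>)" by simp
  qed (use C c in auto)
qed

lemma line_bounded_right:
  assumes "5/4 \<le> b" "b \<le> 7/4"
  obtains C where "line_bounded b C"
proof -
  obtain C where C: "C > 0" "\<And>s. 5/4 \<le> Re s \<Longrightarrow> Re s \<le> 7/4 \<Longrightarrow> norm (Fz s) \<le> C * exp (- (1/2) * \<bar>Im s\<bar>)"
    using Fz_bound_right_strip by blast
  have "Re \<rho> \<noteq> b" if "\<rho> \<in> nontrivial_zeros" for \<rho> using nontrivial_zero_strip(2)[OF that] assms by simp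
  moreover have "norm (Fz (Complex b t)) \<le> C * exp (- (1/2) * \<bar>t\<bar>)" for t
    using C(2)[of "Complex b t"] assms by simp
  ultimately show ?thesis using that[of C] C(1) assms by (auto simp: line_bounded_def)
qed

text \<open>Under the hypothesis the unit disc about 3/2 + i t is zero-free. The point b + i t lies
  at distance r1 = 3/2 - b < 1 from its centre, so zeta is bounded below there by a negative power
  of |t|, whose exponent \<kappa> depends on b only and grows without bound as b approaches
  1/2.\<close>

lemma line_bounded_under_RH:
  assumes RH: "riemann_hypothesis" and b: "1/2 < b" "b \<le> 1"
  obtains C where "line_bounded b C"
proof -
  obtain C where C: "C > 0" "\<And>s. -2 \<le> Re s \<Longrightarrow> Re s \<le> 7/4 \<Longrightarrow> norm (Fz s) \<le> C * exp (- (3/4) * \<bar>Im s\<bar>) / norm (zeta s)"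
    using Fz_bound_right by blast
  obtain c where c: "c > 0" "\<And>s. Re s \<ge> 5/4 \<Longrightarrow> norm (zeta s) \<ge> c"
    using zeta_lower_bound[of "5/4"] by auto
  define r1 where "r1 = 3/2 - b"
  have r1: "1/2 \<le> r1" "r1 < 1" using b by (auto simp: r1_def)
  define K where "K u = 2 * (2 + 10 * (u + 5)\<^sup>2) / c" for u :: real
  define \<kappa> where "\<kappa> = 2 * r1 / (1 - r1)"
  have low: "norm (zeta (Complex b t)) \<ge> c * K \<bar>t\<bar> powr (- \<kappa>)" if t: "\<bar>t\<bar> \<ge> 2" for t
  proof -
    define s0 where "s0 = Complex (3/2) t"
    define g where "g z = zeta (s0 + z)" for z
    have bnd: "Re (s0 + z) > 1/2" "\<bar>Im (s0 + z)\<bar> \<ge> 1" if "norm z < 1" for z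
      using that t abs_Re_le_cmod[of z] abs_Im_le_cmod[of z] by (auto simp: s0_def)
    have ne1: "s0 + z \<noteq> 1" if "norm z < 1" for z
    proof
      assume "s0 + z = 1"
      then have "Im (s0 + z) = 0" by simp
      then show False using bnd(2)[OF that] by simp
    qed
    have "norm (g (Complex (b - 3/2) 0)) \<ge> norm (g 0) * K \<bar>t\<bar> powr (- (2 * r1 / (1 - r1)))"
    proof (rule nonvanishing_lower_bound[where r = 1])
      have "zeta \<circ> (\<lambda>z. s0 + z) holomorphic_on ball 0 1"
      proof (rule holomorphic_on_compose_gen[OF _ zeta_holomorphic])
        show "(\<lambda>z. s0 + z) ` ball 0 1 \<subseteq> - {1}" using ne1 by (force simp del: image_add_ball)
      qed (auto intro!: holomorphic_intros)
      then show "g holomorphic_on ball 0 1" by (simp add: g_def[abs_def] o_def)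
      show "g z \<noteq> 0" if "z \<in> ball 0 1" for z
      proof
        assume "g z = 0"
        then have "s0 + z \<in> nontrivial_zeros"
          using that bnd[of z] ne1[of z] by (intro nontrivial_zerosI) (auto simp: g_def)
        then show False using RH bnd[of z] that by (auto simp: riemann_hypothesis_def)
      qed
      fix z :: complex assume "z \<in> ball 0 1"
      then have z: "norm z < 1" by simp
      have "norm s0 \<le> 3/2 + \<bar>t\<bar>" using cmod_le[of s0] by (simp add: s0_def)
      then have n: "norm (s0 + z) \<le> \<bar>t\<bar> + 5/2" using norm_triangle_ineq[of s0 z] z by linarith
      have g0: "norm (g 0) \<ge> c" unfolding g_def by (rule c) (simp add: s0_def)
      have "norm (g z) \<le> 2 + 10 * (norm (s0 + z) + 1)\<^sup>2"
        unfolding g_def using bnd[OF z] by (intro zeta_growth) auto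
      also have "\<dots> \<le> 2 + 10 * (\<bar>t\<bar> + 5)\<^sup>2" using n by (intro add_left_mono mult_left_mono power_mono) auto
      also have "\<dots> < K \<bar>t\<bar> * c" using c(1) by (simp add: K_def add_pos_nonneg)
      also have "\<dots> \<le> K \<bar>t\<bar> * norm (g 0)" using g0 c(1) by (intro mult_left_mono) (auto simp: K_def)
      finally show "norm (g z) < K \<bar>t\<bar> * norm (g 0)" .
    next
      show "norm (Complex (b - 3/2) 0) \<le> r1" using b by (simp add: r1_def cmod_def)
    qed (use r1 in auto)
    moreover have "norm (g 0) \<ge> c" unfolding g_def by (rule c) (simp add: s0_def)
    then have "norm (g 0) * K \<bar>t\<bar> powr (- (2 * r1 / (1 - r1))) \<ge> c * K \<bar>t\<bar> powr (- (2 * r1 / (1 - r1)))"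
      by (intro mult_right_mono) auto
    moreover have "s0 + Complex (b - 3/2) 0 = Complex b t" by (simp add: s0_def complex_eq_iff)
    ultimately show ?thesis by (simp add: g_def \<kappa>_def)
  qed
  have \<kappa>: "\<kappa> > 0" using r1 by (simp add: \<kappa>_def)
  have "eventually (\<lambda>u. c * (2 * (2 + 10 * (u + 5)\<^sup>2) / c) powr (- \<kappa>) \<ge> exp (- u / 4)) at_top"
    using c(1) \<kappa> by real_asymp
  then have "eventually (\<lambda>u. c * K u powr (- \<kappa>) \<ge> exp (- u / 4)) at_top" by (simp add: K_def)
  then obtain M where M: "\<And>u. u \<ge> M \<Longrightarrow> c * K u powr (- \<kappa>) \<ge> exp (- u / 4)"
    by (auto simp: eventually_at_top_linorder)
  show ?thesis
  proof (rule line_boundedI[of b "max M 2" C])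
    show "\<forall>\<rho>\<in>nontrivial_zeros. Re \<rho> \<noteq> b" using RH b by (auto simp: riemann_hypothesis_def)
    fix t assume t: "\<bar>t\<bar> \<ge> max M 2"
    have "norm (zeta (Complex b t)) \<ge> c * K \<bar>t\<bar> powr (- \<kappa>)" using t by (intro low) simp
    then have l: "norm (zeta (Complex b t)) \<ge> exp (- \<bar>t\<bar> / 4)" using M[of "\<bar>t\<bar>"] t by linarith
    have "norm (Fz (Complex b t)) \<le> C * exp (- (3/4) * \<bar>t\<bar>) / norm (zeta (Complex b t))"
      using C(2)[of "Complex b t"] b by simp
    also have "\<dots> \<le> C * exp (- (3/4) * \<bar>t\<bar>) / exp (- \<bar>t\<bar> / 4)"
      using l C(1) by (intro divide_left_mono mult_pos_pos less_le_trans[OF _ l]) auto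
    also have "\<dots> = C * exp (- (1/2) * \<bar>t\<bar>)" by (simp add: field_simps flip: exp_add)
    finally show "norm (Fz (Complex b t)) \<le> C * exp (- (1/2) * \<bar>t\<bar>)" .
  qed (use b that in auto)
qed

lemma residue_zeta_kernel:
  assumes simple: "\<forall>\<rho>\<in>nontrivial_zeros. zorder zeta \<rho> = 1" and \<rho>: "\<rho> \<in> nontrivial_zeros" and x: "x > 0"
  shows "residue (zeta_kernel x) \<rho> = of_real x powr (\<rho> / 2) * Gamma (1 - \<rho> / 2) / deriv zeta \<rho>"
proof -
  note r = nontrivial_zero_strip[OF \<rho>]
  have in1: "\<rho> \<in> - {1}" "0 \<in> - {1::complex}" and z0: "zeta 0 \<noteq> 0" using r zeta_0 by auto
  have o1: "open (- {1::complex})" by auto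
  obtain e where e: "e > 0" "ball \<rho> e \<subseteq> - {1}" "\<And>z. z \<in> ball \<rho> e - {\<rho>} \<Longrightarrow> zeta z \<noteq> 0"
    using isolated_zeros[OF zeta_holomorphic o1 connected_complement_singleton_complex in1(1) r(3) in1(2) z0] by blast
  define h where "h s = of_real x powr (s / 2) * Gamma (1 - s / 2)" for s :: complex
  have np: "1 - s / 2 \<notin> \<int>\<^sub>\<le>\<^sub>0" if "Re s < 2" for s
    using that by (auto elim!: nonpos_Ints_cases simp: complex_eq_iff)
  show ?thesis
  proof (rule residue_simple'[where s = "ball \<rho> e \<inter> ({s. Re s > -1} \<inter> {s. Re s < 2})"])
    show "open (ball \<rho> e \<inter> ({s. Re s > -1} \<inter> {s. Re s < 2}))"
      by (intro open_Int open_ball open_halfspace_Re_gt open_halfspace_Re_lt)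
    show "\<rho> \<in> ball \<rho> e \<inter> ({s. Re s > -1} \<inter> {s. Re s < 2})" using e r by auto
    have "z \<notin> nontrivial_zeros" if "z \<in> ball \<rho> e - {\<rho>}" for z
      using e(3)[OF that] nontrivial_zero_strip(3) by blast
    then have "ball \<rho> e \<inter> ({s. Re s > -1} \<inter> {s. Re s < 2}) - {\<rho>} \<subseteq> {s. -1 < Re s \<and> Re s < 2} - nontrivial_zeros" by auto
    then have "Fz holomorphic_on ball \<rho> e \<inter> ({s. Re s > -1} \<inter> {s. Re s < 2}) - {\<rho>}"
      by (rule holomorphic_on_subset[OF Fz_holomorphic])
    then show "zeta_kernel x holomorphic_on ball \<rho> e \<inter> ({s. Re s > -1} \<inter> {s. Re s < 2}) - {\<rho>}"
      unfolding zeta_kernel_def[abs_def] using x by (intro holomorphic_intros) auto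
    have "isCont h \<rho>"
      unfolding h_def using x np[of \<rho>] r by (intro continuous_intros) auto
    then have 1: "(h \<longlongrightarrow> h \<rho>) (at \<rho>)" by (simp add: isCont_def)
    have "(zeta has_field_derivative deriv zeta \<rho>) (at \<rho>)"
      using r by (intro holomorphic_derivI[OF zeta_holomorphic]) auto
    then have "((\<lambda>w. zeta w / (w - \<rho>)) \<longlongrightarrow> deriv zeta \<rho>) (at \<rho>)"
      using r by (simp add: has_field_derivative_iff)
    from tendsto_divide[OF 1 this deriv_zeta_nonzero[OF simple \<rho>]]
    have "((\<lambda>w. h w / (zeta w / (w - \<rho>))) \<longlongrightarrow> h \<rho> / deriv zeta \<rho>) (at \<rho>)" .
    then show "((\<lambda>w. zeta_kernel x w * (w - \<rho>)) \<longlongrightarrow> of_real x powr (\<rho> / 2) * Gamma (1 - \<rho> / 2) / deriv zeta \<rho>) (at \<rho>)"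
      by (simp add: h_def zeta_kernel_def Fz_def mult_ac)
  qed
qed

text \<open>b is any bounded line to the right of all zeros: 5/4 unconditionally, close to 1/2 under
  the hypothesis. On the horizontal sides the lower bound for zeta is applied at s if Re s >= 1/2
  and at 1 - s otherwise.\<close>

lemma zero_sum_tendsto:
  assumes simple: "\<forall>\<rho>\<in>nontrivial_zeros. zorder zeta \<rho> = 1"
    and T: "filterlim T at_top sequentially" "\<And>k. T k \<ge> (1::real)"
    and low: "\<And>k s. \<bar>Im s\<bar> = T k \<Longrightarrow> Re s \<ge> 1/2 \<Longrightarrow> norm (zeta s) \<ge> exp (- T k / 4)"
    and b: "1/2 < b" "b \<le> 7/4" "\<And>\<rho>. \<rho> \<in> nontrivial_zeros \<Longrightarrow> Re \<rho> < b" "line_bounded b C"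
    and x: "x > 0"
  shows "(\<lambda>k. zero_sum_upto (T k) x) \<longlonglongrightarrow> (line_integral b x - line_integral (-1/2) x) / (2 * pi)"
proof -
  obtain C1 where C1: "C1 > 0" "\<And>s. -2 \<le> Re s \<Longrightarrow> Re s \<le> 7/4 \<Longrightarrow> norm (Fz s) \<le> C1 * exp (- (3/4) * \<bar>Im s\<bar>) / norm (zeta s)"
    using Fz_bound_right by blast
  obtain C2 where C2: "C2 > 0" "\<And>s. -1/2 \<le> Re s \<Longrightarrow> Re s \<le> 1/2 \<Longrightarrow> \<bar>Im s\<bar> \<ge> 1 \<Longrightarrow>
    norm (Fz s) \<le> C2 * exp (- (3/4) * \<bar>Im s\<bar>) / norm (zeta (1 - s))"
    using Fz_bound_left by blast
  obtain C3 where C3: "line_bounded (-1/2) C3" using line_bounded_left by blast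
  \<comment> \<open>Dominates x^(Re s / 2) between the two lines: the second term serves x >= 1, the
    first one x < 1.\<close>
  define X where "X = x powr (-1/4) + x powr (b / 2)"
  have F: "norm (Fz s) \<le> (C1 + C2) * exp (- (1/2) * T k)" if s: "-1/2 \<le> Re s" "Re s \<le> b" "\<bar>Im s\<bar> = T k" for s k
  proof -
    have e: "D * exp (- (3/4) * T k) / norm (zeta z) \<le> (C1 + C2) * exp (- (1/2) * T k)"
      if z: "\<bar>Im z\<bar> = T k" "Re z \<ge> 1/2" and D: "0 < D" "D \<le> C1 + C2" for z D
    proof -
      have l: "norm (zeta z) \<ge> exp (- T k / 4)" by (rule low[OF z])
      have "D * exp (- (3/4) * T k) / norm (zeta z) \<le> D * exp (- (3/4) * T k) / exp (- T k / 4)"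
        using l D by (intro divide_left_mono mult_pos_pos less_le_trans[OF _ l]) auto
      also have "\<dots> = D * exp (- (1/2) * T k)" by (simp add: field_simps flip: exp_add)
      also have "\<dots> \<le> (C1 + C2) * exp (- (1/2) * T k)" using D by (intro mult_right_mono) auto
      finally show ?thesis .
    qed
    show ?thesis
    proof (cases "Re s \<ge> 1/2")
      case True
      have "norm (Fz s) \<le> C1 * exp (- (3/4) * T k) / norm (zeta s)" using C1(2)[of s] s b by simp
      then show ?thesis using e[of s C1] s True C1 C2 by linarith
    next
      case False
      have "norm (Fz s) \<le> C2 * exp (- (3/4) * T k) / norm (zeta (1 - s))" using C2(2)[of s] s T(2)[of k] False by simp
      then show ?thesis using e[of "1 - s" C2] s False C1 C2 by simp
    qed
  qed
  have Xle: "x powr (\<sigma> / 2) \<le> X" if "-1/2 \<le> \<sigma>" "\<sigma> \<le> b" for \<sigma>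
  proof (cases "x \<ge> 1")
    case True
    then have "x powr (\<sigma> / 2) \<le> x powr (b / 2)" using that by (intro powr_mono) auto
    then show ?thesis by (simp add: X_def add_increasing)
  next
    case False
    then have "x powr (\<sigma> / 2) \<le> x powr (-1/4)" using that x by (intro powr_mono') auto
    then show ?thesis by (simp add: X_def add_increasing2)
  qed
  have "(\<lambda>k. \<Sum>p | p \<in> nontrivial_zeros \<and> \<bar>Im p\<bar> \<le> T k. residue (zeta_kernel x) p) \<longlonglongrightarrow>
    ((\<integral>t. zeta_kernel x (Complex b t) \<partial>lborel) - (\<integral>t. zeta_kernel x (Complex (-1/2) t) \<partial>lborel)) / (2 * pi)"
  proof (rule residue_sum_tendsto_vertical_integrals[where \<alpha> = "-1" and \<beta> = 2 and h = "\<lambda>k. (C1 + C2) * exp (- (1/2) * T k) * X"])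
    show "zeta_kernel x holomorphic_on {s. -1 < Re s \<and> Re s < 2} - nontrivial_zeros"
      unfolding zeta_kernel_def[abs_def] using x by (intro holomorphic_intros Fz_holomorphic) auto
    show "finite {p \<in> nontrivial_zeros. \<bar>Im p\<bar> \<le> R}" for R by (rule finite_nontrivial_zeros)
    show "-1/2 < Re p \<and> Re p < b" if "p \<in> nontrivial_zeros" for p
      using nontrivial_zero_strip(1)[OF that] b(3)[OF that] by simp
    \<comment> \<open>The lower bound itself excludes zeros at these heights with Re p >= 1/2;
      reflection excludes the others.\<close>
    show "\<bar>Im p\<bar> \<noteq> T k" if p: "p \<in> nontrivial_zeros" for k p
    proof
      assume Tk: "\<bar>Im p\<bar> = T k"
      have *: "False" if "q \<in> nontrivial_zeros" "Re q \<ge> 1/2" "\<bar>Im q\<bar> = T k" for q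
        using low[OF that(3,2)] nontrivial_zero_strip(3)[OF that(1)] by (simp add: not_le[symmetric])
      show False
      proof (cases "Re p \<ge> 1/2")
        case False
        then show False using *[of "1 - p"] nontrivial_zero_reflect[OF p] Tk by simp
      qed (use * p Tk in blast)
    qed
    show "norm (zeta_kernel x s) \<le> (C1 + C2) * exp (- (1/2) * T k) * X"
      if "-1/2 \<le> Re s" "Re s \<le> b" "\<bar>Im s\<bar> = T k" for k s
      unfolding norm_zeta_kernel[OF x] using F[OF that] Xle[OF that(1,2)] C1 C2 by (intro mult_mono) auto
    have "filterlim (\<lambda>k. - (1/2) * T k) at_bot sequentially"
      using T(1) by (subst filterlim_tendsto_neg_mult_at_bot_iff[OF tendsto_const]) auto
    then have "(\<lambda>k. exp (- (1/2) * T k)) \<longlonglongrightarrow> 0" by (rule filterlim_compose[OF exp_at_bot])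
    then have "(\<lambda>k. (C1 + C2) * exp (- (1/2) * T k) * X) \<longlonglongrightarrow> (C1 + C2) * 0 * X" by (intro tendsto_intros)
    then show "(\<lambda>k. (C1 + C2) * exp (- (1/2) * T k) * X) \<longlonglongrightarrow> 0" by simp
  qed (use b x T zeta_kernel_line_integrable[OF C3 x] zeta_kernel_line_integrable[OF b(4) x] in auto)
  moreover have "(\<Sum>p | p \<in> nontrivial_zeros \<and> \<bar>Im p\<bar> \<le> T k. residue (zeta_kernel x) p) = zero_sum_upto (T k) x" for k
    unfolding zero_sum_upto_def by (intro sum.cong) (auto simp: residue_zeta_kernel[OF simple _ x])
  ultimately show ?thesis by (simp add: line_integral_def)
qed

subsection \<open>From growth to zero-free regions\<close>

lemma complex_power_tail_integral:
  fixes a :: complex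
  assumes a: "Re a < -1" and x0: "x0 \<ge> (1::real)"
  shows "(\<integral>x. indicat_real {x0..} x *\<^sub>R exp (a * of_real (ln x)) \<partial>lborel) = - exp ((a + 1) * of_real (ln x0)) / (a + 1)"
    "integrable lborel (\<lambda>x. indicat_real {x0..} x *\<^sub>R exp (a * of_real (ln x)))"
proof -
  have a1: "a + 1 \<noteq> 0" using a by (auto simp: complex_eq_iff)
  show int: "integrable lborel (\<lambda>x. indicat_real {x0..} x *\<^sub>R exp (a * of_real (ln x)))"
  proof (rule Bochner_Integration.integrable_bound[OF powr_tail(1)[of "- Re a", unfolded set_integrable_def]])
    show "(\<lambda>x. indicat_real {x0..} x *\<^sub>R exp (a * of_real (ln x))) \<in> borel_measurable lborel" by measurable
    show "AE x in lborel. norm (indicat_real {x0..} x *\<^sub>R exp (a * of_real (ln x))) \<le> norm (indicat_real {1..} x *\<^sub>R x powr (- (- Re a)))"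
      using x0 by (intro AE_I2) (auto simp: indicator_def powr_def)
  qed (use a in simp)
  define \<Phi> where "\<Phi> x = exp ((a + 1) * of_real (ln x)) / (a + 1)" for x :: real
  have fin: "integral {x0..x0 + real k} (\<lambda>x. exp (a * of_real (ln x))) = \<Phi> (x0 + real k) - \<Phi> x0" for k
  proof (rule integral_unique, rule fundamental_theorem_of_calculus)
    fix x assume "x \<in> {x0..x0 + real k}"
    then have x: "x > 0" using x0 by auto
    have "((\<lambda>x. complex_of_real (ln x)) has_vector_derivative of_real (1 / x)) (at x within {x0..x0 + real k})"
      using x by (intro has_vector_derivative_of_real) (auto intro!: derivative_eq_intros)
    then have "((\<lambda>x. (a + 1) * of_real (ln x)) has_vector_derivative (a + 1) * of_real (1 / x)) (at x within {x0..x0 + real k})"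
      by (rule has_vector_derivative_mult_right)
    then have "(exp \<circ> (\<lambda>x. (a + 1) * of_real (ln x)) has_vector_derivative ((a + 1) * of_real (1 / x)) * exp ((a + 1) * of_real (ln x))) (at x within {x0..x0 + real k})"
      by (rule field_vector_diff_chain_within) (auto intro!: derivative_eq_intros)
    then have "((\<lambda>x. exp ((a + 1) * of_real (ln x)) / (a + 1)) has_vector_derivative ((a + 1) * of_real (1 / x)) * exp ((a + 1) * of_real (ln x)) / (a + 1)) (at x within {x0..x0 + real k})"
      unfolding o_def by (rule has_vector_derivative_divide)
    moreover have "((a + 1) * of_real (1 / x)) * exp ((a + 1) * of_real (ln x)) / (a + 1) = exp (a * of_real (ln x))"
    proof -
      have "exp (complex_of_real (ln x)) = of_real x" using x by (simp add: exp_of_real)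
      then have e: "exp ((a + 1) * of_real (ln x)) = exp (a * of_real (ln x)) * of_real x"
        by (simp only: distrib_right exp_add mult_1_left)
      show ?thesis unfolding e using a1 x by simp
    qed
    ultimately show "(\<Phi> has_vector_derivative exp (a * of_real (ln x))) (at x within {x0..x0 + real k})"
      unfolding \<Phi>_def by simp
  qed (use x0 in simp)
  have L1: "(\<lambda>k. \<Phi> (x0 + real k) - \<Phi> x0) \<longlonglongrightarrow> (\<integral>x. indicat_real {x0..} x *\<^sub>R exp (a * of_real (ln x)) \<partial>lborel)"
    using integral_tail_tendsto[OF int] x0 by (simp add: fin)
  have "(\<lambda>k. \<Phi> (x0 + real k)) \<longlonglongrightarrow> 0"
  proof (rule tendsto_norm_zero_cancel)
    have "norm (\<Phi> (x0 + real k)) = exp ((Re a + 1) * ln (x0 + real k)) / norm (a + 1)" for k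
      by (simp add: \<Phi>_def norm_divide)
    moreover have "(\<lambda>k. exp ((Re a + 1) * ln (x0 + real k)) / norm (a + 1)) \<longlonglongrightarrow> 0 / norm (a + 1)"
    proof (intro tendsto_divide tendsto_const)
      have neg: "Re a + 1 < 0" using a by simp
      show "(\<lambda>k. exp ((Re a + 1) * ln (x0 + real k))) \<longlonglongrightarrow> 0" using neg by real_asymp
    qed (use a1 in simp)
    ultimately show "(\<lambda>k. norm (\<Phi> (x0 + real k))) \<longlonglongrightarrow> 0" by simp
  qed
  then have "(\<lambda>k. \<Phi> (x0 + real k) - \<Phi> x0) \<longlonglongrightarrow> 0 - \<Phi> x0" by (intro tendsto_intros)
  with L1 have "(\<integral>x. indicat_real {x0..} x *\<^sub>R exp (a * of_real (ln x)) \<partial>lborel) = 0 - \<Phi> x0" by (rule LIMSEQ_unique)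
  then show "(\<integral>x. indicat_real {x0..} x *\<^sub>R exp (a * of_real (ln x)) \<partial>lborel) = - exp ((a + 1) * of_real (ln x0)) / (a + 1)"
    by (simp add: \<Phi>_def)
qed

section \<open>Mellin transforms of line integrals and their continuation\<close>

text \<open>The Mellin transform over x >= x0 of a line integral, with the x-integration done first:
  x^(s/2 - w - 1) integrates to x0^(s/2 - w) / (w - s/2). It starts at x0 because the growth bound
  holds only from there on.\<close>

definition mellin_line :: "real \<Rightarrow> real \<Rightarrow> complex \<Rightarrow> complex" where
  "mellin_line x0 c w = (\<integral>t. Fz (Complex c t) * exp ((Complex c t / 2 - w) * of_real (ln x0)) / (w - Complex c t / 2) \<partial>lborel)"

lemma zeta_kernel_exp: "x > 0 \<Longrightarrow> zeta_kernel x s = Fz s * exp (s / 2 * of_real (ln x))"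
  by (simp add: zeta_kernel_def powr_def Ln_of_real)

lemma Fz_line_measurable [measurable]:
  assumes "line_bounded c C"
  shows "(\<lambda>t. Fz (Complex c t)) \<in> borel_measurable borel"
  using assms by (intro borel_measurable_continuous_onI continuous_on_Fz_line) (auto simp: line_bounded_def)

lemma Complex_measurable [measurable]: "(\<lambda>t. Complex c t) \<in> borel_measurable borel"
  unfolding Complex_eq by measurable

text \<open>The indicator restricts to x > 0, where \<open>powr\<close> may be replaced by exp(s/2
  ln x); joint measurability in x and t is then automatic.\<close>

lemma line_integral_measurable:
  assumes c: "line_bounded c C" and x0: "x0 \<ge> (1::real)"
  shows "(\<lambda>x. indicat_real {x0..} x *\<^sub>R line_integral c x) \<in> borel_measurable lborel"
proof -
  note [measurable] = Fz_line_measurable[OF c]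
  have "(\<lambda>x. \<integral>t. indicat_real {x0..} x *\<^sub>R (Fz (Complex c t) * exp (Complex c t / 2 * of_real (ln x))) \<partial>lborel) \<in> borel_measurable lborel"
    by measurable
  also have "(\<lambda>x. \<integral>t. indicat_real {x0..} x *\<^sub>R (Fz (Complex c t) * exp (Complex c t / 2 * of_real (ln x))) \<partial>lborel) = (\<lambda>x. indicat_real {x0..} x *\<^sub>R line_integral c x)"
    using x0 by (intro ext) (auto simp: indicator_def line_integral_def zeta_kernel_exp)
  finally show ?thesis .
qed

lemma mellin_line_integral:
  assumes c: "line_bounded c C" and x0: "x0 \<ge> (1::real)" and w: "Re w > c / 2"
  shows "(\<integral>x. indicat_real {x0..} x *\<^sub>R (line_integral c x * exp (- (w + 1) * of_real (ln x))) \<partial>lborel) = mellin_line x0 c w"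
proof -
  note [measurable] = Fz_line_measurable[OF c]
  define f where "f x t = indicat_real {x0..} x *\<^sub>R (Fz (Complex c t) * exp ((Complex c t / 2 - w - 1) * of_real (ln x)))" for x t
  have C: "C > 0" "\<And>t. norm (Fz (Complex c t)) \<le> C * exp (- (1/2) * \<bar>t\<bar>)" using c by (auto simp: line_bounded_def)
  define g where "g x = indicat_real {x0..} x * x powr (c / 2 - Re w - 1)" for x
  have gint: "integrable lborel g"
  proof (rule Bochner_Integration.integrable_bound[OF powr_tail(1)[of "Re w + 1 - c / 2", unfolded set_integrable_def]])
    show "AE x in lborel. norm (g x) \<le> norm (indicat_real {1..} x *\<^sub>R x powr (- (Re w + 1 - c / 2)))"
      using x0 by (intro AE_I2) (auto simp: indicator_def g_def algebra_simps)
    show "g \<in> borel_measurable lborel" unfolding g_def[abs_def] by measurable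
  qed (use w in simp)
  \<comment> \<open>The norm splits into a function of t and one of x, which makes the Fubini
    hypothesis immediate.\<close>
  have nf: "norm (f x t) = norm (Fz (Complex c t)) * g x" for x t
    using x0 by (auto simp: f_def g_def indicator_def norm_mult powr_def)
  have Fint: "integrable lborel (\<lambda>t. Fz (Complex c t))"
    by (rule Bochner_Integration.integrable_bound[OF integrable_exp_half[of C 1]]) (use C in \<open>auto simp: abs_mult\<close>)
  have "integrable (lborel \<Otimes>\<^sub>M lborel) (case_prod f)"
  proof (rule lborel_pair.Fubini_integrable)
    show "case_prod f \<in> borel_measurable (lborel \<Otimes>\<^sub>M lborel)"
      unfolding f_def[abs_def] by measurable
    have "(\<lambda>x. \<integral>y. norm (case_prod f (x, y)) \<partial>lborel) = (\<lambda>x. (\<integral>t. norm (Fz (Complex c t)) \<partial>lborel) * g x)"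
      by (simp add: nf)
    then show "integrable lborel (\<lambda>x. \<integral>y. norm (case_prod f (x, y)) \<partial>lborel)" using gint by simp
    show "AE x in lborel. integrable lborel (\<lambda>y. case_prod f (x, y))"
    proof (rule AE_I2)
      fix x
      have "integrable lborel (\<lambda>t. norm (Fz (Complex c t)) * g x)" using Fint by simp
      then show "integrable lborel (\<lambda>y. case_prod f (x, y))"
      proof (rule Bochner_Integration.integrable_bound)
        show "(\<lambda>y. case_prod f (x, y)) \<in> borel_measurable lborel" unfolding f_def[abs_def] by simp
        show "AE y in lborel. norm (case_prod f (x, y)) \<le> norm (norm (Fz (Complex c y)) * g x)"
          by (intro AE_I2) (simp only: case_prod_conv nf real_norm_def abs_ge_self)
      qed
    qed
  qed
  from lborel_pair.Fubini_integral[OF this]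
  have F: "(\<integral>x. (\<integral>t. f x t \<partial>lborel) \<partial>lborel) = (\<integral>t. (\<integral>x. f x t \<partial>lborel) \<partial>lborel)" by simp
  have "(\<integral>t. f x t \<partial>lborel) = indicat_real {x0..} x *\<^sub>R (line_integral c x * exp (- (w + 1) * of_real (ln x)))" for x
  proof (cases "x \<ge> x0")
    case True
    then have x: "x > 0" using x0 by simp
    have "f x t = zeta_kernel x (Complex c t) * exp (- (w + 1) * of_real (ln x))" for t
    proof -
      have "exp ((Complex c t / 2 - w - 1) * of_real (ln x)) = exp (Complex c t / 2 * of_real (ln x)) * exp (- (w + 1) * of_real (ln x))"
        by (simp add: algebra_simps flip: exp_add)
      then show ?thesis using True x by (simp add: f_def zeta_kernel_exp)
    qed
    then show ?thesis using True by (simp add: line_integral_def)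
  qed (simp add: f_def)
  moreover have "(\<integral>x. f x t \<partial>lborel) = Fz (Complex c t) * exp ((Complex c t / 2 - w) * of_real (ln x0)) / (w - Complex c t / 2)" for t
  proof -
    have "Re (Complex c t / 2 - w - 1) < -1" using w by simp
    note P = complex_power_tail_integral[OF this x0]
    have "(\<integral>x. f x t \<partial>lborel) = (\<integral>x. Fz (Complex c t) * (indicat_real {x0..} x *\<^sub>R exp ((Complex c t / 2 - w - 1) * of_real (ln x))) \<partial>lborel)"
      unfolding f_def by (intro Bochner_Integration.integral_cong) auto
    also have "\<dots> = Fz (Complex c t) * (- exp ((Complex c t / 2 - w - 1 + 1) * of_real (ln x0)) / (Complex c t / 2 - w - 1 + 1))"
      by (simp only: Bochner_Integration.integral_mult_right_zero P)
    finally have fin: "(\<integral>x. f x t \<partial>lborel) = Fz (Complex c t) * (- exp ((Complex c t / 2 - w - 1 + 1) * of_real (ln x0)) / (Complex c t / 2 - w - 1 + 1))" .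
    define D where "D = w - Complex c t / 2"
    have e: "Complex c t / 2 - w - 1 + 1 = - D" "Complex c t / 2 - w = - D" by (simp_all add: D_def)
    show ?thesis using fin unfolding e D_def[symmetric] by simp
  qed
  ultimately show ?thesis using F by (simp only: mellin_line_def)
qed

text \<open>Between the lines Fz is holomorphic, so the only pole crossed is s = 2w, with residue -2
  Fz(2w) because w - s/2 = -(s - 2w)/2. The range of Re w is what places 2w between 5/4 and
  7/4.\<close>

lemma mellin_line_shift:
  assumes x0: "x0 \<ge> (1::real)" and w: "5/8 < Re w" "Re w < 7/8"
  shows "mellin_line x0 (5/4) w = mellin_line x0 (7/4) w + 4 * pi * Fz (2 * w)"
proof -
  obtain C where C: "C > 0" "\<And>s. 5/4 \<le> Re s \<Longrightarrow> Re s \<le> 7/4 \<Longrightarrow> norm (Fz s) \<le> C * exp (- (1/2) * \<bar>Im s\<bar>)"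
    using Fz_bound_right_strip by blast
  obtain C1 where C1: "line_bounded (5/4) C1" using line_bounded_right[of "5/4"] by auto
  obtain C2 where C2: "line_bounded (7/4) C2" using line_bounded_right[of "7/4"] by auto
  define E where "E s = exp ((s / 2 - w) * of_real (ln x0))" for s
  define G where "G s = Fz s * E s / (w - s / 2)" for s
  define X where "X = exp (2 * ln x0)"
  have Ele: "norm (E s) \<le> X" if "Re s \<le> 7/4" for s
  proof -
    have "Re (s / 2 - w) * ln x0 \<le> 2 * ln x0" using that w x0 by (intro mult_right_mono) auto
    then show ?thesis by (simp add: E_def X_def)
  qed
  have Fhol: "Fz holomorphic_on {s. 1 < Re s \<and> Re s < 2}"
    by (rule holomorphic_on_subset[OF Fz_holomorphic]) (use nontrivial_zero_strip(2) in force)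
  have ne: "w - s / 2 \<noteq> 0" if "s \<noteq> 2 * w" for s using that by auto
  \<comment> \<open>High enough that |w - s/2| >= 1/2 on the horizontal sides.\<close>
  define T where "T k = \<bar>Im (2 * w)\<bar> + 1 + real k" for k
  have D: "norm (w - s / 2) \<ge> d" if "d \<le> \<bar>Re w - Re s / 2\<bar> \<or> d \<le> \<bar>Im w - Im s / 2\<bar>" for s d
    using that abs_Re_le_cmod[of "w - s / 2"] abs_Im_le_cmod[of "w - s / 2"] by auto
  have int: "integrable lborel (\<lambda>t. G (Complex b t))" if b: "b = 5/4 \<or> b = 7/4" for b
  proof -
    obtain C' where C': "line_bounded b C'" using b C1 C2 by blast
    note [measurable] = Fz_line_measurable[OF C']
    define d where "d = \<bar>Re w - b / 2\<bar>"
    have d: "d > 0" using w b by (auto simp: d_def)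
    show ?thesis
    proof (rule Bochner_Integration.integrable_bound[OF integrable_exp_half[of C "X / d"]])
      show "(\<lambda>t. G (Complex b t)) \<in> borel_measurable lborel" unfolding G_def E_def by measurable
      show "AE t in lborel. norm (G (Complex b t)) \<le> norm (C * exp (- (1/2) * \<bar>t\<bar>) * (X / d))"
      proof (rule AE_I2)
        fix t
        have "norm (Fz (Complex b t)) \<le> C * exp (- (1/2) * \<bar>t\<bar>)" using C(2)[of "Complex b t"] b by auto
        moreover have "norm (E (Complex b t)) \<le> X" using b by (intro Ele) auto
        moreover have "norm (w - Complex b t / 2) \<ge> d" by (rule D) (simp add: d_def)
        ultimately have "norm (G (Complex b t)) \<le> C * exp (- (1/2) * \<bar>t\<bar>) * X / d"
          unfolding G_def norm_mult norm_divide using C d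
          by (intro frac_le mult_mono) (auto simp: X_def)
        moreover have "0 \<le> C * exp (- (1/2) * \<bar>t\<bar>) * X / d" using C d by (simp add: X_def)
        ultimately show "norm (G (Complex b t)) \<le> norm (C * exp (- (1/2) * \<bar>t\<bar>) * (X / d))"
          by (simp only: times_divide_eq_right real_norm_def abs_of_nonneg)
      qed
    qed
  qed
  have "(\<lambda>k. \<Sum>p | p \<in> {2 * w} \<and> \<bar>Im p\<bar> \<le> T k. residue G p) \<longlonglongrightarrow>
    ((\<integral>t. G (Complex (7/4) t) \<partial>lborel) - (\<integral>t. G (Complex (5/4) t) \<partial>lborel)) / (2 * pi)"
  proof (rule residue_sum_tendsto_vertical_integrals[where \<alpha> = 1 and \<beta> = 2 and h = "\<lambda>k. C * exp (- (1/2) * T k) * X / (1/2)"])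
    show "G holomorphic_on {s. 1 < Re s \<and> Re s < 2} - {2 * w}"
      unfolding G_def E_def using ne by (intro holomorphic_intros holomorphic_on_subset[OF Fhol]) auto
    show "finite {p \<in> {2 * w}. \<bar>Im p\<bar> \<le> R}" for R by simp
    show "5/4 < Re p \<and> Re p < 7/4" if "p \<in> {2 * w}" for p using that w by simp
    show "filterlim T at_top sequentially" unfolding T_def by real_asymp
    show "\<bar>Im p\<bar> \<noteq> T k" if "p \<in> {2 * w}" for k p using that by (auto simp: T_def)
    show "norm (G s) \<le> C * exp (- (1/2) * T k) * X / (1/2)" if s: "5/4 \<le> Re s" "Re s \<le> 7/4" "\<bar>Im s\<bar> = T k" for k s
    proof -
      have "norm (Fz s) \<le> C * exp (- (1/2) * T k)" using C(2)[OF s(1,2)] s by simp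
      moreover have "norm (E s) \<le> X" using s by (intro Ele) auto
      moreover have "norm (w - s / 2) \<ge> 1/2"
      proof (rule D, rule disjI2)
        have "\<bar>Im s\<bar> \<ge> \<bar>2 * Im w\<bar> + 1" using s by (simp add: T_def)
        then show "1/2 \<le> \<bar>Im w - Im s / 2\<bar>" by linarith
      qed
      ultimately show ?thesis
        unfolding G_def norm_mult norm_divide using C
        by (intro frac_le mult_mono) (auto simp: X_def)
    qed
    have "(\<lambda>k. exp (- (1/2) * T k)) \<longlonglongrightarrow> 0" unfolding T_def by real_asymp
    then have "(\<lambda>k. C * exp (- (1/2) * T k) * X / (1/2)) \<longlonglongrightarrow> C * 0 * X / (1/2)" by (intro tendsto_intros) auto
    then show "(\<lambda>k. C * exp (- (1/2) * T k) * X / (1/2)) \<longlonglongrightarrow> 0" by simp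
  qed (use int in auto)
  moreover have "(\<Sum>p | p \<in> {2 * w} \<and> \<bar>Im p\<bar> \<le> T k. residue G p) = - 2 * Fz (2 * w)" for k
  proof -
    have "{p. p \<in> {2 * w} \<and> \<bar>Im p\<bar> \<le> T k} = {2 * w}" by (auto simp: T_def)
    moreover have "residue G (2 * w) = - 2 * Fz (2 * w)"
    proof -
      have "G = (\<lambda>s. (- 2 * Fz s * E s) / (s - 2 * w))"
      proof
        fix s
        have "w - s / 2 = (s - 2 * w) / (- 2)" by (simp add: field_simps)
        then show "G s = (- 2 * Fz s * E s) / (s - 2 * w)" by (simp only: G_def) simp
      qed
      moreover have "residue (\<lambda>s. (- 2 * Fz s * E s) / (s - 2 * w)) (2 * w) = - 2 * Fz (2 * w) * E (2 * w)"
      proof (rule residue_simple)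
        show "open ({s. 1 < Re s} \<inter> {s. Re s < 2})" by (intro open_Int open_halfspace_Re_gt open_halfspace_Re_lt)
        show "(\<lambda>s. - 2 * Fz s * E s) holomorphic_on {s. 1 < Re s} \<inter> {s. Re s < 2}"
          unfolding E_def by (intro holomorphic_intros holomorphic_on_subset[OF Fhol]) auto
      qed (use w in auto)
      ultimately show ?thesis by (simp add: E_def)
    qed
    ultimately show ?thesis by simp
  qed
  ultimately have "(\<lambda>k::nat. - 2 * Fz (2 * w)) \<longlonglongrightarrow>
    ((\<integral>t. G (Complex (7/4) t) \<partial>lborel) - (\<integral>t. G (Complex (5/4) t) \<partial>lborel)) / (2 * pi)" by simp
  then have "- 2 * Fz (2 * w) = (mellin_line x0 (7/4) w - mellin_line x0 (5/4) w) / (2 * pi)"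
    using LIMSEQ_unique[OF tendsto_const] by (force simp: mellin_line_def G_def E_def)
  then show ?thesis by (simp add: field_simps)
qed

text \<open>The denominator vanishes only on Re w = 7/8. This is the gain from the shift: the
  transform on 5/4 has its singular line at 5/8 instead.\<close>

lemma mellin_line_holomorphic:
  assumes x0: "x0 \<ge> (1::real)"
  shows "mellin_line x0 (7/4) holomorphic_on {w. Re w < 7/8}"
proof -
  obtain C where c: "line_bounded (7/4) C" using line_bounded_right[of "7/4"] by auto
  then have C: "C > 0" "\<And>t. norm (Fz (Complex (7/4) t)) \<le> C * exp (- (1/2) * \<bar>t\<bar>)" by (auto simp: line_bounded_def)
  note [measurable] = Fz_line_measurable[OF c]
  show ?thesis
    unfolding mellin_line_def[abs_def]
  proof (rule holomorphic_on_lebesgue_integral)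
    show "open {w. Re w < 7/8}" by (rule open_halfspace_Re_lt)
    show "(\<lambda>w. Fz (Complex (7/4) t) * exp ((Complex (7/4) t / 2 - w) * of_real (ln x0)) / (w - Complex (7/4) t / 2)) holomorphic_on {w. Re w < 7/8}" for t
      by (intro holomorphic_intros) (auto simp: complex_eq_iff)
    show "(\<lambda>t. Fz (Complex (7/4) t) * exp ((Complex (7/4) t / 2 - w) * of_real (ln x0)) / (w - Complex (7/4) t / 2)) \<in> borel_measurable lborel" for w
      by measurable
    fix w0 assume w0: "w0 \<in> {w. Re w < 7/8}"
    define r where "r = (7/8 - Re w0) / 2"
    have r: "r > 0" using w0 by (simp add: r_def)
    have Rew: "r < 7/8 - Re w" "7/8 - Re w < 3 * r" if "w \<in> ball w0 r" for w
    proof -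
      have "\<bar>Re (w0 - w)\<bar> < r" using that abs_Re_le_cmod[of "w0 - w"] by (simp add: dist_norm)
      then have "\<bar>Re w0 - Re w\<bar> < r" by simp
      then show "r < 7/8 - Re w" "7/8 - Re w < 3 * r" unfolding r_def by argo+
    qed
    show "\<exists>r>0. \<exists>g. ball w0 r \<subseteq> {w. Re w < 7/8} \<and> integrable lborel g \<and>
      (\<forall>w\<in>ball w0 r. \<forall>t\<in>space lborel. norm (Fz (Complex (7/4) t) * exp ((Complex (7/4) t / 2 - w) * of_real (ln x0)) / (w - Complex (7/4) t / 2)) \<le> g t)"
    proof (intro exI[of _ r] exI[of _ "\<lambda>t. C * exp (- (1/2) * \<bar>t\<bar>) * (exp (3 * r * ln x0) / r)"] conjI ballI r integrable_exp_half)
      show "ball w0 r \<subseteq> {w. Re w < 7/8}" using Rew r by force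
      fix w t assume w: "w \<in> ball w0 r"
      have "(7/8 - Re w) * ln x0 \<le> 3 * r * ln x0" using Rew[OF w] x0 by (intro mult_right_mono) auto
      then have e: "norm (exp ((Complex (7/4) t / 2 - w) * of_real (ln x0))) \<le> exp (3 * r * ln x0)" by simp
      have "\<bar>Re (w - Complex (7/4) t / 2)\<bar> \<ge> r" using Rew[OF w] by simp
      then have d: "norm (w - Complex (7/4) t / 2) \<ge> r" using abs_Re_le_cmod[of "w - Complex (7/4) t / 2"] by linarith
      have "norm (Fz (Complex (7/4) t) * exp ((Complex (7/4) t / 2 - w) * of_real (ln x0)) / (w - Complex (7/4) t / 2))
         \<le> C * exp (- (1/2) * \<bar>t\<bar>) * exp (3 * r * ln x0) / r"
        unfolding norm_mult norm_divide using C e d r by (intro frac_le mult_mono) auto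
      then show "norm (Fz (Complex (7/4) t) * exp ((Complex (7/4) t / 2 - w) * of_real (ln x0)) / (w - Complex (7/4) t / 2)) \<le> C * exp (- (1/2) * \<bar>t\<bar>) * (exp (3 * r * ln x0) / r)"
        by simp
    qed
  qed
qed

text \<open>Here the assumed growth enters: the order x^\<beta> makes the transform converge locally
  uniformly for Re w > \<beta>, beyond the half plane Re w > c/2 of the Fubini argument when \<beta>
  < c/2.\<close>

lemma mellin_holomorphic:
  assumes x0: "x0 \<ge> (1::real)" and c: "line_bounded c C"
    and K: "\<And>x. x \<ge> x0 \<Longrightarrow> norm (line_integral c x) \<le> K * x powr \<beta>"
  shows "(\<lambda>w. \<integral>x. indicat_real {x0..} x *\<^sub>R (line_integral c x * exp (- (w + 1) * of_real (ln x))) \<partial>lborel) holomorphic_on {w. Re w > \<beta>}"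
proof (rule holomorphic_on_lebesgue_integral)
  note [measurable] = line_integral_measurable[OF c x0]
  show "open {w. Re w > \<beta>}" by (rule open_halfspace_Re_gt)
  show "(\<lambda>w. indicat_real {x0..} t *\<^sub>R (line_integral c t * exp (- (w + 1) * of_real (ln t)))) holomorphic_on {w. Re w > \<beta>}" for t
    unfolding scaleR_conv_of_real by (intro holomorphic_intros)
  have "(\<lambda>t. indicat_real {x0..} t *\<^sub>R line_integral c t * exp (- (w + 1) * of_real (ln t))) \<in> borel_measurable lborel" for w
    by measurable
  then show "(\<lambda>t. indicat_real {x0..} t *\<^sub>R (line_integral c t * exp (- (w + 1) * of_real (ln t)))) \<in> borel_measurable lborel" for w
    by (simp add: scaleR_conv_of_real mult.assoc)
  fix w0 assume w0: "w0 \<in> {w. Re w > \<beta>}"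
  define r where "r = (Re w0 - \<beta>) / 2"
  have r: "r > 0" using w0 by (simp add: r_def)
  have Rew: "Re w > \<beta> + r" if "w \<in> ball w0 r" for w
  proof -
    have "\<bar>Re (w0 - w)\<bar> < r" using that abs_Re_le_cmod[of "w0 - w"] by (simp add: dist_norm)
    then have "\<bar>Re w0 - Re w\<bar> < r" by simp
    then show "Re w > \<beta> + r" unfolding r_def by argo
  qed
  have K0: "K \<ge> 0"
  proof -
    have "0 \<le> K * x0 powr \<beta>" using K[of x0] norm_ge_zero order_trans by blast
    then show ?thesis using x0 by (simp add: zero_le_mult_iff not_le)
  qed
  show "\<exists>r>0. \<exists>g. ball w0 r \<subseteq> {w. Re w > \<beta>} \<and> integrable lborel g \<and>
      (\<forall>w\<in>ball w0 r. \<forall>t\<in>space lborel. norm (indicat_real {x0..} t *\<^sub>R (line_integral c t * exp (- (w + 1) * of_real (ln t)))) \<le> g t)"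
  proof (intro exI[of _ r] exI[of _ "\<lambda>t. K * (indicat_real {1..} t *\<^sub>R t powr (- (r + 1)))"] conjI ballI r)
    show "ball w0 r \<subseteq> {w. Re w > \<beta>}" using Rew r by force
    show "integrable lborel (\<lambda>t. K * (indicat_real {1..} t *\<^sub>R t powr (- (r + 1))))"
      using powr_tail(1)[of "r + 1"] r by (simp add: set_integrable_def)
    fix w t assume w: "w \<in> ball w0 r"
    show "norm (indicat_real {x0..} t *\<^sub>R (line_integral c t * exp (- (w + 1) * of_real (ln t)))) \<le> K * (indicat_real {1..} t *\<^sub>R t powr (- (r + 1)))"
    proof (cases "t \<ge> x0")
      case True
      then have t: "t \<ge> 1" using x0 by simp
      have "norm (exp (- (w + 1) * of_real (ln t))) = t powr (- (Re w + 1))" using t by (simp add: powr_def)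
      then have "norm (line_integral c t * exp (- (w + 1) * of_real (ln t))) \<le> (K * t powr \<beta>) * t powr (- (Re w + 1))"
        unfolding norm_mult using K[OF True] by (metis mult_right_mono powr_ge_zero)
      also have "\<dots> = K * t powr (\<beta> - (Re w + 1))" by (simp add: powr_add[symmetric] algebra_simps flip: powr_add)
      also have "\<dots> \<le> K * t powr (- (r + 1))" using Rew[OF w] t K0 by (intro mult_left_mono powr_mono) auto
      finally show ?thesis using True t by simp
    next
      case False
      then show ?thesis using K0 by (auto simp: indicator_def)
    qed
  qed
qed

text \<open>Q continues Fz(2w) to the left of Re w = 5/8. The relation is kept in the multiplied
  form zeta(2w) Q(w) = Gamma(1 - w), which remains meaningful at zeros of zeta; a zero beyond
  2\<beta> would force Gamma to vanish.\<close>

lemma zeros_bounded_by_growth: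
  assumes x0: "x0 \<ge> (1::real)" and \<beta>: "1/4 < \<beta>" "\<beta> < 5/8"
    and K: "\<And>x. x \<ge> x0 \<Longrightarrow> norm (line_integral (5/4) x) \<le> K * x powr \<beta>"
    and \<rho>: "\<rho> \<in> nontrivial_zeros"
  shows "Re \<rho> \<le> 2 * \<beta>"
proof (rule ccontr)
  assume "\<not> Re \<rho> \<le> 2 * \<beta>"
  note r = nontrivial_zero_strip[OF \<rho>]
  obtain C where c: "line_bounded (5/4) C" using line_bounded_right[of "5/4"] by auto
  define M where "M w = (\<integral>x. indicat_real {x0..} x *\<^sub>R (line_integral (5/4) x * exp (- (w + 1) * of_real (ln x))) \<partial>lborel)" for w
  define Q where "Q w = (M w - mellin_line x0 (7/4) w) / (4 * pi)" for w
  \<comment> \<open>The point 1/2 is removed because 2w is then the pole of zeta.\<close>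
  define S where "S = {w. \<beta> < Re w} \<inter> {w. Re w < 7/8} - {1/2::complex}"
  have Mh: "M holomorphic_on {w. Re w > \<beta>}" unfolding M_def by (rule mellin_holomorphic[OF x0 c K])
  have Qh: "Q holomorphic_on {w. \<beta> < Re w} \<inter> {w. Re w < 7/8}"
    unfolding Q_def by (intro holomorphic_intros holomorphic_on_subset[OF Mh] holomorphic_on_subset[OF mellin_line_holomorphic[OF x0]]) auto
  have eq: "zeta (2 * w) * Q w = Gamma (1 - w)" if "w \<in> S" for w
  proof (rule analytic_continuation_open[of "{w. 5/8 < Re w} \<inter> {w. Re w < 7/8}" S "\<lambda>w. zeta (2 * w) * Q w" "\<lambda>w. Gamma (1 - w)"])
    show "open ({w. 5/8 < Re w} \<inter> {w. Re w < 7/8})" "open S"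
      unfolding S_def by (intro open_Int open_halfspace_Re_gt open_halfspace_Re_lt open_delete)+
    have "complex_of_real (3/4) \<in> {w. 5/8 < Re w} \<inter> {w. Re w < 7/8}" by simp
    then show "{w. 5/8 < Re w} \<inter> {w. Re w < 7/8} \<noteq> {}" by blast
    show "connected S" unfolding S_def
      by (intro connected_open_delete open_Int open_halfspace_Re_gt open_halfspace_Re_lt convex_connected convex_Int convex_halfspace_Re_gt convex_halfspace_Re_lt) simp
    show "{w. 5/8 < Re w} \<inter> {w. Re w < 7/8} \<subseteq> S" using \<beta> by (auto simp: S_def)
    have "(zeta \<circ> (\<lambda>w. 2 * w)) holomorphic_on S"
      by (rule holomorphic_on_compose_gen[OF _ zeta_holomorphic]) (auto simp: S_def complex_eq_iff intro!: holomorphic_intros)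
    then show "(\<lambda>w. zeta (2 * w) * Q w) holomorphic_on S"
      by (auto simp: o_def S_def intro!: holomorphic_intros holomorphic_on_subset[OF Qh])
    have "1 - z \<notin> \<int>\<^sub>\<le>\<^sub>0" if "z \<in> S" for z
      using that by (auto simp: S_def complex_eq_iff elim!: nonpos_Ints_cases)
    then show "(\<lambda>w. Gamma (1 - w)) holomorphic_on S" by (intro holomorphic_intros) auto
    fix z assume "z \<in> {w. 5/8 < Re w} \<inter> {w. Re w < 7/8}"
    then have z: "5/8 < Re z" "Re z < 7/8" by auto
    have "M z = mellin_line x0 (5/4) z" unfolding M_def by (rule mellin_line_integral[OF c x0]) (use z in simp)
    then have "Q z = Fz (2 * z)" using mellin_line_shift[OF x0 z] by (simp add: Q_def)
    moreover have "zeta (2 * z) \<noteq> 0" using z by (intro zeta_nonzero_right) simp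
    ultimately show "zeta (2 * z) * Q z = Gamma (1 - z)" by (simp add: Fz_def)
  qed (rule that)
  have "\<rho> / 2 \<in> S" using \<open>\<not> Re \<rho> \<le> 2 * \<beta>\<close> r by (auto simp: S_def field_simps)
  from eq[OF this] have "Gamma (1 - \<rho> / 2) = 0" using r by simp
  moreover have "1 - \<rho> / 2 \<notin> \<int>\<^sub>\<le>\<^sub>0" using r by (auto elim!: nonpos_Ints_cases simp: complex_eq_iff)
  ultimately show False by (simp add: Gamma_eq_zero_iff)
qed

subsection \<open>The cosine series and the equivalence\<close>

lemma abs_moebius_le_1: "\<bar>moebius n\<bar> \<le> 1"
  by (simp add: moebius_def power_abs)

text \<open>No convergence of \<open>\<Sum> \<mu>(n)/n\<close> is needed: if that series diverged, every value of
  \<^const>\<open>cos_series\<close> would be the same junk number.\<close>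

lemma cos_series_linear_bound:
  obtains A D where "A \<ge> 0" "D \<ge> 0" "\<And>t. t \<ge> 0 \<Longrightarrow> \<bar>cos_series t\<bar> \<le> A + D * t"
proof -
  define m where "m n = moebius (Suc n) / real (Suc n)" for n
  \<comment> \<open>Subtracting the value at t = 0 leaves terms of order t / n^2, which converge
    absolutely and grow linearly in t.\<close>
  define d where "d t n = m n * (cos (sqrt t / real (Suc n)) - 1)" for t n
  define q where "q n = 1 / real (Suc n) ^ 2" for n
  have q: "summable q" unfolding q_def using inverse_power_summable[of 2, where 'a = real]
    by (subst summable_Suc_iff[of "\<lambda>n. 1 / real n ^ 2"]) (simp add: inverse_eq_divide)
  have dq: "\<bar>d t n\<bar> \<le> t / 2 * q n" if "t \<ge> 0" for t n
  proof -
    have "\<bar>m n\<bar> \<le> 1"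
      using abs_moebius_le_1[of "Suc n"] by (simp add: m_def divide_le_eq)
    moreover have "\<bar>cos y - 1\<bar> \<le> y\<^sup>2 / 2" for y :: real
    proof -
      have "\<bar>sin (y / 2)\<bar> \<le> \<bar>y / 2\<bar>" by (rule abs_sin_x_le_abs_x)
      then have "(sin (y / 2))\<^sup>2 \<le> (y / 2)\<^sup>2" by (subst (asm) abs_le_square_iff)
      moreover have "cos y = 1 - 2 * (sin (y / 2))\<^sup>2" using cos_double_sin[of "y / 2"] by simp
      ultimately show ?thesis by (simp add: power_divide)
    qed
    from this[of "sqrt t / real (Suc n)"] have "\<bar>cos (sqrt t / real (Suc n)) - 1\<bar> \<le> t / 2 * q n"
      using that by (simp add: power_divide q_def)
    ultimately have "\<bar>m n\<bar> * \<bar>cos (sqrt t / real (Suc n)) - 1\<bar> \<le> 1 * (t / 2 * q n)"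
      by (intro mult_mono) auto
    then show ?thesis by (simp add: d_def abs_mult)
  qed
  have ds: "summable (d t)" "\<bar>suminf (d t)\<bar> \<le> t / 2 * suminf q" if "t \<ge> 0" for t
  proof -
    have qs: "summable (\<lambda>n. t / 2 * q n)" using q by (rule summable_mult)
    have "summable (\<lambda>n. \<bar>d t n\<bar>)"
      by (rule summable_comparison_test'[OF qs, of 0]) (use dq[OF that] in auto)
    then show "summable (d t)" by (rule summable_rabs_cancel)
    have "\<bar>suminf (d t)\<bar> \<le> (\<Sum>n. \<bar>d t n\<bar>)" by (rule summable_rabs) fact
    also have "\<dots> \<le> (\<Sum>n. t / 2 * q n)" using dq[OF that] qs \<open>summable (\<lambda>n. \<bar>d t n\<bar>)\<close> by (intro suminf_le) auto
    also have "\<dots> = t / 2 * suminf q" using q by (rule suminf_mult)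
    finally show "\<bar>suminf (d t)\<bar> \<le> t / 2 * suminf q" .
  qed
  have cs: "cos_series t = (\<Sum>n. m n + d t n)" for t
    unfolding cos_series_def by (intro suminf_cong) (simp add: d_def m_def algebra_simps)
  have q0: "suminf q \<ge> 0" using q by (intro suminf_nonneg) (auto simp: q_def)
  show ?thesis
  proof (cases "summable m")
    case True
    show ?thesis
    proof (rule that[of "\<bar>suminf m\<bar>" "suminf q / 2"])
      fix t :: real assume t: "t \<ge> 0"
      have "cos_series t = suminf m + suminf (d t)"
        unfolding cs by (rule suminf_add[symmetric, OF True ds(1)[OF t]])
      then show "\<bar>cos_series t\<bar> \<le> \<bar>suminf m\<bar> + suminf q / 2 * t" using ds(2)[OF t] by (simp add: mult.commute)
    qed (use q0 in auto)
  next
    case False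
    show ?thesis
    proof (rule that[of "\<bar>THE s::real. False\<bar>" 0])
      fix t :: real assume t: "t \<ge> 0"
      have "\<not> summable (\<lambda>n. m n + d t n)"
      proof
        assume "summable (\<lambda>n. m n + d t n)"
        from summable_diff[OF this ds(1)[OF t]] show False using False by simp
      qed
      then have no: "(sums) (\<lambda>n. m n + d t n) = (\<lambda>s. False)" by (auto simp: summable_def)
      have "cos_series t = (THE s. False)" unfolding cs suminf_def by (simp only: no)
      then show "\<bar>cos_series t\<bar> \<le> \<bar>THE s::real. False\<bar> + 0 * t" by simp
    qed auto
  qed
qed

text \<open>Linear growth A + D t turns into a bound of order A + D/a after multiplication by a = x
  / (2 pi)^2, and a is bounded below for x >= 1.\<close>

lemma cos_series_laplace_bounded:
  obtains K where "K \<ge> 0" "\<And>x. x \<ge> 1 \<Longrightarrow> \<bar>x / (2 * pi)\<^sup>2 * (LBINT t:{0..}. exp (- x * t / (2 * pi)\<^sup>2) * cos_series t)\<bar> \<le> K"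
proof -
  obtain A D where AD: "A \<ge> 0" "D \<ge> 0" "\<And>t. t \<ge> 0 \<Longrightarrow> \<bar>cos_series t\<bar> \<le> A + D * t"
    using cos_series_linear_bound by blast
  show ?thesis
  proof (rule that[of "2 * A + 4 * D * (2 * pi)\<^sup>2"])
    fix x :: real assume x: "x \<ge> 1"
    define a where "a = x / (2 * pi)\<^sup>2"
    have a: "a > 0" using x by (simp add: a_def)
    define J where "J = (LBINT t:{0..}. exp (- x * t / (2 * pi)\<^sup>2) * cos_series t)"
    have hi: "((\<lambda>t. exp (- (a / 2) * t)) has_integral exp (- (a / 2) * 0) / (a / 2)) {0..}"
      by (rule has_integral_exp_minus_to_infinity) (use a in simp)
    have si: "set_integrable lborel {0..} (\<lambda>t. exp (- (a / 2) * t))"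
      using integrable_exp_minus_abs[of "a / 2"] a unfolding set_integrable_def
      by (intro Bochner_Integration.integrable_bound[OF integrable_exp_minus_abs[of "a / 2"]]) (auto simp: indicator_def)
    have val: "(\<integral>t. indicat_real {0..} t *\<^sub>R exp (- (a / 2) * t) \<partial>lborel) = 2 / a"
      using set_borel_integral_eq_integral(2)[OF si] integral_unique[OF hi] by (simp add: set_lebesgue_integral_def)
    have pt: "norm (indicat_real {0..} t *\<^sub>R (exp (- x * t / (2 * pi)\<^sup>2) * cos_series t)) \<le> (A + 2 * D / a) * (indicat_real {0..} t *\<^sub>R exp (- (a / 2) * t))" for t
    proof (cases "t \<ge> 0")
      case True
      \<comment> \<open>One half of the exponential absorbs the linear factor, the other half
        remains as the integrable majorant.\<close>
      have e: "exp (- x * t / (2 * pi)\<^sup>2) = exp (- (a / 2) * t) * exp (- (a / 2) * t)"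
        by (simp add: a_def flip: exp_add)
      have "a / 2 * t \<le> exp (a / 2 * t)" using exp_ge_add_one_self[of "a / 2 * t"] by linarith
      then have "a / 2 * t * exp (- (a / 2) * t) \<le> exp (a / 2 * t) * exp (- (a / 2) * t)" by (rule mult_right_mono) simp
      also have "\<dots> = 1" by (simp flip: exp_add)
      finally have "a / 2 * t * exp (- (a / 2) * t) \<le> 1" .
      moreover have "t * E \<le> 2 / a" if "a / 2 * t * E \<le> 1" for E :: real
        using that a by (simp add: field_simps)
      ultimately have "t * exp (- (a / 2) * t) \<le> 2 / a" by blast
      then have "D * (t * exp (- (a / 2) * t)) \<le> D * (2 / a)" using AD by (intro mult_left_mono) auto
      moreover have "A * exp (- (a / 2) * t) \<le> A * 1" using AD True a by (intro mult_left_mono) auto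
      ultimately have le: "(A + D * t) * exp (- (a / 2) * t) \<le> A + 2 * D / a" by (simp add: algebra_simps)
      have "\<bar>exp (- x * t / (2 * pi)\<^sup>2) * cos_series t\<bar> = exp (- (a / 2) * t) * (\<bar>cos_series t\<bar> * exp (- (a / 2) * t))"
        unfolding e by (simp add: abs_mult)
      also have "\<dots> \<le> exp (- (a / 2) * t) * ((A + D * t) * exp (- (a / 2) * t))"
        using AD(3)[OF True] by (intro mult_left_mono mult_right_mono) auto
      also have "\<dots> \<le> exp (- (a / 2) * t) * (A + 2 * D / a)" using le by (intro mult_left_mono) auto
      finally show ?thesis using True by (simp add: mult.commute)
    qed simp
    have "norm J \<le> (\<integral>t. (A + 2 * D / a) * (indicat_real {0..} t *\<^sub>R exp (- (a / 2) * t)) \<partial>lborel)"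
      unfolding J_def set_lebesgue_integral_def
      by (rule norm_lebesgue_integral_le[OF _ pt]) (use si in \<open>simp add: set_integrable_def\<close>)
    also have "\<dots> = (A + 2 * D / a) * (2 / a)" using val by simp
    finally have "a * \<bar>J\<bar> \<le> a * ((A + 2 * D / a) * (2 / a))" using a by (intro mult_left_mono) auto
    also have "\<dots> = 2 * A + 4 * D / a" using a by (simp add: field_simps)
    also have "4 * D / a \<le> 4 * D * (2 * pi)\<^sup>2"
    proof -
      have "1 / a \<le> (2 * pi)\<^sup>2" using x by (simp add: a_def divide_le_eq)
      then have "4 * D * (1 / a) \<le> 4 * D * (2 * pi)\<^sup>2" using AD by (intro mult_left_mono) auto
      then show ?thesis by simp
    qed
    finally show "\<bar>x / (2 * pi)\<^sup>2 * (LBINT t:{0..}. exp (- x * t / (2 * pi)\<^sup>2) * cos_series t)\<bar> \<le> 2 * A + 4 * D * (2 * pi)\<^sup>2"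
      using a x by (simp add: J_def a_def abs_mult)
  qed (use AD in auto)
qed

lemma line_integral_growth:
  assumes "line_bounded b C"
  obtains K where "K \<ge> 0" "\<And>x. x > 0 \<Longrightarrow> norm (line_integral b x) \<le> K * x powr (b / 2)"
proof (rule that)
  show "0 \<le> (\<integral>t. C * exp (- (1/2) * \<bar>t\<bar>) \<partial>lborel)"
    using assms by (intro Bochner_Integration.integral_nonneg) (auto simp: line_bounded_def)
qed (use norm_line_integral[OF assms] in auto)

text \<open>The heights are fixed before either direction and do not depend on x or on the Riemann
  hypothesis, so one sequence serves both implications.\<close>

theorem theorem2p1:
  assumes simple_zeros: "\<forall>\<rho>\<in>nontrivial_zeros. zorder zeta \<rho> = 1"
  shows "\<exists>T. admissible_heights T
           \<and> (riemann_hypothesis \<longleftrightarrow>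
                (\<forall>\<epsilon>>0. S_along T \<in> O[at_top](\<lambda>x. of_real (x powr (1 / 4 + \<epsilon>)))))"
proof -
  obtain T :: "nat \<Rightarrow> real" where T: "strict_mono T" "filterlim T at_top sequentially" "\<And>k. T k \<ge> 1"
    "\<And>k s. \<bar>Im s\<bar> = T k \<Longrightarrow> Re s \<ge> 1/2 \<Longrightarrow> norm (zeta s) \<ge> exp (- T k / 4)"
    using zeta_good_heights[OF simple_zeros] by blast
  have Tlim: "(\<lambda>k. zero_sum_upto (T k) x) \<longlonglongrightarrow> (line_integral b x - line_integral (-1/2) x) / (2 * pi)"
    if b: "1/2 < b" "b \<le> 7/4" "\<And>\<rho>. \<rho> \<in> nontrivial_zeros \<Longrightarrow> Re \<rho> < b" "line_bounded b C" "x > 0" for b C x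
  proof (rule zero_sum_tendsto)
    show "exp (- T k / 4) \<le> norm (zeta s)" if "\<bar>Im s\<bar> = T k" "Re s \<ge> 1/2" for k s
      by (rule T(4)[OF that])
    show "Re \<rho> < b" if "\<rho> \<in> nontrivial_zeros" for \<rho> by (rule b(3)[OF that])
  qed (use simple_zeros T b in auto)
  obtain C where C: "line_bounded (5/4) C" using line_bounded_right[of "5/4"] by auto
  have lt54: "Re \<rho> < 5/4" if "\<rho> \<in> nontrivial_zeros" for \<rho> using nontrivial_zero_strip(2)[OF that] by simp
  \<comment> \<open>Unconditional, as all zeros have Re \<rho> <= 1: it gives admissibility of T
    and, in the converse direction, recovers the line integral from \<open>S_along\<close>.\<close>
  have lim54: "(\<lambda>k. zero_sum_upto (T k) x) \<longlonglongrightarrow> (line_integral (5/4) x - line_integral (-1/2) x) / (2 * pi)" if "x > 0" for x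
    by (rule Tlim) (use lt54 C that in auto)
  have adm: "admissible_heights T"
    unfolding admissible_heights_def using T(1,2) convergentI[OF lim54] by blast
  define I where "I x = x / (2 * pi)\<^sup>2 * (LBINT t:{0..}. exp (- x * t / (2 * pi)\<^sup>2) * cos_series t)" for x
  have S: "S_along T x = Z - of_real (I x)" if "(\<lambda>k. zero_sum_upto (T k) x) \<longlonglongrightarrow> Z" for x Z
    unfolding S_along_def I_def using limI[OF that] by simp
  obtain K3 where K3: "K3 \<ge> 0" "\<And>x. x \<ge> 1 \<Longrightarrow> \<bar>I x\<bar> \<le> K3"
    using cos_series_laplace_bounded unfolding I_def by blast
  obtain Ca where "line_bounded (-1/2) Ca" using line_bounded_left by blast
  then obtain K2 where K2: "K2 \<ge> 0" "\<And>x. x > 0 \<Longrightarrow> norm (line_integral (-1/2) x) \<le> K2 * x powr (-1/2 / 2)"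
    using line_integral_growth by blast
  have K2': "norm (line_integral (-1/2) x) \<le> K2 * x powr \<beta>" if "x \<ge> 1" "\<beta> > 0" for x \<beta>
  proof -
    have "norm (line_integral (-1/2) x) \<le> K2 * x powr (-1/2 / 2)" using K2(2)[of x] that by simp
    also have "\<dots> \<le> K2 * x powr \<beta>" using K2(1) that by (intro mult_left_mono powr_mono) auto
    finally show ?thesis .
  qed
  have K3': "\<bar>I x\<bar> \<le> K3 * x powr \<beta>" if "x \<ge> 1" "\<beta> > 0" for x \<beta>
  proof -
    have "x powr 0 \<le> x powr \<beta>" using that by (intro powr_mono) auto
    then have "K3 * 1 \<le> K3 * x powr \<beta>" using that K3(1) by (intro mult_left_mono) auto
    then show ?thesis using K3(2)[OF that(1)] by simp
  qed
  have pi2: "2 * pi > 1" using pi_gt3 by simp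
  have "riemann_hypothesis \<longleftrightarrow> (\<forall>\<epsilon>>0. S_along T \<in> O[at_top](\<lambda>x. of_real (x powr (1 / 4 + \<epsilon>))))"
  proof (intro iffI allI impI)
    fix \<epsilon> :: real assume RH: "riemann_hypothesis" and \<epsilon>: "\<epsilon> > 0"
    \<comment> \<open>The cap 1/4 keeps b <= 1, while b/2 <= 1/4 + \<epsilon> gives the required
      exponent.\<close>
    define b where "b = 1/2 + 2 * min \<epsilon> (1/4)"
    have b: "1/2 < b" "b \<le> 1" "b / 2 \<le> 1/4 + \<epsilon>" using \<epsilon> by (auto simp: b_def)
    obtain Cb where Cb: "line_bounded b Cb" using line_bounded_under_RH[OF RH b(1,2)] by blast
    then obtain K1 where K1: "K1 \<ge> 0" "\<And>x. x > 0 \<Longrightarrow> norm (line_integral b x) \<le> K1 * x powr (b / 2)"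
      using line_integral_growth by blast
    have ltb: "Re \<rho> < b" if "\<rho> \<in> nontrivial_zeros" for \<rho> using RH that b by (auto simp: riemann_hypothesis_def)
    show "S_along T \<in> O[at_top](\<lambda>x. of_real (x powr (1 / 4 + \<epsilon>)))"
    \<comment> \<open>The summand 1 makes the constant strictly positive.\<close>
    proof (rule landau_o.bigI[of "K1 + K2 + K3 + 1"])
      show "\<forall>\<^sub>F x in at_top. norm (S_along T x) \<le> (K1 + K2 + K3 + 1) * norm (complex_of_real (x powr (1/4 + \<epsilon>)))"
        using eventually_ge_at_top[of 1]
      proof eventually_elim
        case (elim x)
        define p where "p = x powr (1/4 + \<epsilon>)"
        have p: "p \<ge> 0" by (simp add: p_def)
        have "(\<lambda>k. zero_sum_upto (T k) x) \<longlonglongrightarrow> (line_integral b x - line_integral (-1/2) x) / (2 * pi)"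
          by (rule Tlim) (use ltb Cb b elim in auto)
        then have "S_along T x = (line_integral b x - line_integral (-1/2) x) / (2 * pi) - of_real (I x)" by (rule S)
        then have "norm (S_along T x) \<le> norm ((line_integral b x - line_integral (-1/2) x) / (2 * pi)) + \<bar>I x\<bar>"
          using norm_triangle_ineq4[of "(line_integral b x - line_integral (-1/2) x) / (2 * pi)" "of_real (I x)"] by simp
        also have "norm ((line_integral b x - line_integral (-1/2) x) / (2 * pi)) = norm (line_integral b x - line_integral (-1/2) x) / (2 * pi)"
          by (simp add: norm_divide)
        also have "\<dots> \<le> norm (line_integral b x - line_integral (-1/2) x) / 1"
          using pi2 by (intro divide_left_mono) auto
        also have "\<dots> \<le> norm (line_integral b x) + norm (line_integral (-1/2) x)" by (simp add: norm_triangle_ineq4)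
        also have "norm (line_integral b x) \<le> K1 * p"
        proof -
          have "norm (line_integral b x) \<le> K1 * x powr (b / 2)" using K1(2)[of x] elim by simp
          also have "\<dots> \<le> K1 * p" unfolding p_def using K1(1) b elim by (intro mult_left_mono powr_mono) auto
          finally show ?thesis .
        qed
        also have "norm (line_integral (-1/2) x) \<le> K2 * p" unfolding p_def using elim \<epsilon> by (intro K2') auto
        also have "\<bar>I x\<bar> \<le> K3 * p" unfolding p_def using elim \<epsilon> by (intro K3') auto
        finally have "norm (S_along T x) \<le> K1 * p + K2 * p + K3 * p" by simp
        also have "\<dots> \<le> (K1 + K2 + K3 + 1) * p" using p by (simp add: algebra_simps)
        finally show ?case by (simp add: p_def)
      qed
    qed (use K1 K2 K3 in auto)
  next
    assume O: "\<forall>\<epsilon>>0. S_along T \<in> O[at_top](\<lambda>x. of_real (x powr (1 / 4 + \<epsilon>)))"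
    have le: "Re \<rho> \<le> 1/2" if \<rho>: "\<rho> \<in> nontrivial_zeros" for \<rho>
    proof (rule field_le_epsilon)
      fix e :: real assume e: "e > 0"
      \<comment> \<open>The cap ensures 1/4 + \<epsilon> < 5/8, as
        \<open>zeros_bounded_by_growth\<close> requires.\<close>
      define \<epsilon> where "\<epsilon> = min (e / 2) (1/4)"
      have \<epsilon>: "\<epsilon> > 0" "\<epsilon> < 3/8" "2 * \<epsilon> \<le> e" using e by (auto simp: \<epsilon>_def)
      from O \<epsilon>(1) have "S_along T \<in> O[at_top](\<lambda>x. of_real (x powr (1 / 4 + \<epsilon>)))" by blast
      then obtain c where c: "c > 0" "\<forall>\<^sub>F x in at_top. norm (S_along T x) \<le> c * norm (complex_of_real (x powr (1/4 + \<epsilon>)))"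
        by (rule landau_o.bigE)
      then obtain x1 where x1: "\<And>x. x \<ge> x1 \<Longrightarrow> norm (S_along T x) \<le> c * x powr (1/4 + \<epsilon>)"
        by (auto simp: eventually_at_top_linorder)
      have "Re \<rho> \<le> 2 * (1/4 + \<epsilon>)"
      proof (rule zeros_bounded_by_growth[of "max x1 1" _ "2 * pi * (c + K3) + K2"])
        fix x :: real assume "x \<ge> max x1 1"
        then have x: "x \<ge> x1" "x \<ge> 1" by auto
        define p where "p = x powr (1/4 + \<epsilon>)"
        have "S_along T x = (line_integral (5/4) x - line_integral (-1/2) x) / (2 * pi) - of_real (I x)"
          using S[OF lim54] x by simp
        then have "line_integral (5/4) x = of_real (2 * pi) * (S_along T x + of_real (I x)) + line_integral (-1/2) x"
          by (simp add: field_simps)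
        then have "norm (line_integral (5/4) x) \<le> norm (of_real (2 * pi) * (S_along T x + of_real (I x))) + norm (line_integral (-1/2) x)"
          by (simp only: norm_triangle_ineq)
        also have "norm (of_real (2 * pi) * (S_along T x + of_real (I x))) = 2 * pi * norm (S_along T x + of_real (I x))"
          by (simp add: norm_mult)
        also have "norm (S_along T x + of_real (I x)) \<le> norm (S_along T x) + \<bar>I x\<bar>"
          using norm_triangle_ineq[of "S_along T x" "of_real (I x)"] by simp
        also have "norm (S_along T x) \<le> c * p" unfolding p_def by (rule x1[OF x(1)])
        also have "\<bar>I x\<bar> \<le> K3 * p" unfolding p_def using x \<epsilon> by (intro K3') auto
        also have "norm (line_integral (-1/2) x) \<le> K2 * p" unfolding p_def using x \<epsilon> by (intro K2') auto
        finally show "norm (line_integral (5/4) x) \<le> (2 * pi * (c + K3) + K2) * x powr (1/4 + \<epsilon>)"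
          by (simp add: p_def algebra_simps)
      qed (use \<epsilon> \<rho> in auto)
      then show "Re \<rho> \<le> 1/2 + e" using \<epsilon> by simp
    qed
    show "riemann_hypothesis"
      unfolding riemann_hypothesis_def
    proof
      fix \<rho> assume \<rho>: "\<rho> \<in> nontrivial_zeros"
      \<comment> \<open>The bound just proved gives Re \<rho> < 1, so reflection is available;
        applied to both zeros it forces equality.\<close>
      have "1 - \<rho> \<in> nontrivial_zeros" using nontrivial_zero_reflect[OF \<rho>] le[OF \<rho>] by simp
      from le[OF this] le[OF \<rho>] show "Re \<rho> = 1/2" by simp
    qed
  qed
  with adm show ?thesis by blast
qed

end
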